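(* Let $\mathcal{X}\subset\mathbb{R}^m$ be nonempty and compact, let $\xi$ be a random vector whose distribution is supported on $\Xi\subset\mathbb{R}^d$, let $G:\mathcal{X}\times\mathbb{R}^d\to\mathbb{R}$, $G_x:=G(x,\xi)$, and let $\xi_1,\dots,\xi_N$ be an i.i.d. sample of $\xi$. Suppose that: (i) $\mathcal{R}(Z)=\sup_{w\in\mathfrak{W}}\{w_0\mathbb{E}[Z]+\sum_{i=1}^kw_i\mathsf{AVaR}_{\alpha_i}(Z)\}$, where $0<\alpha_1<\dots<\alpha_k<1$ and $\mathfrak{W}$ is a nonempty closed convex subset of $\Delta_{k+1}=\{w\in\mathbb{R}^{k+1}_+:w_0+\dots+w_k=1\}$; (ii) the set $\mathcal{X}$ is convex and $G(x,\xi)$ is convex in $x$ for all $\xi\in\Xi$; (iii) for every $i\in\{1,\dots,k\}$ there exists $w\in\mathfrak{W}$ with $w_i\ne0$; (iv) $\mathbb{E}[G_x^2]$ is finite for some $x\in\mathcal{X}$; (v) there is a measurable function $C(\xi)$ such that $\mathbb{E}[C(\xi)^2]$ is finite and $|G(x,\xi)-G(x',\xi)|\le C(\xi)\|x-x'\|$ for all $x,x'\in\mathcal{X}$ and all $\xi\in\Xi$. Let $\vartheta_*=\inf_{x\in\mathcal{X}}\mathcal{R}(G_x)$, let $\hat\vartheta_N$ be the optimal value of its sample average approximation, and let $\overline{\mathfrak{W}}$ and $\overline{\mathcal{Y}}$ be the sets of optimal solutions defined in the context. Then, as $N\to\infty$, $$\hat\vartheta_N=\inf_{(x,\tau)\in\overline{\mathcal{Y}}}\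 \sup_{w\in\overline{\mathfrak{W}}}\Big\{\frac{w_0}{N}\sum_{j=1}^NG(x,\xi_j)+\sum_{i=1}^kw_i\Big(\tau_i+\frac{1}{N(1-\alpha_i)}\sum_{j=1}^N[G(x,\xi_j)-\tau_i]_+\Big)\Big\}+o_p(N^{-1/2}).$$ Moreover, if the sets $\overline{\mathfrak{W}}=\{w_*\}$ and $\overline{\mathcal{Y}}=\{(x_*,\tau_* )\}$ are singletons, then $N^{1/2}(\hat\vartheta_N-\vartheta_* )$ converges in distribution to the normal $\mathcal{N}(0,\nu_*^2)$ with variance $$\nu_*^2=\mathrm{Var}\Big\{w_{*0}G_{x_*}+\sum_{i=1}^k\frac{w_{*i}}{1-\alpha_i}\big[G_{x_*}-\tau_{*i}\big]_+\Big\}.$$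
   Context: $[a]_+=\max\{a,0\}$. For an integrable random variable $Z$ with cdf $F$ and $\alpha\in[0,1)$, $\mathsf{AVaR}_\alpha(Z)=\frac{1}{1-\alpha}\int_\alpha^1F^{-1}(\tau)\,d\tau$ with $F^{-1}(\tau)=\inf\{t:F(t)\ge\tau\}$; for $\alpha\in(0,1)$ it equals $\inf_{\tau\in\mathbb{R}}\{\tau+(1-\alpha)^{-1}\mathbb{E}[Z-\tau]_+\}$. For $z\in\mathbb{R}$, $w\in\mathbb{R}^{k+1}$, $\tau\in\mathbb{R}^k$ put $$\phi(z,w,\tau)=w_0z+\sum_{i=1}^kw_i\big(\tau_i+(1-\alpha_i)^{-1}[z-\tau_i]_+\big).$$ Then $\vartheta_*=\inf_{(x,\tau)\in\mathcal{X}\times\mathbb{R}^k}\sup_{w\in\mathfrak{W}}\mathbb{E}[\phi(G_x,w,\tau)]=\sup_{w\in\mathfrak{W}}\inf_{(x,\tau)\in\mathcal{X}\times\mathbb{R}^k}\mathbb{E}[\phi(G_x,w,\tau)]$. The set $\overline{\mathcal{Y}}\subset\mathcal{X}\times\mathbb{R}^k$ is the set of minimizers over $(x,\tau)\in\mathcal{X}\times\mathbb{R}^k$ of $\sup_{w\in\mathfrak{W}}\mathbb{E}[\phi(G_x,w,\tau)]$, and $\overline{\mathfrak{W}}$ is the set of maximizers over $w\in\mathfrak{W}$ of $\inf_{x\in\mathcal{X}}\{w_0\mathbb{E}[G_x]+\sum_{i=1}^kw_i\mathsf{AVaR}_{\alpha_i}(G_x)\}$. The sample average approximation (SAA) optimal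 value, obtained by replacing the distribution of $\xi$ with its empirical distribution, is $$\hat\vartheta_N=\inf_{(x,\tau)\in\mathcal{X}\times\mathbb{R}^k}\sup_{w\in\mathfrak{W}}\frac1N\sum_{j=1}^N\phi(G(x,\xi_j),w,\tau).$$ For each $x\in\mathcal{X}$, $G_x$ is assumed to be a (measurable) integrable random variable. $o_p(N^{-1/2})$ denotes a term which multiplied by $N^{1/2}$ tends to zero in probability. *)

theory Defs
  imports "HOL-Probability.Probability"
begin

text \<open>Left-continuous quantile \<open>F\<^sup>-\<^sup>1(\<tau>) = inf {t. F(t) \<ge> \<tau>}\<close> of the cdf \<open>F\<close> of \<open>Z\<close>.
  It is only meaningful for \<open>0 < \<tau> < 1\<close>, which is why the integral below is over the open interval.\<close>

definition quantile :: "'w measure \<Rightarrow> ('w \<Rightarrow> real) \<Rightarrow> real \<Rightarrow> real" where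
  "quantile M Z \<tau> = Inf {t. cdf (distr M borel Z) t \<ge> \<tau>}"

definition AVaR :: "'w measure \<Rightarrow> real \<Rightarrow> ('w \<Rightarrow> real) \<Rightarrow> real" where
  "AVaR M a Z = 1 / (1 - a) * (LINT \<tau>:{a<..<1}|lborel. quantile M Z \<tau>)"

text \<open>A vector \<open>w = (w\<^sub>0, w\<^sub>1, \<dots>, w\<^sub>k)\<close> of \<open>\<real>\<^sup>k\<^sup>+\<^sup>1\<close> is encoded as a pair in \<open>\<real> \<times> \<real>\<^sup>k\<close>, the
  first component being \<open>w\<^sub>0\<close>; the indices \<open>1, \<dots>, k\<close> are the elements of a finite linearly
  ordered type \<open>'k\<close>.\<close>

definition simplex_weights :: "(real \<times> (real ^ 'k)) set" where
  "simplex_weights = {w. 0 \<le> fst w \<and> (\<forall>i. 0 \<le> snd w $ i) \<and> fst w + (\<Sum>i\<in>UNIV. snd w $ i) = 1}"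

definition AVaR_mixture ::
  "'w measure \<Rightarrow> real ^ 'k \<Rightarrow> real \<times> (real ^ 'k) \<Rightarrow> ('w \<Rightarrow> real) \<Rightarrow> real" where
  "AVaR_mixture M \<alpha> w Z = fst w * (\<integral>\<omega>. Z \<omega> \<partial>M) + (\<Sum>i\<in>UNIV. snd w $ i * AVaR M (\<alpha> $ i) Z)"

definition risk ::
  "'w measure \<Rightarrow> real ^ 'k \<Rightarrow> (real \<times> (real ^ 'k)) set \<Rightarrow> ('w \<Rightarrow> real) \<Rightarrow> real" where
  "risk M \<alpha> W Z = (SUP w\<in>W. AVaR_mixture M \<alpha> w Z)"

definition phi :: "real ^ 'k \<Rightarrow> real \<Rightarrow> real \<times> (real ^ 'k) \<Rightarrow> real ^ 'k \<Rightarrow> real" where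
  "phi \<alpha> z w \<tau> =
     fst w * z + (\<Sum>i\<in>UNIV. snd w $ i * (\<tau> $ i + 1 / (1 - \<alpha> $ i) * max (z - \<tau> $ i) 0))"

text \<open>In the following \<open>Z x\<close> is the random variable \<open>G\<^sub>x\<close>.\<close>

definition opt_value ::
  "'w measure \<Rightarrow> real ^ 'k \<Rightarrow> (real \<times> (real ^ 'k)) set \<Rightarrow> 'x set \<Rightarrow> ('x \<Rightarrow> 'w \<Rightarrow> real) \<Rightarrow> real" where
  "opt_value M \<alpha> W X Z = (INF x\<in>X. risk M \<alpha> W (Z x))"

definition primal_solutions ::
  "'w measure \<Rightarrow> real ^ 'k \<Rightarrow> (real \<times> (real ^ 'k)) set \<Rightarrow> 'x set \<Rightarrow> ('x \<Rightarrow> 'w \<Rightarrow> real)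
     \<Rightarrow> ('x \<times> (real ^ 'k)) set" where
  "primal_solutions M \<alpha> W X Z =
     {p. is_arg_min (\<lambda>(x, \<tau>). SUP w\<in>W. \<integral>\<omega>. phi \<alpha> (Z x \<omega>) w \<tau> \<partial>M) (\<lambda>p. p \<in> X \<times> UNIV) p}"

definition dual_solutions ::
  "'w measure \<Rightarrow> real ^ 'k \<Rightarrow> (real \<times> (real ^ 'k)) set \<Rightarrow> 'x set \<Rightarrow> ('x \<Rightarrow> 'w \<Rightarrow> real)
     \<Rightarrow> (real \<times> (real ^ 'k)) set" where
  "dual_solutions M \<alpha> W X Z =
     {w. is_arg_max (\<lambda>w. INF x\<in>X. AVaR_mixture M \<alpha> w (Z x)) (\<lambda>w. w \<in> W) w}"

text \<open>Optimal value of the sample average approximation for the sample \<open>y\<^sub>0, \<dots>, y\<^sub>N\<^sub>-\<^sub>1\<close>.\<close>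

definition saa_value ::
  "real ^ 'k \<Rightarrow> (real \<times> (real ^ 'k)) set \<Rightarrow> 'x set \<Rightarrow> ('x \<Rightarrow> 'y \<Rightarrow> real) \<Rightarrow> nat \<Rightarrow> (nat \<Rightarrow> 'y) \<Rightarrow> real"
  where
  "saa_value \<alpha> W X G N y =
     (INF (x, \<tau>)\<in>X \<times> UNIV. SUP w\<in>W. 1 / real N * (\<Sum>j<N. phi \<alpha> (G x (y j)) w \<tau>))"

text \<open>The library functions \<^const>\<open>measure\<close> and \<^const>\<open>distr\<close> return junk values on
  non-measurable arguments, so both modes of convergence include measurability.\<close>

definition tendsto_zero_in_prob :: "'w measure \<Rightarrow> (nat \<Rightarrow> 'w \<Rightarrow> real) \<Rightarrow> bool" where
  "tendsto_zero_in_prob M Y \<longleftrightarrow>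
     (\<forall>N. Y N \<in> borel_measurable M) \<and>
     (\<forall>\<epsilon>>0. (\<lambda>N. measure M {\<omega> \<in> space M. \<bar>Y N \<omega>\<bar> > \<epsilon>}) \<longlonglongrightarrow> 0)"

definition converges_in_distribution :: "'w measure \<Rightarrow> (nat \<Rightarrow> 'w \<Rightarrow> real) \<Rightarrow> real measure \<Rightarrow> bool"
  where
  "converges_in_distribution M Y L \<longleftrightarrow>
     (\<forall>N. Y N \<in> borel_measurable M) \<and> weak_conv_m (\<lambda>N. distr M borel (Y N)) L"

text \<open>The normal distribution with variance \<open>v \<ge> 0\<close>, which for \<open>v = 0\<close> is a point mass.\<close>

definition normal_law :: "real \<Rightarrow> real \<Rightarrow> real measure" where
  "normal_law \<mu> v =
     (if v = 0 then return borel \<mu> else density lborel (\<lambda>t. ennreal (normal_density \<mu> (sqrt v) t)))"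

text \<open>A term \<open>r\<^sub>N\<close> is \<open>o\<^sub>p(N\<^sup>-\<^sup>1\<^sup>/\<^sup>2)\<close> on the probability space \<open>M\<close>. Both here and in the central limit
  statement the space is meant to be completed: an optimal value such as \<^const>\<open>saa_value\<close> is an
  infimum over an uncountable set and in general is a measurable function of the sample only up
  to a null set (the one on which the sample leaves the support). When the variables are
  measurable, the completion changes nothing.\<close>

definition op_inv_sqrt :: "'w measure \<Rightarrow> (nat \<Rightarrow> 'w \<Rightarrow> real) \<Rightarrow> bool" where
  "op_inv_sqrt M r \<longleftrightarrow> tendsto_zero_in_prob (completion M) (\<lambda>N \<omega>. sqrt (real N) * r N \<omega>)"

end

theory Submission
  imports Defs
begin

text \<open>Let \<open>A\<close> be the vector of expected losses as a function of \<open>y = (x, \<tau>)\<close> and \<open>A\<^sub>N\<close> its sample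
  average, so that both problems are minimax problems for \<open>w \<bullet> A y\<close>, convex in \<open>y\<close> and linear in \<open>w\<close>.
  Let \<open>(y\<^sub>N, w\<^sub>N)\<close> be a saddle point of the sample problem. Comparing \<open>w\<^sub>N\<close> with a nearby dual
  solution, at any primal solution, bounds the sample value from above; comparing \<open>y\<^sub>N\<close> with a nearby
  primal solution, at any dual solution, bounds it from below. On pairs of solutions \<open>w \<bullet> A y\<close> is
  constant, so the error is at most the modulus of continuity of \<open>w \<bullet> (A\<^sub>N y - A y)\<close>, and this is
  \<open>o\<^sub>p(N\<^sup>-\<^sup>1\<^sup>/\<^sup>2)\<close> by chaining: with Lipschitz envelopes truncated at \<open>\<surd>N / 2\<close> the normalized
  increments have exponential tails uniformly in \<open>N\<close>, and square integrability makes the truncation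
  negligible. For singletons the remaining term is an i.i.d. average, to which the central limit
  theorem and Slutsky's lemma apply.\<close>

section \<open>Saddle points\<close>

text \<open>The variable y = (x, \<tau>) is unbounded in \<tau>, while every probabilistic estimate
  lives on a bounded set. By \<open>W_nonzero\<close> and convexity, W contains a w with all w_i >
  0; it bounds the \<tau>-part of sublevel sets by a radius that depends only on a bound for E|G_x|.
  A square-integrable majorant of all |G_x| has sample means close to its expectation, so one
  compact box K holds the true minimizers and, with high probability, the sample minimizers. Nothing
  is known about A_N - A outside K; since K contains the points of X x R^k near the true minimizers,
  convexity in y carries lower bounds from K to all y. At a fixed outcome the sample problem is the
  same minimax problem for the uniform distribution on the sample indices, so saddle points are
  constructed once for both, and the comparison of the two problems is deterministic. Uniform
  closeness of A_N to A only serves to locate the sample saddle point; the size of the error comes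
  from the joint modulus in (y, w) alone. Suprema over uncountable sets may fail to be measurable,
  so events are handled through measurable exceptional sets.\<close>

definition support_fun :: "'e::real_inner set \<Rightarrow> 'e \<Rightarrow> real" where
  "support_fun W s = (SUP w\<in>W. inner w s)"

context
  fixes W :: "'e::euclidean_space set"
  assumes W: "compact W" "W \<noteq> {}"
begin

lemma bdd_above_inner: "bdd_above ((\<lambda>w. inner w s) ` W)"
  by (intro bounded_imp_bdd_above compact_imp_bounded compact_continuous_image continuous_intros W)

lemma inner_le_support_fun: "w \<in> W \<Longrightarrow> inner w s \<le> support_fun W s"
  unfolding support_fun_def by (rule cSUP_upper[OF _ bdd_above_inner])

lemma support_fun_attained: obtains w where "w \<in> W" "support_fun W s = inner w s"
proof -
  have "continuous_on W (\<lambda>w. inner w s)" by (intro continuous_intros)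
  then obtain w where w: "w \<in> W" "\<And>w'. w' \<in> W \<Longrightarrow> inner w' s \<le> inner w s"
    using continuous_attains_sup[OF W] by blast
  have "support_fun W s = inner w s"
    unfolding support_fun_def by (intro cSup_eq_maximum) (use w in auto)
  with w show thesis by (blast intro: that)
qed

lemma support_fun_le_iff: "support_fun W s \<le> c \<longleftrightarrow> (\<forall>w\<in>W. inner w s \<le> c)"
  by (metis inner_le_support_fun order_trans support_fun_attained)

lemma continuous_on_support_fun: "continuous_on S (support_fun W)"
proof -
  obtain B where B: "B > 0" "\<And>w. w \<in> W \<Longrightarrow> norm w \<le> B"
    using compact_imp_bounded[OF W(1)] bounded_pos by metis
  have le: "support_fun W s \<le> support_fun W t + B * dist s t" for s t
  proof -
    have "inner w s \<le> support_fun W t + B * dist s t" if w: "w \<in> W" for w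
    proof -
      have "inner w s = inner w t + inner w (s - t)" by (simp add: inner_diff_right)
      also have "inner w (s - t) \<le> norm w * norm (s - t)" by (rule norm_cauchy_schwarz)
      also have "\<dots> \<le> B * dist s t"
        by (simp add: dist_norm B(2)[OF w] mult_right_mono)
      also have "inner w t \<le> support_fun W t" by (rule inner_le_support_fun[OF w])
      finally show ?thesis by simp
    qed
    then show ?thesis by (simp add: support_fun_le_iff)
  qed
  have "B-lipschitz_on S (support_fun W)"
  proof (rule lipschitz_onI)
    fix s t
    show "dist (support_fun W s) (support_fun W t) \<le> B * dist s t"
      using le[of s t] le[of t s] by (auto simp: dist_real_def dist_commute abs_le_iff)
  qed (use B in simp)
  then show ?thesis by (rule lipschitz_on_continuous_on)
qed

lemma support_fun_scaleR: "t \<ge> 0 \<Longrightarrow> support_fun W (t *\<^sub>R s) = t * support_fun W s"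
proof (rule antisym)
  assume t: "t \<ge> 0"
  show "support_fun W (t *\<^sub>R s) \<le> t * support_fun W s"
    using t by (auto simp: support_fun_le_iff intro!: mult_left_mono inner_le_support_fun)
  obtain w where "w \<in> W" "support_fun W s = inner w s" by (rule support_fun_attained)
  then show "t * support_fun W s \<le> support_fun W (t *\<^sub>R s)"
    using inner_le_support_fun[of w "t *\<^sub>R s"] by simp
qed

text \<open>Converse of \<open>inner_le_support_fun\<close> for compact convex sets: the normal of a
  hyperplane separating c from W would violate the hypothesis, with the sign chosen so that c lies
  on the far side.\<close>

lemma mem_if_inner_le_support_fun:
  assumes "convex W" "\<And>s. inner c s \<le> support_fun W s"
  shows "c \<in> W"
proof (rule ccontr)
  assume "c \<notin> W"
  then obtain a b where ab: "inner a c < b" "\<And>x. x \<in> W \<Longrightarrow> inner a x > b"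
    using separating_hyperplane_closed_point[OF assms(1) compact_imp_closed[OF W(1)]] by blast
  obtain w where w: "w \<in> W" "support_fun W (- a) = inner w (- a)" by (rule support_fun_attained)
  show False
    using assms(2)[of "- a"] ab(1) ab(2)[OF w(1)] w(2) by (simp add: inner_commute)
qed

end

text \<open>The vector \<open>e0\<close> is the trace of the normalization of the weights: moving s
  by a multiple of \<open>e0\<close> shifts \<open>inner w s\<close> by the same constant for all w
  in W. Attainment is assumed instead of compactness of Y, because \<tau> ranges over a whole
  space.\<close>

locale bilinear_saddle =
  fixes W :: "'e::euclidean_space set" and e0 :: 'e
    and Y :: "'y::real_normed_vector set" and A :: "'y \<Rightarrow> 'e"
  assumes W: "compact W" "W \<noteq> {}" "convex W"
    and e0: "\<And>w. w \<in> W \<Longrightarrow> inner w e0 = 1"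
    and Y: "convex Y"
    and A_convex: "\<And>w. w \<in> W \<Longrightarrow> convex_on Y (\<lambda>y. inner w (A y))"
    and A_cont: "continuous_on Y A"
    and attained: "\<exists>y\<in>Y. \<forall>y'\<in>Y. support_fun W (A y) \<le> support_fun W (A y')"
begin

definition saddle_value where "saddle_value = (INF y\<in>Y. support_fun W (A y))"
definition minimizers where "minimizers = {y\<in>Y. support_fun W (A y) \<le> saddle_value}"
text \<open>Phrased by lower bounds rather than as the maximizers of an infimum over Y, which on the
  reals is a junk value when the payoff is unbounded below. The two notions agree once
  \<open>maximizers_nonempty\<close> provides strong duality.\<close>

definition maximizers where "maximizers = {w\<in>W. \<forall>y\<in>Y. saddle_value \<le> inner w (A y)}"

lemma obtain_minimizer:
  obtains y where "y \<in> Y" "support_fun W (A y) = saddle_value"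
    "\<And>y'. y' \<in> Y \<Longrightarrow> saddle_value \<le> support_fun W (A y')"
proof -
  obtain y where y: "y \<in> Y" "\<And>y'. y' \<in> Y \<Longrightarrow> support_fun W (A y) \<le> support_fun W (A y')"
    using attained by blast
  have "saddle_value = support_fun W (A y)"
    unfolding saddle_value_def by (intro cInf_eq_minimum) (use y in auto)
  with y show thesis by (intro that[of y]) auto
qed

lemma minimizers_nonempty: "minimizers \<noteq> {}"
  unfolding minimizers_def by (rule obtain_minimizer) auto

lemma saddle_value_le: "y \<in> Y \<Longrightarrow> saddle_value \<le> support_fun W (A y)"
  by (rule obtain_minimizer) auto

lemma minimizers_inner_le: "y \<in> minimizers \<Longrightarrow> w \<in> W \<Longrightarrow> inner w (A y) \<le> saddle_value"
  by (auto simp: minimizers_def support_fun_le_iff W)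

lemma saddle_inner_eq:
  assumes "y \<in> minimizers" "w \<in> maximizers"
  shows "inner w (A y) = saddle_value"
  using assms minimizers_inner_le[of y w]
  by (auto simp: maximizers_def minimizers_def intro!: antisym)

text \<open>Separate the upward closure \<open>S\<close> of the values of \<open>A\<close> from the sublevel set \<open>P\<close>
  of the support function. Since \<open>e0\<close> allows every vector to be pushed into \<open>P\<close>, the normal vector,
  scaled to have inner product \<open>1\<close> with \<open>e0\<close>, is dominated by the support function of \<open>W\<close>.\<close>

lemma maximizers_nonempty: "maximizers \<noteq> {}"
proof -
  define v where "v = saddle_value"
  define S where "S = {s. \<exists>y\<in>Y. \<forall>w\<in>W. inner w (A y) \<le> inner w s}"
  define P where "P = {s. \<forall>w\<in>W. inner w s < v}"
  obtain y0 where y0: "y0 \<in> Y" by (rule obtain_minimizer)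
  have "convex S"
    unfolding convex_def
  proof (intro ballI allI impI)
    fix s t :: 'e and p q :: real
    assume st: "s \<in> S" "t \<in> S" and pq: "0 \<le> p" "0 \<le> q" "p + q = 1"
    obtain y z where y: "y \<in> Y" "\<And>w. w \<in> W \<Longrightarrow> inner w (A y) \<le> inner w s"
      and z: "z \<in> Y" "\<And>w. w \<in> W \<Longrightarrow> inner w (A z) \<le> inner w t"
      using st unfolding S_def by blast
    have "inner w (A (p *\<^sub>R y + q *\<^sub>R z)) \<le> inner w (p *\<^sub>R s + q *\<^sub>R t)" if w: "w \<in> W" for w
    proof -
      have "inner w (A (p *\<^sub>R y + q *\<^sub>R z)) \<le> p * inner w (A y) + q * inner w (A z)"
        using A_convex[OF w] y(1) z(1) pq unfolding convex_on_def by blast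
      also have "\<dots> \<le> p * inner w s + q * inner w t"
        by (intro add_mono mult_left_mono y z pq w)
      finally show ?thesis by (simp add: inner_add_right)
    qed
    moreover have "p *\<^sub>R y + q *\<^sub>R z \<in> Y"
      using Y y z pq by (auto simp: convex_def)
    ultimately show "p *\<^sub>R s + q *\<^sub>R t \<in> S" unfolding S_def by blast
  qed
  moreover have "convex P"
  proof -
    have "P = (\<Inter>w\<in>W. {s. inner w s < v})" unfolding P_def by auto
    then show ?thesis by (auto intro: convex_INT convex_halfspace_lt)
  qed
  moreover have "A y0 \<in> S" using y0 unfolding S_def by blast
  moreover have push: "s - (support_fun W s - v + \<epsilon>) *\<^sub>R e0 \<in> P" if "\<epsilon> > 0" for s \<epsilon>
    using inner_le_support_fun[OF W(1,2), of _ s] that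
    by (fastforce simp: P_def inner_diff_right e0)
  moreover have "S \<inter> P = {}"
  proof -
    have False if s: "s \<in> S" "s \<in> P" for s
    proof -
      obtain y where y: "y \<in> Y" "\<And>w. w \<in> W \<Longrightarrow> inner w (A y) \<le> inner w s"
        using s(1) unfolding S_def by blast
      obtain w where w: "w \<in> W" "support_fun W (A y) = inner w (A y)"
        by (rule support_fun_attained[OF W(1,2)])
      show False
        using saddle_value_le[OF y(1)] w y(2)[OF w(1)] s(2) unfolding P_def v_def by fastforce
    qed
    then show ?thesis by blast
  qed
  ultimately obtain a b where ab: "a \<noteq> 0" "\<And>x. x \<in> P \<Longrightarrow> inner a x \<le> b" "\<And>x. x \<in> S \<Longrightarrow> inner a x \<ge> b"
    using separating_hyperplane_sets[of P S] by (metis Int_commute empty_iff zero_less_one)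
  define \<kappa> where "\<kappa> = inner a e0"
  have bound: "inner a s - (support_fun W s - v + \<epsilon>) * \<kappa> \<le> b" if "\<epsilon> > 0" for s \<epsilon>
    using ab(2)[OF push[OF that, of s]] by (simp add: inner_diff_right \<kappa>_def)
  \<comment> \<open>S is closed under adding nonnegative multiples of \<open>e0\<close>. If \<kappa>
    were negative, the t below would bring the separating functional down to b - 1 on S.\<close>
  have "\<kappa> \<ge> 0"
  proof (rule ccontr)
    assume "\<not> \<kappa> \<ge> 0"
    define t where "t = (inner a (A y0) - b + 1) / (- \<kappa>)"
    have "inner a (A y0) \<ge> b" using ab(3) \<open>A y0 \<in> S\<close> by blast
    then have "t \<ge> 0" using \<open>\<not> \<kappa> \<ge> 0\<close> by (simp add: t_def divide_le_0_iff)
    then have "A y0 + t *\<^sub>R e0 \<in> S"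
      using y0 unfolding S_def by (auto simp: inner_add_right e0 intro!: bexI[of _ y0])
    then have "b \<le> inner a (A y0) + t * \<kappa>"
      using ab(3) by (fastforce simp: inner_add_right \<kappa>_def)
    moreover have "t * \<kappa> = - (inner a (A y0) - b + 1)" using \<open>\<not> \<kappa> \<ge> 0\<close> by (simp add: t_def)
    ultimately show False by simp
  qed
  \<comment> \<open>The support function is positively homogeneous: \<open>bound\<close> at t s,
    with t large, leaves only the terms linear in t.\<close>
  have dom: "inner a s \<le> support_fun W s * \<kappa>" for s
  proof (rule ccontr)
    assume "\<not> ?thesis"
    then have d: "inner a s - support_fun W s * \<kappa> > 0" (is "?d > 0") by simp
    define t where "t = (\<bar>b + (1 - v) * \<kappa>\<bar> + 1) / ?d"
    have t: "t \<ge> 0" using d by (simp add: t_def)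
    have "t * ?d \<le> b + (1 - v) * \<kappa>"
      using bound[of 1 "t *\<^sub>R s"] t by (simp add: support_fun_scaleR[OF W(1,2)] algebra_simps)
    moreover have "t * ?d = \<bar>b + (1 - v) * \<kappa>\<bar> + 1" using d by (simp add: t_def)
    ultimately show False by linarith
  qed
  have "\<kappa> > 0"
  proof (rule ccontr)
    assume "\<not> \<kappa> > 0"
    with \<open>\<kappa> \<ge> 0\<close> have "\<kappa> = 0" by simp
    then have "inner a a \<le> 0" using dom[of a] by simp
    with ab(1) show False by (metis inner_gt_zero_iff not_le)
  qed
  define c where "c = (1 / \<kappa>) *\<^sub>R a"
  have "c \<in> W"
  proof (rule mem_if_inner_le_support_fun[OF W(1,2,3)])
    show "inner c s \<le> support_fun W s" for s
      using dom[of s] \<open>\<kappa> > 0\<close> by (simp add: c_def field_simps)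
  qed
  moreover have "v \<le> inner c (A y)" if y: "y \<in> Y" for y
  proof (rule field_le_epsilon)
    fix \<epsilon> :: real assume \<epsilon>: "\<epsilon> > 0"
    have "support_fun W 0 = 0" using support_fun_scaleR[OF W(1,2), of 0 0] by simp
    then have "(v - \<epsilon>) * \<kappa> \<le> b" using bound[OF \<epsilon>, of 0] by (simp add: algebra_simps)
    also have "b \<le> inner a (A y)" using ab(3) y unfolding S_def by blast
    finally have "v - \<epsilon> \<le> inner a (A y) / \<kappa>" using \<open>\<kappa> > 0\<close> by (simp add: pos_le_divide_eq)
    then show "v \<le> inner c (A y) + \<epsilon>" by (simp add: c_def)
  qed
  ultimately have "c \<in> maximizers" unfolding maximizers_def v_def by simp
  then show ?thesis by blast
qed

lemma compact_maximizers: "compact maximizers"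
proof -
  have "maximizers = W \<inter> (\<Inter>y\<in>Y. {w. saddle_value \<le> inner w (A y)})"
    unfolding maximizers_def by auto
  moreover have "closed (\<Inter>y\<in>Y. {w. saddle_value \<le> inner w (A y)})"
    by (intro closed_INT ballI closed_Collect_le continuous_intros)
  ultimately show ?thesis using W(1) by (simp add: compact_Int_closed)
qed

text \<open>On the compact part of K at distance at least h from all minimizers, the objective
  attains a minimum, which exceeds the optimal value. Half of this gap serves as \<eta>; if that
  part is empty, any \<eta> does.\<close>

lemma near_minimizers:
  assumes K: "compact K" "K \<subseteq> Y" and h: "h > 0"
  obtains \<eta> where "\<eta> > 0"
    "\<And>y. y \<in> K \<Longrightarrow> support_fun W (A y) \<le> saddle_value + \<eta> \<Longrightarrow> \<exists>y'\<in>minimizers. dist y y' \<le> h"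
proof -
  define K' where "K' = K \<inter> (\<Inter>y'\<in>minimizers. {y. h \<le> dist y y'})"
  have "compact K'"
    unfolding K'_def
    by (intro compact_Int_closed K closed_INT ballI closed_Collect_le continuous_intros)
  have cont: "continuous_on K' (\<lambda>y. support_fun W (A y))"
    by (intro continuous_on_compose2[OF continuous_on_support_fun[OF W(1,2), of UNIV]]
        continuous_on_subset[OF A_cont]) (use K in \<open>auto simp: K'_def\<close>)
  show thesis
  proof (cases "K' = {}")
    case True
    show thesis
    proof (rule that[of 1])
      fix y assume "y \<in> K"
      with True show "\<exists>y'\<in>minimizers. dist y y' \<le> h"
        by (force simp: K'_def)
    qed simp
  next
    case False
    then obtain y1 where y1: "y1 \<in> K'" "\<And>y. y \<in> K' \<Longrightarrow> support_fun W (A y1) \<le> support_fun W (A y)"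
      using continuous_attains_inf[OF \<open>compact K'\<close> _ cont] by blast
    have "y1 \<notin> minimizers" using y1(1) h by (auto simp: K'_def)
    then have gt: "support_fun W (A y1) > saddle_value"
      using y1(1) K by (auto simp: minimizers_def K'_def)
    show thesis
    proof (rule that[of "(support_fun W (A y1) - saddle_value) / 2"])
      fix y assume y: "y \<in> K" "support_fun W (A y) \<le> saddle_value + (support_fun W (A y1) - saddle_value) / 2"
      then have "y \<notin> K'" using y1(2)[of y] gt by (force simp: field_simps)
      with y(1) show "\<exists>y'\<in>minimizers. dist y y' \<le> h" by (force simp: K'_def)
    qed (use gt in simp)
  qed
qed

text \<open>The set \<open>K\<close> is only a neighbourhood of a minimizer, but by convexity a lower bound there
  holds on all of \<open>Y\<close>.\<close>

lemma maximizer_if_on_neighbourhood: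
  assumes y0: "y0 \<in> minimizers"
    and K: "\<And>y. y \<in> Y \<Longrightarrow> \<exists>t>0. t \<le> 1 \<and> (1 - t) *\<^sub>R y0 + t *\<^sub>R y \<in> K"
    and w: "w \<in> W" "\<And>y. y \<in> K \<Longrightarrow> saddle_value \<le> inner w (A y)"
  shows "w \<in> maximizers"
proof -
  have "saddle_value \<le> inner w (A y)" if y: "y \<in> Y" for y
  proof -
    obtain t where t: "t > 0" "t \<le> 1" "(1 - t) *\<^sub>R y0 + t *\<^sub>R y \<in> K" using K[OF y] by blast
    have "saddle_value \<le> inner w (A ((1 - t) *\<^sub>R y0 + t *\<^sub>R y))" by (rule w(2)[OF t(3)])
    also have "\<dots> \<le> (1 - t) * inner w (A y0) + t * inner w (A y)"
      by (rule convex_onD[OF A_convex[OF w(1)]]) (use t y y0 in \<open>auto simp: minimizers_def\<close>)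
    also have "(1 - t) * inner w (A y0) \<le> (1 - t) * saddle_value"
      by (intro mult_left_mono minimizers_inner_le[OF y0 w(1)]) (use t in simp)
    finally have "t * saddle_value \<le> t * inner w (A y)" by (simp add: algebra_simps)
    then show ?thesis using t by simp
  qed
  with w show ?thesis by (simp add: maximizers_def)
qed

text \<open>By compactness of W, a sequence of nearly optimal w that stays farther than h from the
  maximizers has a limit point, and \<open>maximizer_if_on_neighbourhood\<close> makes this limit a
  maximizer. Lower bounds are requested on K only, since that is where the perturbed payoff is
  controlled.\<close>

lemma near_maximizers:
  assumes y0: "y0 \<in> minimizers"
    and K: "\<And>y. y \<in> Y \<Longrightarrow> \<exists>t>0. t \<le> 1 \<and> (1 - t) *\<^sub>R y0 + t *\<^sub>R y \<in> K"
    and h: "h > 0"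
  obtains \<eta> where "\<eta> > 0"
    "\<And>w. w \<in> W \<Longrightarrow> (\<And>y. y \<in> K \<Longrightarrow> saddle_value - \<eta> \<le> inner w (A y)) \<Longrightarrow> \<exists>w'\<in>maximizers. dist w w' \<le> h"
proof (rule ccontr)
  assume no: "\<not> thesis"
  have "\<exists>w\<in>W. (\<forall>y\<in>K. saddle_value - 1 / real (Suc n) \<le> inner w (A y)) \<and> (\<forall>w'\<in>maximizers. dist w w' > h)" for n
    using no that[of "1 / real (Suc n)"] by force
  then obtain w where w: "\<And>n. w n \<in> W" "\<And>n y. y \<in> K \<Longrightarrow> saddle_value - 1 / real (Suc n) \<le> inner (w n) (A y)"
    "\<And>n w'. w' \<in> maximizers \<Longrightarrow> dist (w n) w' > h"
    by metis
  obtain l r where l: "l \<in> W" "strict_mono r" "(w \<circ> r) \<longlonglongrightarrow> l"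
    using W(1) w(1) unfolding compact_def by metis
  have "l \<in> maximizers"
  proof (rule maximizer_if_on_neighbourhood[OF y0 K l(1)])
    fix y assume y: "y \<in> K"
    have "(\<lambda>n. saddle_value - 1 / real (Suc (r n))) \<longlonglongrightarrow> saddle_value - 0"
      using LIMSEQ_subseq_LIMSEQ[OF LIMSEQ_inverse_real_of_nat l(2)]
      by (intro tendsto_intros) (simp add: o_def inverse_eq_divide)
    moreover have "(\<lambda>n. inner (w (r n)) (A y)) \<longlonglongrightarrow> inner l (A y)"
      using l(3) by (intro tendsto_intros) (simp add: o_def)
    ultimately show "saddle_value \<le> inner l (A y)"
      using w(2)[OF y] by (intro LIMSEQ_le[of _ saddle_value _ "inner l (A y)"]) auto
  qed
  then have "dist ((w \<circ> r) n) l > h" for n using w(3) by simp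
  moreover have "eventually (\<lambda>n. dist ((w \<circ> r) n) l < h) sequentially"
    using l(3) h by (auto simp: tendsto_iff)
  ultimately show False
    by (metis (no_types, lifting) eventually_sequentially order.refl not_less_iff_gr_or_eq)
qed

text \<open>B and \<epsilon> are quantified inside because one \<eta> must serve all sample sizes
  and outcomes, with B the sample average and \<epsilon> of order 1 / sqrt N. Closeness up to
  \<eta>, which need not be small compared with \<epsilon>, does not enter the final bound.\<close>

definition perturbation_stable :: "'y set \<Rightarrow> real \<Rightarrow> real \<Rightarrow> bool" where
  "perturbation_stable K h \<eta> \<longleftrightarrow> (\<forall>B \<epsilon>.
     bilinear_saddle W e0 Y B \<and> bilinear_saddle.minimizers W Y B \<inter> K \<noteq> {} \<and>
     (\<forall>y\<in>K. \<forall>w\<in>W. \<bar>inner w (B y) - inner w (A y)\<bar> \<le> \<eta>) \<and>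
     (\<forall>y\<in>K. \<forall>y'\<in>K. \<forall>w\<in>W. \<forall>w'\<in>W. dist (y, w) (y', w') \<le> h \<longrightarrow>
        \<bar>(inner w (B y) - inner w (A y)) - (inner w' (B y') - inner w' (A y'))\<bar> \<le> \<epsilon>) \<longrightarrow>
     \<bar>bilinear_saddle.saddle_value W Y B - (INF y\<in>minimizers. support_fun maximizers (B y))\<bar> \<le> \<epsilon>)"

lemma perturbation_stableD:
  assumes "perturbation_stable K h \<eta>" "bilinear_saddle W e0 Y B" "bilinear_saddle.minimizers W Y B \<inter> K \<noteq> {}"
    "\<And>y w. y \<in> K \<Longrightarrow> w \<in> W \<Longrightarrow> \<bar>inner w (B y) - inner w (A y)\<bar> \<le> \<eta>"
    "\<And>y y' w w'. y \<in> K \<Longrightarrow> y' \<in> K \<Longrightarrow> w \<in> W \<Longrightarrow> w' \<in> W \<Longrightarrow> dist (y, w) (y', w') \<le> h \<Longrightarrow>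
       \<bar>(inner w (B y) - inner w (A y)) - (inner w' (B y') - inner w' (A y'))\<bar> \<le> \<epsilon>"
  shows "\<bar>bilinear_saddle.saddle_value W Y B - (INF y\<in>minimizers. support_fun maximizers (B y))\<bar> \<le> \<epsilon>"
  using assms unfolding perturbation_stable_def by blast

theorem exists_perturbation_stable:
  assumes K: "compact K" "K \<subseteq> Y" "minimizers \<subseteq> K"
    and K_abs: "\<And>y0 y. y0 \<in> minimizers \<Longrightarrow> y \<in> Y \<Longrightarrow> \<exists>t>0. t \<le> 1 \<and> (1 - t) *\<^sub>R y0 + t *\<^sub>R y \<in> K"
    and h: "h > 0"
  shows "\<exists>\<eta>>0. perturbation_stable K h \<eta>"
proof -
  obtain y0 where y0: "y0 \<in> minimizers" using minimizers_nonempty by blast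
  obtain \<eta>1 where \<eta>1: "\<eta>1 > 0"
    "\<And>y. y \<in> K \<Longrightarrow> support_fun W (A y) \<le> saddle_value + \<eta>1 \<Longrightarrow> \<exists>y'\<in>minimizers. dist y y' \<le> h"
    using near_minimizers[OF K(1,2) h] by blast
  obtain \<eta>2 where \<eta>2: "\<eta>2 > 0"
    "\<And>w. w \<in> W \<Longrightarrow> (\<And>y. y \<in> K \<Longrightarrow> saddle_value - \<eta>2 \<le> inner w (A y)) \<Longrightarrow> \<exists>w'\<in>maximizers. dist w w' \<le> h"
    using near_maximizers[OF y0 K_abs[OF y0] h] by blast
  \<comment> \<open>Halved because \<eta> is lost twice: once when B replaces A in the payoff and
    once when the saddle value of B replaces that of A.\<close>
  define \<eta> where "\<eta> = min \<eta>1 \<eta>2 / 2"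
  have "\<eta> > 0" using \<eta>1 \<eta>2 by (simp add: \<eta>_def)
  moreover have "perturbation_stable K h \<eta>"
    unfolding perturbation_stable_def
  proof (intro allI impI, elim conjE)
    fix B \<epsilon>
    assume B: "bilinear_saddle W e0 Y B" and nonempty: "bilinear_saddle.minimizers W Y B \<inter> K \<noteq> {}"
      and close': "\<forall>y\<in>K. \<forall>w\<in>W. \<bar>inner w (B y) - inner w (A y)\<bar> \<le> \<eta>"
      and modulus': "\<forall>y\<in>K. \<forall>y'\<in>K. \<forall>w\<in>W. \<forall>w'\<in>W. dist (y, w) (y', w') \<le> h \<longrightarrow>
         \<bar>(inner w (B y) - inner w (A y)) - (inner w' (B y') - inner w' (A y'))\<bar> \<le> \<epsilon>"
    have close: "\<bar>inner w (B y) - inner w (A y)\<bar> \<le> \<eta>" if "y \<in> K" "w \<in> W" for y w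
      using close' that by blast
    have modulus: "\<bar>(inner w (B y) - inner w (A y)) - (inner w' (B y') - inner w' (A y'))\<bar> \<le> \<epsilon>"
      if "y \<in> K" "y' \<in> K" "w \<in> W" "w' \<in> W" "dist (y, w) (y', w') \<le> h" for y y' w w'
      using modulus' that by blast
    interpret B: bilinear_saddle W e0 Y B by (rule B)
    obtain yh where yh: "yh \<in> B.minimizers" "yh \<in> K" using nonempty by blast
    obtain wh where wh: "wh \<in> B.maximizers" using B.maximizers_nonempty by blast
    have whW: "wh \<in> W" using wh by (simp add: B.maximizers_def)
    have supB: "support_fun W (B yh) \<le> B.saddle_value" using yh by (simp add: B.minimizers_def)
    have v_le: "saddle_value \<le> B.saddle_value + \<eta>"
    proof -
      obtain w where w: "w \<in> W" "support_fun W (A yh) = inner w (A yh)"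
        by (rule support_fun_attained[OF W(1,2)])
      have "saddle_value \<le> inner w (A yh)" using saddle_value_le[of yh] yh K(2) w(2) by auto
      also have "\<dots> \<le> inner w (B yh) + \<eta>" using close[OF yh(2) w(1)] by linarith
      also have "inner w (B yh) \<le> B.saddle_value" by (rule B.minimizers_inner_le[OF yh(1) w(1)])
      finally show ?thesis by simp
    qed
    have le_v: "B.saddle_value \<le> saddle_value + \<eta>"
    proof -
      have "B.saddle_value \<le> inner wh (B y0)"
        using wh y0 by (auto simp: B.maximizers_def minimizers_def)
      also have "\<dots> \<le> inner wh (A y0) + \<eta>" using close[of y0 wh] y0 K(3) whW by fastforce
      also have "inner wh (A y0) \<le> saddle_value" by (rule minimizers_inner_le[OF y0 whW])
      finally show ?thesis by simp
    qed
    obtain w' where w': "w' \<in> maximizers" "dist wh w' \<le> h"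
    proof -
      have "saddle_value - \<eta>2 \<le> inner wh (A y)" if y: "y \<in> K" for y
      proof -
        have "B.saddle_value \<le> inner wh (B y)" using wh y K(2) by (auto simp: B.maximizers_def)
        also have "\<dots> \<le> inner wh (A y) + \<eta>" using close[OF y whW] by linarith
        finally show ?thesis using v_le \<eta>1(1) by (simp add: \<eta>_def)
      qed
      then show thesis using \<eta>2(2)[OF whW] that by blast
    qed
    obtain y' where y': "y' \<in> minimizers" "dist yh y' \<le> h"
    proof -
      have "support_fun W (A yh) \<le> saddle_value + \<eta>1"
        unfolding support_fun_le_iff[OF W(1,2)]
      proof
        fix w assume w: "w \<in> W"
        have "inner w (A yh) \<le> inner w (B yh) + \<eta>" using close[OF yh(2) w] by linarith
        also have "inner w (B yh) \<le> B.saddle_value" by (rule B.minimizers_inner_le[OF yh(1) w])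
        finally show "inner w (A yh) \<le> saddle_value + \<eta>1" using le_v \<eta>2(1) by (simp add: \<eta>_def)
      qed
      then show thesis using \<eta>1(2)[OF yh(2)] that by blast
    qed
    have max_W: "maximizers \<subseteq> W" by (auto simp: maximizers_def)
    have upper: "B.saddle_value - \<epsilon> \<le> support_fun maximizers (B y)" if y: "y \<in> minimizers" for y
    proof -
      have "B.saddle_value \<le> inner wh (B y)"
        using wh y by (auto simp: B.maximizers_def minimizers_def)
      also have "\<dots> \<le> inner w' (B y) + \<epsilon>"
      proof -
        \<comment> \<open>At a minimizer y, the maximizer w' is a best reply for A. Passing from wh
          to w' therefore costs no more than the change of B - A between two points at distance at
          most h.\<close>
        have "inner wh (A y) \<le> inner w' (A y)"
          using minimizers_inner_le[OF y whW] saddle_inner_eq[OF y w'(1)] by simp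
        then show ?thesis
          using modulus[of y y wh w'] y K(3) whW w' max_W by (fastforce simp: dist_Pair_Pair)
      qed
      also have "inner w' (B y) \<le> support_fun maximizers (B y)"
        by (rule inner_le_support_fun[OF compact_maximizers maximizers_nonempty w'(1)])
      finally show ?thesis by simp
    qed
    have lower: "support_fun maximizers (B y') \<le> B.saddle_value + \<epsilon>"
      unfolding support_fun_le_iff[OF compact_maximizers maximizers_nonempty]
    proof
      fix w assume w: "w \<in> maximizers"
      have "inner w (A y') \<le> inner w (A yh)"
        using saddle_inner_eq[OF y'(1) w] w yh(2) K(2) by (auto simp: maximizers_def)
      then have "inner w (B y') \<le> inner w (B yh) + \<epsilon>"
        using modulus[of yh y' w w] yh(2) y' K(3) w max_W by (fastforce simp: dist_Pair_Pair)
      also have "inner w (B yh) \<le> B.saddle_value"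
        using w max_W by (intro B.minimizers_inner_le[OF yh(1)]) auto
      finally show "inner w (B y') \<le> B.saddle_value + \<epsilon>" by simp
    qed
    have "B.saddle_value - \<epsilon> \<le> (INF y\<in>minimizers. support_fun maximizers (B y))"
      by (intro cINF_greatest minimizers_nonempty upper)
    moreover have "(INF y\<in>minimizers. support_fun maximizers (B y)) \<le> support_fun maximizers (B y')"
      by (intro cINF_lower bdd_belowI2[of _ "B.saddle_value - \<epsilon>"] upper y'(1))
    ultimately show "\<bar>B.saddle_value - (INF y\<in>minimizers. support_fun maximizers (B y))\<bar> \<le> \<epsilon>"
      using lower by linarith
  qed
  ultimately show ?thesis by blast
qed

end

section \<open>Chaining\<close>

text \<open>Cut space into grid cells and pick a representative from each cell that meets the set,
  so that the net lies inside the set. The number of cells at level l is of order (2^l)^d, hence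
  geometric in l with B = 2^d.\<close>

lemma bounded_dyadic_nets:
  fixes \<Theta> :: "'a::euclidean_space set"
  assumes "bounded \<Theta>"
  obtains T and K B :: real where "B \<ge> 1" "\<And>l. finite (T l)" "\<And>l. T l \<subseteq> \<Theta>"
    "\<And>l. real (card (T l)) \<le> K * B ^ l"
    "\<And>l \<theta>. \<theta> \<in> \<Theta> \<Longrightarrow> \<exists>t\<in>T l. dist \<theta> t \<le> (1/2) ^ l"
proof -
  define d where "d = DIM('a)"
  have d: "d > 0" by (simp add: d_def)
  obtain R where R: "R > 0" "\<And>x. x \<in> \<Theta> \<Longrightarrow> norm x \<le> R"
    using assms bounded_pos by metis
  \<comment> \<open>Cells of side 1 / (d 2^l) have diameter at most 2^-l in the l1 norm, which
    dominates the Euclidean norm.\<close>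
  define s where "s l = real d * 2 ^ l" for l :: nat
  have s: "s l > 0" for l using d by (simp add: s_def)
  define cell where "cell l x = restrict (\<lambda>b. \<lfloor>inner x b * s l\<rfloor>) Basis" for l and x :: 'a
  define n where "n l = nat \<lceil>R * s l\<rceil>" for l
  have n: "real (n l) \<ge> R * s l" "real (n l) \<le> R * s l + 1" for l
    using R(1) s[of l] of_nat_ceiling[of "R * s l"] of_int_ceiling_le_add_one[of "R * s l"]
    by (auto simp: n_def)
  define F where "F l = (Basis :: 'a set) \<rightarrow>\<^sub>E {- int (n l) - 1 .. int (n l)}" for l
  have cell_F: "cell l ` \<Theta> \<subseteq> F l" for l
  proof
    fix c assume "c \<in> cell l ` \<Theta>"
    then obtain x where x: "x \<in> \<Theta>" "c = cell l x" by blast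
    have "\<lfloor>inner x b * s l\<rfloor> \<in> {- int (n l) - 1 .. int (n l)}" if b: "b \<in> Basis" for b
    proof -
      have "\<bar>inner x b\<bar> \<le> R" using Basis_le_norm[OF b, of x] R(2)[OF x(1)] by simp
      then have "\<bar>inner x b * s l\<bar> \<le> real (n l)"
        using n(1)[of l] s[of l] by (auto simp: abs_mult intro: order_trans[OF mult_right_mono])
      then show ?thesis by (simp add: abs_le_iff) linarith
    qed
    then show "c \<in> F l" by (auto simp: x F_def cell_def)
  qed
  have finF: "finite (F l)" for l unfolding F_def by (intro finite_PiE) auto
  have cardF: "real (card (F l)) = (2 * real (n l) + 2) ^ d" for l
    by (simp add: F_def card_PiE d_def of_nat_add nat_add_distrib add.commute)
  have cell_dist: "dist x y \<le> (1/2) ^ l" if "cell l x = cell l y" for l x y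
  proof -
    have "\<bar>inner (x - y) b\<bar> \<le> 1 / s l" if b: "b \<in> Basis" for b
    proof -
      have "\<lfloor>inner x b * s l\<rfloor> = \<lfloor>inner y b * s l\<rfloor>"
        using fun_cong[OF \<open>cell l x = cell l y\<close>, of b] b by (simp add: cell_def)
      then have "\<bar>inner x b * s l - inner y b * s l\<bar> \<le> 1" by linarith
      then have "\<bar>inner (x - y) b\<bar> * s l \<le> 1"
        using s[of l] by (simp add: inner_diff_left left_diff_distrib[symmetric] abs_mult)
      then show ?thesis using s[of l] by (simp add: field_simps)
    qed
    then have "(\<Sum>b\<in>Basis. \<bar>inner (x - y) b\<bar>) \<le> real d * (1 / s l)"
      unfolding d_def by (rule sum_bounded_above)
    then show ?thesis
      using norm_le_l1[of "x - y"] d by (simp add: dist_norm s_def power_one_over)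
  qed
  define rep where "rep l c = (SOME x. x \<in> \<Theta> \<and> cell l x = c)" for l c
  have rep: "rep l (cell l x) \<in> \<Theta> \<and> cell l (rep l (cell l x)) = cell l x" if "x \<in> \<Theta>" for l x
    unfolding rep_def by (rule someI[of _ x]) (use that in simp)
  define T where "T l = rep l ` cell l ` \<Theta>" for l
  show thesis
  proof (rule that[of "2 ^ d" T "(2 * R * real d + 4) ^ d"])
    show "(1::real) \<le> 2 ^ d" by simp
    show "finite (T l)" for l unfolding T_def using finite_subset[OF cell_F finF] by blast
    show "T l \<subseteq> \<Theta>" for l unfolding T_def using rep by blast
    show "\<exists>t\<in>T l. dist \<theta> t \<le> (1/2) ^ l" if "\<theta> \<in> \<Theta>" for l \<theta>
      using rep[OF that, of l] cell_dist[of l \<theta> "rep l (cell l \<theta>)"] that by (auto simp: T_def)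
    fix l
    have "card (T l) \<le> card (cell l ` \<Theta>)"
      unfolding T_def by (intro card_image_le finite_subset[OF cell_F finF])
    also have "\<dots> \<le> card (F l)" by (intro card_mono cell_F finF)
    finally have "real (card (T l)) \<le> (2 * real (n l) + 2) ^ d" by (simp add: cardF flip: cardF)
    also have "\<dots> \<le> ((2 * R * real d + 4) * 2 ^ l) ^ d"
    proof (rule power_mono)
      have "2 * real (n l) + 2 \<le> 2 * R * real d * 2 ^ l + 4"
        using n(2)[of l] by (simp add: s_def algebra_simps)
      also have "\<dots> \<le> 2 * R * real d * 2 ^ l + 4 * 2 ^ l" by simp
      finally show "2 * real (n l) + 2 \<le> (2 * R * real d + 4) * 2 ^ l" by (simp add: algebra_simps)
    qed simp
    also have "\<dots> = (2 * R * real d + 4) ^ d * (2 ^ d) ^ l"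
      by (simp add: power_mult_distrib power_mult[symmetric] mult.commute)
    finally show "real (card (T l)) \<le> (2 * R * real d + 4) ^ d * (2 ^ d) ^ l" .
  qed
qed

text \<open>Telescope g along nearest net points of levels L, L + 1, ...; consecutive points are at
  most 2 * 2^-l apart. The Lipschitz constant c only makes the remainder of the chain vanish and is
  absent from the bound, so it may grow with the sample size.\<close>

lemma chaining_bound:
  fixes g :: "'a::metric_space \<Rightarrow> real"
  assumes T: "\<And>l. T l \<subseteq> \<Theta>" "\<And>l \<theta>. \<theta> \<in> \<Theta> \<Longrightarrow> \<exists>t\<in>T l. dist \<theta> t \<le> (1/2) ^ l"
    and c: "c \<ge> 0"
    and lip: "\<And>s t. s \<in> \<Theta> \<Longrightarrow> t \<in> \<Theta> \<Longrightarrow> \<bar>g s - g t\<bar> \<le> c * dist s t"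
    and r: "\<And>l s t. l \<ge> L \<Longrightarrow> s \<in> T l \<union> T (Suc l) \<Longrightarrow> t \<in> T l \<union> T (Suc l) \<Longrightarrow> \<bar>g s - g t\<bar> \<le> r l * dist s t"
    and r0: "\<And>l. r l \<ge> 0"
    and sum: "summable (\<lambda>l. r l * (2 * (1/2) ^ l))"
    and \<theta>: "\<theta> \<in> \<Theta>" "\<theta>' \<in> \<Theta>" "dist \<theta> \<theta>' \<le> (1/2) ^ L"
  shows "\<bar>g \<theta> - g \<theta>'\<bar> \<le> 4 * (\<Sum>l. r (l + L) * (2 * (1/2) ^ (l + L)))"
proof -
  define q where "q l = r l * (2 * (1/2) ^ l)" for l
  define tail where "tail = (\<Sum>l. q (l + L))"
  have q0: "q l \<ge> 0" for l using r0 by (simp add: q_def)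
  have sumq: "summable q" using sum by (simp add: q_def[abs_def])
  then have sum_tail: "summable (\<lambda>l. q (l + L))" by (rule summable_ignore_initial_segment)
  obtain \<pi> where \<pi>: "\<And>l \<theta>. \<theta> \<in> \<Theta> \<Longrightarrow> \<pi> l \<theta> \<in> T l" "\<And>l \<theta>. \<theta> \<in> \<Theta> \<Longrightarrow> dist \<theta> (\<pi> l \<theta>) \<le> (1/2) ^ l"
  proof (rule that[of "\<lambda>l \<theta>. SOME t. t \<in> T l \<and> dist \<theta> t \<le> (1/2) ^ l"])
    fix l \<theta> assume "\<theta> \<in> \<Theta>"
    then have *: "\<exists>t. t \<in> T l \<and> dist \<theta> t \<le> (1/2) ^ l" using T(2) by blast
    show "(SOME t. t \<in> T l \<and> dist \<theta> t \<le> (1/2) ^ l) \<in> T l"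
      "dist \<theta> (SOME t. t \<in> T l \<and> dist \<theta> t \<le> (1/2) ^ l) \<le> (1/2) ^ l"
      using someI_ex[OF *] by auto
  qed
  have near: "\<bar>g \<theta> - g (\<pi> L \<theta>)\<bar> \<le> tail" if \<theta>: "\<theta> \<in> \<Theta>" for \<theta>
  proof -
    have link: "\<bar>g (\<pi> (Suc l) \<theta>) - g (\<pi> l \<theta>)\<bar> \<le> q l" if l: "l \<ge> L" for l
    proof -
      have "dist (\<pi> (Suc l) \<theta>) (\<pi> l \<theta>) \<le> dist \<theta> (\<pi> (Suc l) \<theta>) + dist \<theta> (\<pi> l \<theta>)"
        by (rule dist_triangle3)
      also have "\<dots> \<le> (1/2) ^ Suc l + (1/2) ^ l"
        by (intro add_mono \<pi> \<theta>)
      also have "\<dots> \<le> 2 * (1/2) ^ l" by simp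
      finally have "r l * dist (\<pi> (Suc l) \<theta>) (\<pi> l \<theta>) \<le> q l"
        unfolding q_def by (intro mult_left_mono r0)
      then show ?thesis
        using r[OF l, of "\<pi> (Suc l) \<theta>" "\<pi> l \<theta>"] \<pi>(1)[OF \<theta>] by fastforce
    qed
    have partial: "\<bar>g (\<pi> (n + L) \<theta>) - g (\<pi> L \<theta>)\<bar> \<le> (\<Sum>l<n. q (l + L))" for n
    proof (induction n)
      case (Suc n)
      then show ?case using link[of "n + L"] by simp
    qed simp
    have bound: "\<bar>g \<theta> - g (\<pi> L \<theta>)\<bar> \<le> c * (1/2) ^ (n + L) + tail" for n
    proof -
      have "(\<Sum>l<n. q (l + L)) \<le> tail"
        unfolding tail_def by (intro sum_le_suminf sum_tail) (auto simp: q0)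
      moreover have "\<bar>g \<theta> - g (\<pi> (n + L) \<theta>)\<bar> \<le> c * dist \<theta> (\<pi> (n + L) \<theta>)"
        by (intro lip \<theta> subsetD[OF T(1) \<pi>(1)])
      moreover have "c * dist \<theta> (\<pi> (n + L) \<theta>) \<le> c * (1/2) ^ (n + L)"
        by (intro mult_left_mono \<pi> \<theta> c)
      ultimately show ?thesis using partial[of n] by linarith
    qed
    have "(\<lambda>n. c * (1/2) ^ (n + L) + tail) \<longlonglongrightarrow> c * 0 + tail"
      by (intro tendsto_intros LIMSEQ_ignore_initial_segment LIMSEQ_power_zero) simp
    then show ?thesis
      using bound by (intro LIMSEQ_le_const[of "\<lambda>n. c * (1/2) ^ (n + L) + tail"]) auto
  qed
  have "dist (\<pi> L \<theta>) (\<pi> L \<theta>') \<le> 3 * (1/2) ^ L"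
    using \<pi>(2)[OF \<theta>(1), of L] \<pi>(2)[OF \<theta>(2), of L] \<theta>(3)
      dist_triangle[of "\<pi> L \<theta>" "\<pi> L \<theta>'" \<theta>] dist_triangle[of \<theta> "\<pi> L \<theta>'" \<theta>']
    by (simp add: dist_commute)
  then have "r L * dist (\<pi> L \<theta>) (\<pi> L \<theta>') \<le> r L * (3 * (1/2) ^ L)"
    by (intro mult_left_mono r0)
  then have "\<bar>g (\<pi> L \<theta>) - g (\<pi> L \<theta>')\<bar> \<le> r L * (3 * (1/2) ^ L)"
    using r[of L "\<pi> L \<theta>" "\<pi> L \<theta>'"] \<pi>(1)[OF \<theta>(1)] \<pi>(1)[OF \<theta>(2)] by fastforce
  \<comment> \<open>The link between the two level-L points costs at most two tails; with one tail
    for each of the two chains this gives the factor 4.\<close>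
  also have "\<dots> \<le> 2 * q L" using r0[of L] by (simp add: q_def)
  also have "q L \<le> tail"
    using sum_le_suminf[OF sum_tail, of "{0}"] q0 by (simp add: tail_def)
  finally show ?thesis
    using near[OF \<theta>(1)] near[OF \<theta>(2)] unfolding tail_def q_def by linarith
qed

lemma suminf_tail_tendsto_0:
  fixes q :: "nat \<Rightarrow> real"
  assumes "summable q"
  shows "(\<lambda>L. \<Sum>l. q (l + L)) \<longlonglongrightarrow> 0"
proof -
  have "(\<lambda>L. suminf q - sum q {..<L}) \<longlonglongrightarrow> suminf q - suminf q"
    by (intro tendsto_intros summable_LIMSEQ assms)
  then show ?thesis by (simp add: suminf_minus_initial_segment[OF assms])
qed

section \<open>Stochastic equicontinuity\<close>

text \<open>For x = -y with 0 \<le> y \<le> 1 the claim reads 1 \<le> (1 - y + y^2) exp y. Replacing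
  exp y by its quadratic Taylor minorant gives the product 1 + (y^2 + y^3 + y^4) / 2.\<close>

lemma exp_le_quadratic:
  fixes x :: real
  assumes "\<bar>x\<bar> \<le> 1"
  shows "exp x \<le> 1 + x + x\<^sup>2"
proof (cases "x \<ge> 0")
  case True
  then show ?thesis using assms by (intro exp_bound) auto
next
  case False
  define y where "y = - x"
  have y: "0 \<le> y" "y \<le> 1" using False assms by (auto simp: y_def)
  have pos: "1 + y + y\<^sup>2 / 2 > 0" using y by (simp add: add_pos_nonneg)
  have "1 \<le> (1 - y + y\<^sup>2) * (1 + y + y\<^sup>2 / 2)"
  proof -
    have "(1 - y + y\<^sup>2) * (1 + y + y\<^sup>2 / 2) = 1 + (y ^ 2 + y ^ 3 + y ^ 4) / 2"
      by (simp add: field_simps power2_eq_square power3_eq_cube power4_eq_xxxx)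
    then show ?thesis using y by simp
  qed
  also have "\<dots> \<le> (1 - y + y\<^sup>2) * exp y"
    using y by (intro mult_left_mono exp_lower_Taylor_quadratic) auto
  finally have "exp (- y) \<le> 1 - y + y\<^sup>2" by (simp add: exp_minus field_simps)
  then show ?thesis by (simp add: y_def)
qed

locale iid_sample = prob_space M for M :: "'w measure" +
  fixes S :: "'s measure" and D :: "'s measure" and X :: "nat \<Rightarrow> 'w \<Rightarrow> 's"
  assumes indep: "indep_vars (\<lambda>_. S) X UNIV"
    and distr_eq: "\<And>j. distr M S (X j) = D"
begin

lemma X_measurable [measurable]: "X j \<in> measurable M S"
  using indep by (auto simp: indep_vars_def2)

lemma sets_D [measurable_cong]: "sets D = sets S"
  using distr_eq[of 0] by (metis sets_distr)

lemma prob_space_D: "prob_space D"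
  using prob_space_distr[OF X_measurable, of 0] by (simp add: distr_eq)

sublocale D: prob_space D by (rule prob_space_D)

lemma AE_sample:
  assumes "AE z in D. P z"
  shows "AE \<omega> in M. P (X j \<omega>)"
proof -
  have "AE z in distr M S (X j). P z" unfolding distr_eq by (rule assms)
  then show ?thesis by (rule AE_distrD[OF X_measurable])
qed

lemma integrable_sample: "integrable D (f :: 's \<Rightarrow> real) \<Longrightarrow> integrable M (\<lambda>\<omega>. f (X j \<omega>))"
  by (subst (asm) distr_eq[symmetric, of j]) (rule integrable_distr[OF X_measurable])

lemma integral_sample:
  "f \<in> borel_measurable S \<Longrightarrow> (\<integral>\<omega>. f (X j \<omega>) \<partial>M) = (\<integral>z. (f z :: real) \<partial>D)"
  by (subst distr_eq[symmetric, of j]) (simp add: integral_distr)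

text \<open>The quadratic bound on exp makes each factor at most 1 + \<kappa> / N, so the product of
  the N independent factors is at most exp \<kappa>, uniformly in N.\<close>

lemma exp_moment_bound:
  fixes f :: "'s \<Rightarrow> real"
  assumes f [measurable]: "f \<in> borel_measurable S"
    and bounded: "AE z in D. \<bar>f z\<bar> \<le> 1"
    and mean: "(\<integral>z. f z \<partial>D) = 0"
    and var: "(\<integral>z. (f z)\<^sup>2 \<partial>D) \<le> \<kappa> / real N" and N: "N > 0"
  shows "integrable M (\<lambda>\<omega>. exp (\<Sum>j<N. f (X j \<omega>)))" "(\<integral>\<omega>. exp (\<Sum>j<N. f (X j \<omega>)) \<partial>M) \<le> exp \<kappa>"
proof -
  have int_f: "integrable D f" "integrable D (\<lambda>z. (f z)\<^sup>2)"
    by (rule D.integrable_const_bound[of _ 1]; use bounded in \<open>auto simp: abs_square_le_1\<close>)+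
  have int_exp: "integrable D (\<lambda>z. exp (f z))"
    by (rule D.integrable_const_bound[of _ "exp 1"]) (use bounded in \<open>auto simp: abs_le_iff\<close>)
  have one: "(\<integral>z. exp (f z) \<partial>D) \<le> exp (\<kappa> / N)"
  proof -
    have "(\<integral>z. exp (f z) \<partial>D) \<le> (\<integral>z. 1 + f z + (f z)\<^sup>2 \<partial>D)"
      by (intro integral_mono_AE int_exp Bochner_Integration.integrable_add int_f)
         (use bounded in \<open>auto intro: exp_le_quadratic\<close>)
    also have "\<dots> = 1 + (\<integral>z. (f z)\<^sup>2 \<partial>D)"
      using int_f mean by (simp add: D.prob_space)
    also have "\<dots> \<le> 1 + \<kappa> / N" using var by simp
    also have "\<dots> \<le> exp (\<kappa> / N)" by (rule exp_ge_add_one_self)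
    finally show ?thesis .
  qed
  have ind: "indep_vars (\<lambda>_. borel) (\<lambda>j \<omega>. exp (f (X j \<omega>))) {..<N}"
    by (rule indep_vars_subset[OF indep_vars_compose2[OF indep, of "\<lambda>_ z. exp (f z)"]]) auto
  have int: "integrable M (\<lambda>\<omega>. exp (f (X j \<omega>)))" for j
    by (rule integrable_sample[OF int_exp])
  show "integrable M (\<lambda>\<omega>. exp (\<Sum>j<N. f (X j \<omega>)))"
    using indep_vars_integrable[OF _ ind int] by (simp add: exp_sum)
  have "(\<integral>\<omega>. exp (\<Sum>j<N. f (X j \<omega>)) \<partial>M) = (\<Prod>j<N. \<integral>z. exp (f z) \<partial>D)"
    using indep_vars_lebesgue_integral[OF _ ind int] integral_sample[of "\<lambda>z. exp (f z)"]
    by (simp add: exp_sum)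
  also have "\<dots> \<le> exp (\<kappa> / N) ^ N"
    using one by (auto intro: power_mono)
  also have "\<dots> = exp \<kappa>" using N by (simp add: exp_of_nat_mult[symmetric])
  finally show "(\<integral>\<omega>. exp (\<Sum>j<N. f (X j \<omega>)) \<partial>M) \<le> exp \<kappa>" .
qed

text \<open>Chernoff's inequality with exponent 1 for both signs of (f - m) / sqrt N. The bound sqrt
  N / 2 holds for f and hence for its mean m, so the centred and scaled variable stays in [-1, 1].
  An exponential tail in x is all that chaining over geometric nets requires.\<close>

lemma truncated_tail:
  fixes f :: "'s \<Rightarrow> real"
  assumes f [measurable]: "f \<in> borel_measurable S"
    and bounded: "AE z in D. \<bar>f z\<bar> \<le> sqrt (real N) / 2"
    and var: "(\<integral>z. (f z)\<^sup>2 \<partial>D) \<le> \<kappa>" and N: "N > 0"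
  shows "prob {\<omega>\<in>space M. \<bar>\<Sum>j<N. f (X j \<omega>) - (\<integral>z. f z \<partial>D)\<bar> \<ge> sqrt (real N) * x} \<le> 2 * exp (\<kappa> - x)"
proof -
  define m where "m = (\<integral>z. f z \<partial>D)"
  have int_f: "integrable D f" "integrable D (\<lambda>z. (f z)\<^sup>2)"
    by (rule D.integrable_const_bound[of _ "sqrt (real N) / 2"];
        use bounded in \<open>auto simp: abs_square_le_1\<close>)
       (rule D.integrable_const_bound[of _ "(sqrt (real N) / 2)\<^sup>2"];
        use bounded in \<open>auto simp: abs_le_square_iff[symmetric]\<close>)
  have "AE z in D. f z \<le> sqrt N / 2" "AE z in D. - (sqrt N / 2) \<le> f z" using bounded by auto
  then have m: "\<bar>m\<bar> \<le> sqrt N / 2"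
    using D.integral_le_const[OF int_f(1)] D.integral_ge_const[OF int_f(1)]
    unfolding m_def abs_le_iff by fastforce
  have tail: "prob {\<omega>\<in>space M. (\<Sum>j<N. s * (f (X j \<omega>) - m) / sqrt N) \<ge> x} \<le> exp (\<kappa> - x)"
    if s: "\<bar>s\<bar> = 1" for s
  proof -
    define V where "V z = s * (f z - m) / sqrt N" for z
    have V [measurable]: "V \<in> borel_measurable S" unfolding V_def by measurable
    have "AE z in D. \<bar>V z\<bar> \<le> 1"
      using bounded
    proof eventually_elim
      case (elim z)
      then have "\<bar>f z - m\<bar> \<le> sqrt N" using m by linarith
      then show ?case using s N by (simp add: V_def abs_mult)
    qed
    moreover have "(\<integral>z. V z \<partial>D) = 0"
      using int_f by (simp add: V_def m_def D.prob_space)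
    moreover have "(\<integral>z. (V z)\<^sup>2 \<partial>D) \<le> \<kappa> / N"
    proof -
      have "s\<^sup>2 = 1" using s by (metis power2_abs power_one)
      then have "(\<integral>z. (V z)\<^sup>2 \<partial>D) = (\<integral>z. (f z - m)\<^sup>2 \<partial>D) / N"
        using N by (simp add: V_def power_divide power_mult_distrib)
      also have "(\<integral>z. (f z - m)\<^sup>2 \<partial>D) = (\<integral>z. (f z)\<^sup>2 \<partial>D) - m\<^sup>2"
        using D.variance_eq[OF int_f] by (simp add: m_def)
      finally have "(\<integral>z. (V z)\<^sup>2 \<partial>D) = ((\<integral>z. (f z)\<^sup>2 \<partial>D) - m\<^sup>2) / N" .
      also have "\<dots> \<le> \<kappa> / N"
        using var zero_le_power2[of m] by (intro divide_right_mono) linarith+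
      finally show ?thesis .
    qed
    ultimately have V_exp: "integrable M (\<lambda>\<omega>. exp (\<Sum>j<N. V (X j \<omega>)))"
      "(\<integral>\<omega>. exp (\<Sum>j<N. V (X j \<omega>)) \<partial>M) \<le> exp \<kappa>"
      using exp_moment_bound[OF V _ _ _ N] by blast+
    have "prob {\<omega>\<in>space M. (\<Sum>j<N. V (X j \<omega>)) \<ge> x}
        \<le> exp (- 1 * x) * (\<integral>\<omega>\<in>space M. exp (1 * (\<Sum>j<N. V (X j \<omega>))) \<partial>M)"
    proof (rule Chernoff_ineq_ge)
      show "set_integrable M (space M) (\<lambda>\<omega>. exp (1 * (\<Sum>j<N. V (X j \<omega>))))"
        unfolding set_integrable_def by (rule integrable_mult_indicator) (use V_exp in auto)
    qed auto
    also have "\<dots> \<le> exp (- x) * exp \<kappa>"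
      using V_exp by (simp add: set_integral_space)
    finally show ?thesis by (simp add: V_def exp_diff exp_minus field_simps)
  qed
  have neg: "(\<Sum>j<N. m - f (X j \<omega>)) = - (\<Sum>j<N. f (X j \<omega>) - m)" for \<omega>
    by (simp add: sum_negf[symmetric])
  have sub: "{\<omega>\<in>space M. \<bar>\<Sum>j<N. f (X j \<omega>) - m\<bar> \<ge> sqrt (real N) * x}
     \<subseteq> {\<omega>\<in>space M. (\<Sum>j<N. 1 * (f (X j \<omega>) - m) / sqrt N) \<ge> x} \<union>
       {\<omega>\<in>space M. (\<Sum>j<N. (- 1) * (f (X j \<omega>) - m) / sqrt N) \<ge> x}"
    using N by (auto simp: neg sum_divide_distrib[symmetric] field_simps abs_if split: if_splits)
  have "prob {\<omega>\<in>space M. \<bar>\<Sum>j<N. f (X j \<omega>) - m\<bar> \<ge> sqrt (real N) * x} \<le>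
      prob ({\<omega>\<in>space M. (\<Sum>j<N. 1 * (f (X j \<omega>) - m) / sqrt N) \<ge> x} \<union>
       {\<omega>\<in>space M. (\<Sum>j<N. (- 1) * (f (X j \<omega>) - m) / sqrt N) \<ge> x})"
    by (rule finite_measure_mono[OF sub]) measurable
  also have "\<dots> \<le> prob {\<omega>\<in>space M. (\<Sum>j<N. 1 * (f (X j \<omega>) - m) / sqrt N) \<ge> x} +
       prob {\<omega>\<in>space M. (\<Sum>j<N. (- 1) * (f (X j \<omega>) - m) / sqrt N) \<ge> x}"
    by (rule measure_Un_le) measurable
  also have "\<dots> \<le> exp (\<kappa> - x) + exp (\<kappa> - x)"
    by (intro add_mono tail) auto
  finally show ?thesis by (simp add: m_def)
qed

definition deviation :: "nat \<Rightarrow> 'w \<Rightarrow> ('s \<Rightarrow> real) \<Rightarrow> real" where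
  "deviation N \<omega> f = (\<Sum>j<N. f (X j \<omega>) - (\<integral>z. f z \<partial>D))"

lemma deviation_diff:
  "integrable D f \<Longrightarrow> integrable D g \<Longrightarrow>
    deviation N \<omega> (\<lambda>z. f z - g z) = deviation N \<omega> f - deviation N \<omega> g"
  by (simp add: deviation_def sum_subtractf right_diff_distrib)

text \<open>On this one event, truncation according to L leaves the sample terms of every function
  dominated by a multiple of L unchanged. The cost of truncation is thus paid once, while union
  bounds concern only the truncated functions.\<close>

definition small_envelope :: "'s set \<Rightarrow> ('s \<Rightarrow> real) \<Rightarrow> nat \<Rightarrow> 'w \<Rightarrow> bool" where
  "small_envelope \<Xi> L N \<omega> \<longleftrightarrow> (\<forall>j<N. X j \<omega> \<in> \<Xi> \<and> L (X j \<omega>) \<le> sqrt (real N) / 2)"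

text \<open>The bias caused by truncating at \<open>\<surd>N / 2\<close> is at most \<open>2\<kappa>u / \<surd>N\<close> per observation.\<close>

lemma deviation_tail:
  fixes f L :: "'s \<Rightarrow> real"
  assumes f [measurable]: "f \<in> borel_measurable S" and L [measurable]: "L \<in> borel_measurable S"
    and L0: "\<And>z. L z \<ge> 0" and L2: "integrable D (\<lambda>z. (L z)\<^sup>2)"
    and \<Xi>: "AE z in D. z \<in> \<Xi>" and bound: "\<And>z. z \<in> \<Xi> \<Longrightarrow> \<bar>f z\<bar> \<le> L z * u" and u: "u \<ge> 0"
    and N: "N > 0"
  defines "\<kappa> \<equiv> \<integral>z. (L z)\<^sup>2 \<partial>D"
  obtains E where "E \<in> events" "prob E \<le> 2 * exp (\<kappa> - x)"
    "\<And>\<omega>. \<omega> \<in> space M - E \<Longrightarrow> small_envelope \<Xi> L N \<omega> \<Longrightarrow> \<bar>deviation N \<omega> f\<bar> \<le> sqrt N * u * (x + 2 * \<kappa>)"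
proof (cases "u = 0")
  case True
  have "AE z in D. f z = 0" using \<Xi> by eventually_elim (use bound True in force)
  then have "(\<integral>z. f z \<partial>D) = 0" by (simp add: integral_eq_zero_AE)
  then have "deviation N \<omega> f = 0" if "small_envelope \<Xi> L N \<omega>" for \<omega>
    using that bound True by (force simp: deviation_def small_envelope_def intro!: sum.neutral)
  then show thesis by (intro that[of "{}"]) (auto simp: True)
next
  case False
  then have u: "u > 0" using assms by simp
  have sN: "sqrt N > 0" using N by simp
  have int_L: "integrable D L" by (rule D.square_integrable_imp_integrable[OF _ L2]) simp
  have "AE z in D. norm (f z) \<le> norm (L z * u)"
    using \<Xi> by eventually_elim (use bound L0 u in \<open>force simp: abs_mult\<close>)
  then have int_f: "integrable D f"
    by (intro Bochner_Integration.integrable_bound[of D "\<lambda>z. L z * u" f]) (use int_L in auto)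
  \<comment> \<open>Truncating where L is large, rather than where f is, makes the cut-off set
    common to all f with the envelope L.\<close>
  define g where "g z = f z / u * indicator {z. L z \<le> sqrt N / 2} z" for z
  have g [measurable]: "g \<in> borel_measurable S" unfolding g_def by measurable
  have g_le: "AE z in D. \<bar>g z\<bar> \<le> L z \<and> \<bar>g z\<bar> \<le> sqrt N / 2"
    using \<Xi>
  proof eventually_elim
    case (elim z)
    then have "\<bar>f z / u\<bar> \<le> L z" using bound u by (simp add: field_simps)
    then show ?case
      using L0[of z] by (cases "L z \<le> sqrt N / 2") (auto simp: g_def simp del: abs_divide)
  qed
  have int_g: "integrable D g"
    by (rule D.integrable_const_bound[of _ "sqrt (real N) / 2"]) (use g_le in auto)
  have g2: "(\<integral>z. (g z)\<^sup>2 \<partial>D) \<le> \<kappa>"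
    unfolding \<kappa>_def
  proof (rule integral_mono_AE')
    show "AE z in D. (g z)\<^sup>2 \<le> (L z)\<^sup>2"
      using g_le by eventually_elim (auto simp: abs_le_square_iff[symmetric] L0)
  qed (use L2 in auto)
  have bias: "\<bar>(\<integral>z. f z / u \<partial>D) - (\<integral>z. g z \<partial>D)\<bar> \<le> 2 * \<kappa> / sqrt N"
  proof -
    have "\<bar>(\<integral>z. f z / u \<partial>D) - (\<integral>z. g z \<partial>D)\<bar> = \<bar>\<integral>z. f z / u - g z \<partial>D\<bar>"
      using int_f int_g by simp
    also have "\<dots> \<le> (\<integral>z. \<bar>f z / u - g z\<bar> \<partial>D)" by (rule integral_abs_bound)
    also have "\<dots> \<le> (\<integral>z. 2 / sqrt N * (L z)\<^sup>2 \<partial>D)"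
    proof (rule integral_mono_AE')
      show "AE z in D. \<bar>f z / u - g z\<bar> \<le> 2 / sqrt N * (L z)\<^sup>2"
        using \<Xi>
      proof eventually_elim
        case (elim z)
        then have *: "\<bar>f z / u\<bar> \<le> L z" using bound u by (simp add: field_simps)
        show ?case
        proof (cases "L z \<le> sqrt N / 2")
          case True then show ?thesis by (simp add: g_def)
        next
          case False
          \<comment> \<open>Beyond the truncation level 2 L / sqrt N is at least 1, which trades the
            lost first moment for a second moment divided by sqrt N.\<close>
          then have "L z * 1 \<le> L z * (2 / sqrt N * L z)"
            using L0 sN by (intro mult_left_mono) (auto simp: field_simps)
          then show ?thesis using * False by (simp add: g_def power2_eq_square field_simps)
        qed
      qed
    qed (use L2 in auto)
    finally show ?thesis by (simp add: \<kappa>_def)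
  qed
  define E where "E = {\<omega>\<in>space M. \<bar>\<Sum>j<N. g (X j \<omega>) - (\<integral>z. g z \<partial>D)\<bar> \<ge> sqrt (real N) * x}"
  show thesis
  proof (rule that[of E])
    show "E \<in> events" unfolding E_def by measurable
    show "prob E \<le> 2 * exp (\<kappa> - x)"
      unfolding E_def by (rule truncated_tail[OF g _ g2 N]) (use g_le in auto)
    fix \<omega> assume \<omega>: "\<omega> \<in> space M - E" "small_envelope \<Xi> L N \<omega>"
    have "f (X j \<omega>) = u * g (X j \<omega>)" if "j < N" for j
      using that \<omega>(2) u by (auto simp: small_envelope_def g_def)
    then have "deviation N \<omega> f = (\<Sum>j<N. u * g (X j \<omega>) - (\<integral>z. f z \<partial>D))"
      by (simp add: deviation_def)
    also have "\<dots> = u * (\<Sum>j<N. g (X j \<omega>) - (\<integral>z. g z \<partial>D)) - N * u * ((\<integral>z. f z / u \<partial>D) - (\<integral>z. g z \<partial>D))"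
      using u by (simp add: sum_subtractf sum_distrib_left algebra_simps)
    finally have "\<bar>deviation N \<omega> f\<bar> \<le> u * \<bar>\<Sum>j<N. g (X j \<omega>) - (\<integral>z. g z \<partial>D)\<bar> +
        N * u * \<bar>(\<integral>z. f z / u \<partial>D) - (\<integral>z. g z \<partial>D)\<bar>"
      using u by (simp add: abs_mult[symmetric] order_trans[OF abs_triangle_ineq4] abs_mult)
    also have "\<dots> \<le> u * (sqrt N * x) + N * u * (2 * \<kappa> / sqrt N)"
      using \<omega>(1) u bias by (intro add_mono mult_left_mono) (auto simp: E_def)
    also have "N * u * (2 * \<kappa> / sqrt N) = sqrt N * u * (2 * \<kappa>)"
    proof -
      have "N * u * (2 * \<kappa> / sqrt N) = (N / sqrt N) * u * (2 * \<kappa>)" by simp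
      then show ?thesis by (simp add: real_div_sqrt)
    qed
    finally show "\<bar>deviation N \<omega> f\<bar> \<le> sqrt N * u * (x + 2 * \<kappa>)" by (simp add: algebra_simps)
  qed
qed

end

section \<open>Events of high probability, laws of large numbers and equicontinuity\<close>

context iid_sample begin

text \<open>Suprema over uncountable index sets need not be measurable, hence the exceptional event.\<close>

definition likely :: "real \<Rightarrow> ('w \<Rightarrow> bool) \<Rightarrow> bool" where
  "likely p P \<longleftrightarrow> (\<exists>E\<in>events. prob E \<le> p \<and> (\<forall>\<omega>\<in>space M - E. P \<omega>))"

text \<open>This says that the outer probability of the complement tends to zero.\<close>

definition whp :: "(nat \<Rightarrow> 'w \<Rightarrow> bool) \<Rightarrow> bool" where
  "whp P \<longleftrightarrow> (\<forall>p>0. \<forall>\<^sub>F N in sequentially. likely p (P N))"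

lemma likely_mono: "likely p P \<Longrightarrow> (\<And>\<omega>. \<omega> \<in> space M \<Longrightarrow> P \<omega> \<Longrightarrow> Q \<omega>) \<Longrightarrow> likely p Q"
  unfolding likely_def by (meson DiffD1)

lemma likely_conj:
  assumes "likely p P" "likely q Q"
  shows "likely (p + q) (\<lambda>\<omega>. P \<omega> \<and> Q \<omega>)"
proof -
  obtain E F where E: "E \<in> events" "prob E \<le> p" "\<forall>\<omega>\<in>space M - E. P \<omega>"
    and F: "F \<in> events" "prob F \<le> q" "\<forall>\<omega>\<in>space M - F. Q \<omega>"
    using assms unfolding likely_def by blast
  have "prob (E \<union> F) \<le> p + q" using measure_Un_le[OF E(1) F(1)] E(2) F(2) by linarith
  then show ?thesis unfolding likely_def using E F by (intro bexI[of _ "E \<union> F"]) auto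
qed

lemma whpD: "whp P \<Longrightarrow> p > 0 \<Longrightarrow> \<forall>\<^sub>F N in sequentially. likely p (P N)"
  by (simp add: whp_def)

lemma whp_mono:
  assumes "whp P" "\<And>N \<omega>. \<omega> \<in> space M \<Longrightarrow> P N \<omega> \<Longrightarrow> Q N \<omega>"
  shows "whp Q"
  unfolding whp_def
proof (intro allI impI)
  fix p :: real assume "p > 0"
  then show "\<forall>\<^sub>F N in sequentially. likely p (Q N)"
    by (rule eventually_mono[OF whpD[OF assms(1)]]) (erule likely_mono, rule assms(2))
qed

lemma eventually_likely_conj:
  assumes "\<forall>\<^sub>F N in sequentially. likely (p / 2) (P N)" "\<forall>\<^sub>F N in sequentially. likely (p / 2) (Q N)"
  shows "\<forall>\<^sub>F N in sequentially. likely p (\<lambda>\<omega>. P N \<omega> \<and> Q N \<omega>)"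
  using assms
proof eventually_elim
  case (elim N)
  then show ?case using likely_conj[of "p / 2" "P N" "p / 2" "Q N"] by simp
qed

lemma whp_conj: "whp P \<Longrightarrow> whp Q \<Longrightarrow> whp (\<lambda>N \<omega>. P N \<omega> \<and> Q N \<omega>)"
  by (simp add: whp_def eventually_likely_conj)

lemma whp_finite_ball:
  assumes "finite I" "\<And>i. i \<in> I \<Longrightarrow> whp (P i)"
  shows "whp (\<lambda>N \<omega>. \<forall>i\<in>I. P i N \<omega>)"
  using assms
proof (induction I rule: finite_induct)
  case empty
  show ?case unfolding whp_def likely_def by (auto intro!: bexI[of _ "{}"])
next
  case (insert i I)
  then have "whp (\<lambda>N \<omega>. P i N \<omega> \<and> (\<forall>i\<in>I. P i N \<omega>))" by (intro whp_conj) auto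
  then show ?case by (rule whp_mono) auto
qed

lemma whp_AE:
  assumes "AE \<omega> in M. P \<omega>"
  shows "whp (\<lambda>N. P)"
proof -
  obtain E where E: "{\<omega> \<in> space M. \<not> P \<omega>} \<subseteq> E" "emeasure M E = 0" "E \<in> events"
    using AE_E[OF assms] by blast
  then show ?thesis unfolding whp_def likely_def by (auto simp: measure_def intro!: bexI[of _ E])
qed

text \<open>Union bound over the N sample points. Markov's inequality for L^2 alone would only give
  the constant 4 E[L^2]; keeping the indicator of the tail set inside the expectation gives a bound
  that vanishes by dominated convergence.\<close>

lemma whp_small_envelope:
  assumes L [measurable]: "L \<in> borel_measurable S" and L2: "integrable D (\<lambda>z. (L z)\<^sup>2)"
    and \<Xi>: "AE z in D. z \<in> \<Xi>"
  shows "whp (small_envelope \<Xi> L)"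
proof -
  define q where "q N = (\<integral>z. 4 * ((L z)\<^sup>2 * indicator {z. L z > sqrt (real N) / 2} z) \<partial>D)" for N :: nat
  have q: "q \<longlonglongrightarrow> (\<integral>z. 0 \<partial>D)"
    unfolding q_def
  proof (rule integral_dominated_convergence[where w = "\<lambda>z. 4 * (L z)\<^sup>2"])
    show "AE z in D. (\<lambda>N. 4 * ((L z)\<^sup>2 * indicator {z. L z > sqrt (real N) / 2} z)) \<longlonglongrightarrow> 0"
    proof (rule AE_I2, rule tendsto_eventually)
      fix z
      have "eventually (\<lambda>N. real N \<ge> (2 * \<bar>L z\<bar>)\<^sup>2) sequentially" by real_asymp
      then show "eventually (\<lambda>N. 4 * ((L z)\<^sup>2 * indicator {z. L z > sqrt (real N) / 2} z) = 0) sequentially"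
      proof eventually_elim
        case (elim N)
        then have "2 * \<bar>L z\<bar> \<le> sqrt N" by (rule real_le_rsqrt)
        then show ?case by (auto simp: indicator_def)
      qed
    qed
  qed (use L2 in \<open>auto simp: indicator_def intro!: AE_I2\<close>)
  define E where "E N = (\<Union>j<N. {\<omega>\<in>space M. L (X j \<omega>) > sqrt (real N) / 2})" for N
  have E: "E N \<in> events" for N unfolding E_def by measurable
  have prob_E: "prob (E N) \<le> q N" if N: "N > 0" for N
  proof -
    have one: "prob {\<omega>\<in>space M. L (X j \<omega>) > sqrt (real N) / 2} \<le> q N / N" for j
    proof -
      have "prob {\<omega>\<in>space M. L (X j \<omega>) > sqrt (real N) / 2}
          = (\<integral>\<omega>. indicator {z. L z > sqrt (real N) / 2} (X j \<omega>) \<partial>M)"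
      proof -
        have "(\<integral>\<omega>. indicat_real {z. L z > sqrt (real N) / 2} (X j \<omega>) \<partial>M) =
           (\<integral>\<omega>. indicator {\<omega>\<in>space M. L (X j \<omega>) > sqrt (real N) / 2} \<omega> \<partial>M)"
          by (intro Bochner_Integration.integral_cong) (auto simp: indicator_def)
        then show ?thesis by simp
      qed
      also have "\<dots> = (\<integral>z. indicator {z. L z > sqrt (real N) / 2} z \<partial>D)"
        by (rule integral_sample) simp
      also have "\<dots> \<le> (\<integral>z. 4 * ((L z)\<^sup>2 * indicator {z. L z > sqrt (real N) / 2} z) / N \<partial>D)"
      proof (rule integral_mono')
        show "integrable D (\<lambda>z. 4 * ((L z)\<^sup>2 * indicator {z. L z > sqrt (real N) / 2} z) / N)"
          by (rule Bochner_Integration.integrable_bound[of _ "\<lambda>z. 4 * (L z)\<^sup>2 / N"])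
             (use L2 in \<open>auto simp: indicator_def intro!: AE_I2\<close>)
        fix z
        show "indicator {z. L z > sqrt (real N) / 2} z \<le> 4 * ((L z)\<^sup>2 * indicator {z. L z > sqrt (real N) / 2} z) / N"
        proof (cases "L z > sqrt (real N) / 2")
          case True
          then have "(sqrt N)\<^sup>2 \<le> (2 * L z)\<^sup>2" by (intro power_mono) auto
          then show ?thesis using True N by (simp add: field_simps)
        qed simp
      qed (auto simp: indicator_def)
      also have "\<dots> = q N / N" by (simp add: q_def)
      finally show ?thesis .
    qed
    have "prob (E N) \<le> (\<Sum>j<N. prob {\<omega>\<in>space M. L (X j \<omega>) > sqrt (real N) / 2})"
      unfolding E_def by (rule finite_measure_subadditive_finite) auto
    also have "\<dots> \<le> (\<Sum>j<N. q N / N)" by (intro sum_mono one)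
    also have "\<dots> = q N" using N by simp
    finally show ?thesis .
  qed
  have "whp (\<lambda>N \<omega>. \<omega> \<notin> E N)"
    unfolding whp_def
  proof (intro allI impI)
    fix p :: real assume "p > 0"
    then have "\<forall>\<^sub>F N in sequentially. q N < p" using order_tendstoD(2)[OF q, of p] by simp
    then show "\<forall>\<^sub>F N in sequentially. likely p (\<lambda>\<omega>. \<omega> \<notin> E N)"
      using eventually_gt_at_top[of 0]
    proof eventually_elim
      case (elim N)
      then show ?case using prob_E[of N] E[of N] unfolding likely_def by (intro bexI[of _ "E N"]) auto
    qed
  qed
  moreover have "AE \<omega> in M. \<forall>j. X j \<omega> \<in> \<Xi>"
    using AE_sample[OF \<Xi>] by (simp add: AE_all_countable)
  note whp_AE[OF this]
  ultimately have "whp (\<lambda>N \<omega>. \<omega> \<notin> E N \<and> (\<forall>j. X j \<omega> \<in> \<Xi>))" by (rule whp_conj)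
  then show ?thesis
    by (rule whp_mono) (auto simp: E_def small_envelope_def not_less)
qed

text \<open>A weak law of large numbers: with |f| as its own envelope and u = 1,
  \<open>deviation_tail\<close> gives order sqrt N at any prescribed probability, which is
  eventually below \<eta> N.\<close>

lemma whp_deviation_small:
  fixes f :: "'s \<Rightarrow> real"
  assumes f [measurable]: "f \<in> borel_measurable S" and f2: "integrable D (\<lambda>z. (f z)\<^sup>2)"
    and \<eta>: "\<eta> > 0"
  shows "whp (\<lambda>N \<omega>. \<bar>deviation N \<omega> f\<bar> \<le> \<eta> * real N)"
proof -
  define \<kappa> where "\<kappa> = (\<integral>z. (f z)\<^sup>2 \<partial>D)"
  have "whp (\<lambda>N \<omega>. small_envelope UNIV (\<lambda>z. \<bar>f z\<bar>) N \<omega> \<longrightarrow> \<bar>deviation N \<omega> f\<bar> \<le> \<eta> * real N)"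
    unfolding whp_def
  proof (intro allI impI)
    fix p :: real assume p: "p > 0"
    define x where "x = \<kappa> - ln (p / 2)"
    have "\<forall>\<^sub>F N in sequentially. \<eta> * real N \<ge> sqrt (real N) * (x + 2 * \<kappa>) \<and> N > 0"
      using \<eta> by (intro eventually_conj eventually_gt_at_top) real_asymp
    then show "\<forall>\<^sub>F N in sequentially. likely p (\<lambda>\<omega>.
        small_envelope UNIV (\<lambda>z. \<bar>f z\<bar>) N \<omega> \<longrightarrow> \<bar>deviation N \<omega> f\<bar> \<le> \<eta> * real N)"
    proof eventually_elim
      case (elim N)
      obtain E where "E \<in> events" "prob E \<le> 2 * exp (\<kappa> - x)"
        "\<And>\<omega>. \<omega> \<in> space M - E \<Longrightarrow> small_envelope UNIV (\<lambda>z. \<bar>f z\<bar>) N \<omega> \<Longrightarrow>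
           \<bar>deviation N \<omega> f\<bar> \<le> sqrt N * 1 * (x + 2 * \<kappa>)"
        by (rule deviation_tail[of f "\<lambda>z. \<bar>f z\<bar>" UNIV 1 N x]) (use elim f2 in \<open>auto simp: \<kappa>_def\<close>)
      moreover have "2 * exp (\<kappa> - x) = p" using p by (simp add: x_def)
      ultimately show ?case
        using elim unfolding likely_def by (intro bexI[of _ E]) force+
    qed
  qed
  moreover have "whp (small_envelope UNIV (\<lambda>z. \<bar>f z\<bar>))"
    by (rule whp_small_envelope) (use f2 in auto)
  ultimately show ?thesis by (rule whp_mono[OF whp_conj]) blast
qed

abbreviation modulus_le ::
  "nat \<Rightarrow> 'w \<Rightarrow> ('a::metric_space \<Rightarrow> 's \<Rightarrow> real) \<Rightarrow> 'a set \<Rightarrow> real \<Rightarrow> real \<Rightarrow> bool" where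
  "modulus_le N \<omega> \<psi> \<Theta> h c \<equiv> \<forall>\<theta>\<in>\<Theta>. \<forall>\<theta>'\<in>\<Theta>. dist \<theta> \<theta>' \<le> h \<longrightarrow>
     \<bar>deviation N \<omega> (\<psi> \<theta>) - deviation N \<omega> (\<psi> \<theta>')\<bar> \<le> c"

text \<open>At level l the tail parameter x = b l is used for all pairs of net points of levels l
  and l + 1. It grows fast enough for the exceptional probabilities to be summable over all pairs
  and levels, and slowly enough for the increments to be summable against 2^-l. The scale h is fixed
  before N.\<close>

theorem stochastic_equicontinuity:
  fixes \<psi> :: "'a::euclidean_space \<Rightarrow> 's \<Rightarrow> real"
  assumes \<Theta>: "bounded \<Theta>"
    and \<psi>: "\<And>\<theta>. \<theta> \<in> \<Theta> \<Longrightarrow> \<psi> \<theta> \<in> borel_measurable S" "\<And>\<theta>. \<theta> \<in> \<Theta> \<Longrightarrow> integrable D (\<psi> \<theta>)"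
    and L [measurable]: "L \<in> borel_measurable S"
    and L0: "\<And>z. L z \<ge> 0" and L2: "integrable D (\<lambda>z. (L z)\<^sup>2)"
    and \<Xi>: "AE z in D. z \<in> \<Xi>"
    and lip: "\<And>\<theta> \<theta>' z. \<theta> \<in> \<Theta> \<Longrightarrow> \<theta>' \<in> \<Theta> \<Longrightarrow> z \<in> \<Xi> \<Longrightarrow> \<bar>\<psi> \<theta> z - \<psi> \<theta>' z\<bar> \<le> L z * dist \<theta> \<theta>'"
    and \<epsilon>: "\<epsilon> > 0" and p: "p > 0"
  shows "\<exists>h>0. \<forall>\<^sub>F N in sequentially. likely p (\<lambda>\<omega>. modulus_le N \<omega> \<psi> \<Theta> h (\<epsilon> * sqrt (real N)))"
proof -
  define \<kappa> where "\<kappa> = (\<integral>z. (L z)\<^sup>2 \<partial>D)"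
  have \<kappa>: "\<kappa> \<ge> 0" by (simp add: \<kappa>_def)
  have int_L: "integrable D L" by (rule D.square_integrable_imp_integrable[OF _ L2]) simp
  obtain T and K B :: real where B: "B \<ge> 1" and T: "\<And>l. finite (T l)" "\<And>l. T l \<subseteq> \<Theta>"
    "\<And>l. real (card (T l)) \<le> K * B ^ l" "\<And>l \<theta>. \<theta> \<in> \<Theta> \<Longrightarrow> \<exists>t\<in>T l. dist \<theta> t \<le> (1/2) ^ l"
    using bounded_dyadic_nets[OF \<Theta>] by metis
  have K: "K \<ge> 0" using T(3)[of 0] by (simp add: order_trans[OF of_nat_0_le_iff])
  \<comment> \<open>Chosen so that exp(-b l) = 2^-l / B^(2 l): the factor B^(2 l) cancels the growth
    of the number of pairs and a geometric series remains.\<close>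
  define b where "b = ln 2 + 2 * ln B"
  have b: "b \<ge> 0" using B by (simp add: b_def)
  have exp_b: "exp (- (b * real l)) = (1/2) ^ l / (B ^ l)\<^sup>2" for l
  proof -
    have "exp b = 2 * B\<^sup>2" using B by (simp add: b_def exp_add exp_of_nat_mult[of 2, simplified])
    then have "exp (b * real l) = (2 * B\<^sup>2) ^ l" by (simp add: exp_of_nat2_mult)
    then show ?thesis
      by (simp add: exp_minus power_mult_distrib power_mult[symmetric] mult.commute divide_simps)
  qed
  \<comment> \<open>The factor x + 2 \<kappa> of \<open>deviation_tail\<close> at x = b l; its part
    2 \<kappa> pays for the truncation bias.\<close>
  define r where "r l = b * real l + 2 * \<kappa>" for l :: nat
  have r0: "r l \<ge> 0" for l using b \<kappa> by (simp add: r_def)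
  define q where "q l = r l * (2 * (1/2) ^ l)" for l :: nat
  have sum_q: "summable q"
  proof -
    have "summable (\<lambda>l. real l * (1/2) ^ l)"
      using summable_diff[OF sums_summable[OF geometric_deriv_sums[of "1/2::real"]] summable_geometric[of "1/2::real"]]
      by (simp add: algebra_simps)
    then have "summable (\<lambda>l. 2 * b * (real l * (1/2) ^ l) + 4 * \<kappa> * (1/2) ^ l)"
      by (intro summable_add summable_mult summable_geometric) auto
    then show ?thesis by (simp add: q_def[abs_def] r_def algebra_simps)
  qed
  define U where "U l = T l \<union> T (Suc l)" for l
  have U: "finite (U l)" "U l \<subseteq> \<Theta>" for l
    unfolding U_def using T(1)[of l] T(1)[of "Suc l"] T(2)[of l] T(2)[of "Suc l"] by auto
  \<comment> \<open>The square of the bound 2 K B on card (U l) / B^l, times the factor 2 exp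
    \<kappa> of the tail estimate.\<close>
  define Q where "Q = 8 * K\<^sup>2 * B\<^sup>2 * exp \<kappa>"
  have card_U: "(real (card (U l)))\<^sup>2 * (2 * exp (\<kappa> - b * real l)) \<le> Q * (1/2) ^ l" for l
  proof -
    have "real (card (U l)) \<le> real (card (T l)) + real (card (T (Suc l)))"
      unfolding U_def using card_Un_le[of "T l" "T (Suc l)"] by linarith
    also have "\<dots> \<le> K * B ^ Suc l + K * B ^ Suc l"
    proof (rule add_mono)
      have "K * B ^ l \<le> K * B ^ Suc l" by (intro mult_left_mono power_increasing K B) simp
      with T(3)[of l] show "real (card (T l)) \<le> K * B ^ Suc l" by (rule order_trans)
    qed (rule T(3))
    also have "\<dots> = 2 * K * B * B ^ l" by simp
    finally have "real (card (U l)) \<le> 2 * K * B * B ^ l" .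
    then have "(real (card (U l)))\<^sup>2 \<le> (2 * K * B * B ^ l)\<^sup>2" by (intro power_mono) auto
    then have "(real (card (U l)))\<^sup>2 * (2 * exp (\<kappa> - b * real l)) \<le> (2 * K * B * B ^ l)\<^sup>2 * (2 * exp (\<kappa> - b * real l))"
      by (intro mult_right_mono) auto
    also have "\<dots> = (2 * K * B * B ^ l)\<^sup>2 * (2 * (exp \<kappa> * ((1/2) ^ l / (B ^ l)\<^sup>2)))"
      unfolding exp_b[symmetric] exp_add[symmetric] by simp
    also have "\<dots> = Q * (1/2) ^ l"
    proof -
      have "(2 * K * B * c)\<^sup>2 * (2 * (e * (d / c\<^sup>2))) = 8 * K\<^sup>2 * B\<^sup>2 * e * d" if "c \<noteq> 0" for c d e :: real
        using that by (simp add: power2_eq_square)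
      moreover have "B ^ l \<noteq> 0" using B by simp
      ultimately show ?thesis unfolding Q_def by blast
    qed
    finally show ?thesis .
  qed
  have "(\<lambda>L. 4 * (\<Sum>l. q (l + L))) \<longlonglongrightarrow> 4 * 0"
    by (intro tendsto_intros suminf_tail_tendsto_0 sum_q)
  moreover have "(\<lambda>L. 2 * Q * (1/2) ^ L) \<longlonglongrightarrow> 2 * Q * 0"
    by (intro tendsto_intros LIMSEQ_power_zero) simp
  ultimately have "eventually (\<lambda>L. 4 * (\<Sum>l. q (l + L)) < \<epsilon> \<and> 2 * Q * (1/2) ^ L < p / 2) sequentially"
    using \<epsilon> p by (intro eventually_conj order_tendstoD) auto
  \<comment> \<open>Starting the chains at level m makes both the accumulated increments and the
    total exceptional probability 2 Q 2^-m small; h will be 2^-m.\<close>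
  then obtain m where m: "4 * (\<Sum>l. q (l + m)) < \<epsilon>" "2 * Q * (1/2) ^ m < p / 2"
    by (auto simp: eventually_sequentially)
  define links_le where "links_le N \<omega> \<longleftrightarrow> (\<forall>l\<ge>m. \<forall>s\<in>U l. \<forall>t\<in>U l.
      \<bar>deviation N \<omega> (\<lambda>z. \<psi> s z - \<psi> t z)\<bar> \<le> sqrt N * dist s t * r l)" for N \<omega>
  \<comment> \<open>Stated as an implication so that the probability of leaving
    \<open>small_envelope\<close> is not counted again for each of the infinitely many
    links.\<close>
  have links: "likely (p / 2) (\<lambda>\<omega>. small_envelope \<Xi> L N \<omega> \<longrightarrow> links_le N \<omega>)" if N: "N > 0" for N
  proof -
    define good where "good l s t E \<longleftrightarrow> E \<in> events \<and> prob E \<le> 2 * exp (\<kappa> - b * real l) \<and>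
        (\<forall>\<omega>\<in>space M - E. small_envelope \<Xi> L N \<omega> \<longrightarrow>
          \<bar>deviation N \<omega> (\<lambda>z. \<psi> s z - \<psi> t z)\<bar> \<le> sqrt N * dist s t * r l)" for l s t E
    define F where "F l s t = (SOME E. good l s t E)" for l s t
    have F: "good l s t (F l s t)" if "s \<in> \<Theta>" "t \<in> \<Theta>" for l s t
    proof -
      have [measurable]: "\<psi> s \<in> borel_measurable S" "\<psi> t \<in> borel_measurable S" using \<psi>(1) that by auto
      have "\<exists>E. good l s t E"
        unfolding good_def
        by (rule deviation_tail[of "\<lambda>z. \<psi> s z - \<psi> t z" L \<Xi> "dist s t" N "b * real l"])
           (use L0 L2 \<Xi> N lip[OF that] in \<open>auto simp: \<kappa>_def r_def\<close>)
      then show ?thesis unfolding F_def by (rule someI_ex)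
    qed
    then have F: "\<And>l s t. s \<in> \<Theta> \<Longrightarrow> t \<in> \<Theta> \<Longrightarrow> F l s t \<in> events"
      "\<And>l s t. s \<in> \<Theta> \<Longrightarrow> t \<in> \<Theta> \<Longrightarrow> prob (F l s t) \<le> 2 * exp (\<kappa> - b * real l)"
      "\<And>l s t \<omega>. s \<in> \<Theta> \<Longrightarrow> t \<in> \<Theta> \<Longrightarrow> \<omega> \<in> space M - F l s t \<Longrightarrow> small_envelope \<Xi> L N \<omega> \<Longrightarrow>
        \<bar>deviation N \<omega> (\<lambda>z. \<psi> s z - \<psi> t z)\<bar> \<le> sqrt N * dist s t * r l"
      unfolding good_def by blast+
    define G where "G l = (\<Union>st\<in>U l \<times> U l. F l (fst st) (snd st))" for l
    have G: "G l \<in> events" for l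
      unfolding G_def by (intro sets.finite_UN) (use U F(1) in \<open>auto simp: subset_iff\<close>)
    have prob_G: "prob (G l) \<le> Q * (1/2) ^ l" for l
    proof -
      have "prob (G l) \<le> (\<Sum>st\<in>U l \<times> U l. prob (F l (fst st) (snd st)))"
        unfolding G_def by (rule finite_measure_subadditive_finite) (use U F(1) in \<open>auto simp: subset_iff\<close>)
      also have "\<dots> \<le> (\<Sum>st\<in>U l \<times> U l. 2 * exp (\<kappa> - b * real l))"
        by (intro sum_mono F) (use U(2)[of l] in auto)
      also have "\<dots> = (real (card (U l)))\<^sup>2 * (2 * exp (\<kappa> - b * real l))"
        by (simp add: card_cartesian_product power2_eq_square)
      also have "\<dots> \<le> Q * (1/2) ^ l" by (rule card_U)
      finally show ?thesis .
    qed
    define E where "E = (\<Union>l. G (l + m))"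
    have E: "E \<in> events" unfolding E_def by (intro sets.countable_UN) (use G in auto)
    have geo: "summable (\<lambda>l. Q * (1/2) ^ (l + m))" "(\<Sum>l. Q * (1/2) ^ (l + m)) = 2 * Q * (1/2) ^ m"
      using sums_mult[OF geometric_sums[of "1/2::real"], of "Q * (1/2) ^ m"]
      by (auto simp: sums_iff power_add mult_ac)
    have sum_G: "summable (\<lambda>l. prob (G (l + m)))"
      by (rule summable_comparison_test'[OF geo(1)]) (use prob_G in auto)
    have "prob E \<le> (\<Sum>l. prob (G (l + m)))"
      unfolding E_def by (rule finite_measure_subadditive_countably) (use G sum_G in auto)
    also have "\<dots> \<le> (\<Sum>l. Q * (1/2) ^ (l + m))"
      by (intro suminf_le prob_G sum_G geo)
    also have "\<dots> \<le> p / 2" using m geo by simp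
    finally have prob_E: "prob E \<le> p / 2" .
    show ?thesis
      unfolding likely_def links_le_def
    proof (intro bexI[of _ E] conjI ballI impI allI)
      fix \<omega> l s t
      assume \<omega>: "\<omega> \<in> space M - E" "small_envelope \<Xi> L N \<omega>" and l: "l \<ge> m" and st: "s \<in> U l" "t \<in> U l"
      have "\<omega> \<notin> G l" using \<omega>(1) l unfolding E_def by (auto dest: spec[of _ "l - m"])
      then have "\<omega> \<notin> F l s t" using st by (force simp: G_def)
      then show "\<bar>deviation N \<omega> (\<lambda>z. \<psi> s z - \<psi> t z)\<bar> \<le> sqrt N * dist s t * r l"
        using F(3)[OF subsetD[OF U(2) st(1)] subsetD[OF U(2) st(2)]] \<omega> by blast
    qed (rule prob_E E)+
  qed
  have "\<forall>\<^sub>F N in sequentially. likely p (\<lambda>\<omega>. small_envelope \<Xi> L N \<omega> \<and> (small_envelope \<Xi> L N \<omega> \<longrightarrow>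
      links_le N \<omega>))"
    using p by (intro eventually_likely_conj whpD whp_small_envelope L L2 \<Xi>
        eventually_mono[OF eventually_gt_at_top[of 0] links]) auto
  then have "\<forall>\<^sub>F N in sequentially. likely p (\<lambda>\<omega>. modulus_le N \<omega> \<psi> \<Theta> ((1/2) ^ m) (\<epsilon> * sqrt (real N)))"
    using eventually_gt_at_top[of 0]
  proof eventually_elim
    case (elim N)
    note N = elim(2)
    show ?case
    proof (rule likely_mono[OF elim(1)], intro ballI impI, elim conjE)
      fix \<omega> \<theta> \<theta>'
      assume \<theta>: "\<theta> \<in> \<Theta>" "\<theta>' \<in> \<Theta>" "dist \<theta> \<theta>' \<le> (1/2) ^ m" and small: "small_envelope \<Xi> L N \<omega>"
        and "small_envelope \<Xi> L N \<omega> \<longrightarrow> links_le N \<omega>"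
      then have link: "\<bar>deviation N \<omega> (\<lambda>z. \<psi> s z - \<psi> t z)\<bar> \<le> sqrt N * dist s t * r l"
        if "l \<ge> m" "s \<in> U l" "t \<in> U l" for l s t
        using that unfolding links_le_def by blast
      have sN: "sqrt N > 0" using N by simp
      define g where "g \<theta> = deviation N \<omega> (\<psi> \<theta>) / sqrt N" for \<theta>
      have diff: "g s - g t = deviation N \<omega> (\<lambda>z. \<psi> s z - \<psi> t z) / sqrt N" if "s \<in> \<Theta>" "t \<in> \<Theta>" for s t
        using that by (simp add: g_def deviation_diff \<psi> diff_divide_distrib)
      \<comment> \<open>A crude Lipschitz constant of the normalized process for the given sample.
        It depends on N, which is harmless because \<open>chaining_bound\<close> uses it only to let
        the chains converge.\<close>
      define c where "c = (\<Sum>j<N. sqrt (real N) / 2 + (\<integral>z. L z \<partial>D)) / sqrt N"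
      have c: "c \<ge> 0" unfolding c_def by (intro divide_nonneg_nonneg sum_nonneg add_nonneg_nonneg) (auto simp: L0)
      have "\<bar>g \<theta> - g \<theta>'\<bar> \<le> 4 * (\<Sum>l. r (l + m) * (2 * (1/2) ^ (l + m)))"
      proof (rule chaining_bound[where T = T and \<Theta> = \<Theta> and c = c])
        fix s t assume st: "s \<in> \<Theta>" "t \<in> \<Theta>"
        have "\<bar>deviation N \<omega> (\<lambda>z. \<psi> s z - \<psi> t z)\<bar> \<le>
           (\<Sum>j<N. \<bar>\<psi> s (X j \<omega>) - \<psi> t (X j \<omega>) - (\<integral>z. \<psi> s z - \<psi> t z \<partial>D)\<bar>)"
          unfolding deviation_def by (rule sum_abs)
        also have "\<dots> \<le> (\<Sum>j<N. (sqrt N / 2 + (\<integral>z. L z \<partial>D)) * dist s t)"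
        proof (rule sum_mono)
          fix j assume "j \<in> {..<N}"
          then have j: "X j \<omega> \<in> \<Xi>" "L (X j \<omega>) \<le> sqrt N / 2" using small by (auto simp: small_envelope_def)
          have "\<bar>\<psi> s (X j \<omega>) - \<psi> t (X j \<omega>)\<bar> \<le> sqrt N / 2 * dist s t"
            using lip[OF st j(1)] mult_right_mono[OF j(2), of "dist s t"] by simp
          moreover have "\<bar>\<integral>z. \<psi> s z - \<psi> t z \<partial>D\<bar> \<le> (\<integral>z. L z * dist s t \<partial>D)"
          proof -
            have "\<bar>\<integral>z. \<psi> s z - \<psi> t z \<partial>D\<bar> \<le> (\<integral>z. \<bar>\<psi> s z - \<psi> t z\<bar> \<partial>D)"
              by (rule integral_abs_bound)
            also have "\<dots> \<le> (\<integral>z. L z * dist s t \<partial>D)"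
              by (rule integral_mono_AE) (use \<psi>(2) st int_L \<Xi> lip[OF st] in auto)
            finally show ?thesis .
          qed
          ultimately have "\<bar>\<psi> s (X j \<omega>) - \<psi> t (X j \<omega>) - (\<integral>z. \<psi> s z - \<psi> t z \<partial>D)\<bar>
             \<le> sqrt N / 2 * dist s t + (\<integral>z. L z * dist s t \<partial>D)"
            by linarith
          then show "\<bar>\<psi> s (X j \<omega>) - \<psi> t (X j \<omega>) - (\<integral>z. \<psi> s z - \<psi> t z \<partial>D)\<bar>
             \<le> (sqrt N / 2 + (\<integral>z. L z \<partial>D)) * dist s t"
            by (simp add: distrib_right)
        qed
        finally show "\<bar>g s - g t\<bar> \<le> c * dist s t"
          using sN by (simp add: diff[OF st] c_def sum_distrib_right[symmetric] field_simps)
      next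
        fix l s t assume l: "l \<ge> m" and st: "s \<in> T l \<union> T (Suc l)" "t \<in> T l \<union> T (Suc l)"
        then have st': "s \<in> U l" "t \<in> U l" "s \<in> \<Theta>" "t \<in> \<Theta>" using U(2)[of l] by (auto simp: U_def)
        have "\<bar>deviation N \<omega> (\<lambda>z. \<psi> s z - \<psi> t z)\<bar> \<le> sqrt N * dist s t * r l" by (rule link[OF l st'(1,2)])
        then show "\<bar>g s - g t\<bar> \<le> r l * dist s t"
          using sN by (simp add: diff[OF st'(3,4)] field_simps)
      qed (use T r0 c sum_q \<theta> in \<open>auto simp: q_def[abs_def]\<close>)
      also have "\<dots> \<le> \<epsilon>" using m(1) by (simp add: q_def)
      finally have "\<bar>deviation N \<omega> (\<psi> \<theta>) - deviation N \<omega> (\<psi> \<theta>')\<bar> / sqrt N \<le> \<epsilon>"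
        using sN by (simp add: g_def diff_divide_distrib[symmetric])
      then show "\<bar>deviation N \<omega> (\<psi> \<theta>) - deviation N \<omega> (\<psi> \<theta>')\<bar> \<le> \<epsilon> * sqrt (real N)"
        using sN by (simp add: pos_divide_le_eq)
    qed
  qed
  then show ?thesis by (intro exI[of _ "(1/2) ^ m"]) simp
qed

text \<open>A uniform law of large numbers: equicontinuity at scale h reduces the supremum to a
  finite net of mesh below h, where the pointwise law applies. The modulus of order sqrt N is
  absorbed because sqrt N \<le> N.\<close>

theorem whp_uniform_deviation_small:
  fixes \<psi> :: "'a::euclidean_space \<Rightarrow> 's \<Rightarrow> real"
  assumes \<Theta>: "bounded \<Theta>"
    and \<psi>: "\<And>\<theta>. \<theta> \<in> \<Theta> \<Longrightarrow> \<psi> \<theta> \<in> borel_measurable S" "\<And>\<theta>. \<theta> \<in> \<Theta> \<Longrightarrow> integrable D (\<lambda>z. (\<psi> \<theta> z)\<^sup>2)"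
    and L [measurable]: "L \<in> borel_measurable S"
    and L0: "\<And>z. L z \<ge> 0" and L2: "integrable D (\<lambda>z. (L z)\<^sup>2)"
    and \<Xi>: "AE z in D. z \<in> \<Xi>"
    and lip: "\<And>\<theta> \<theta>' z. \<theta> \<in> \<Theta> \<Longrightarrow> \<theta>' \<in> \<Theta> \<Longrightarrow> z \<in> \<Xi> \<Longrightarrow> \<bar>\<psi> \<theta> z - \<psi> \<theta>' z\<bar> \<le> L z * dist \<theta> \<theta>'"
    and \<eta>: "\<eta> > 0"
  shows "whp (\<lambda>N \<omega>. \<forall>\<theta>\<in>\<Theta>. \<bar>deviation N \<omega> (\<psi> \<theta>)\<bar> \<le> \<eta> * real N)"
  unfolding whp_def
proof (intro allI impI)
  fix p :: real assume p: "p > 0"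
  have int: "integrable D (\<psi> \<theta>)" if "\<theta> \<in> \<Theta>" for \<theta>
    using D.square_integrable_imp_integrable[OF _ \<psi>(2)[OF that]] \<psi>(1)[OF that] by simp
  obtain h where h: "h > 0" and equi: "\<forall>\<^sub>F N in sequentially. likely (p / 2) (\<lambda>\<omega>.
    modulus_le N \<omega> \<psi> \<Theta> h (\<eta> / 2 * sqrt (real N)))"
    using stochastic_equicontinuity[OF \<Theta> \<psi>(1) int L L0 L2 \<Xi> lip, of "\<eta> / 2" "p / 2"] \<eta> p by auto
  obtain T and K B :: real where T: "\<And>l. finite (T l)" "\<And>l. T l \<subseteq> \<Theta>"
    "\<And>l \<theta>. \<theta> \<in> \<Theta> \<Longrightarrow> \<exists>t\<in>T l. dist \<theta> t \<le> (1/2) ^ l"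
    using bounded_dyadic_nets[OF \<Theta>] by metis
  obtain l where l: "(1/2 :: real) ^ l < h" using real_arch_pow_inv[OF h, of "1/2"] by auto
  have "whp (\<lambda>N \<omega>. \<forall>t\<in>T l. \<bar>deviation N \<omega> (\<psi> t)\<bar> \<le> \<eta> / 2 * real N)"
    by (intro whp_finite_ball whp_deviation_small \<psi> T(1) subsetD[OF T(2)[of l]]) (use \<eta> in auto)
  with p have "\<forall>\<^sub>F N in sequentially. likely (p / 2) (\<lambda>\<omega>. \<forall>t\<in>T l. \<bar>deviation N \<omega> (\<psi> t)\<bar> \<le> \<eta> / 2 * real N)"
    by (intro whpD) auto
  from eventually_likely_conj[OF equi this]
  show "\<forall>\<^sub>F N in sequentially. likely p (\<lambda>\<omega>. \<forall>\<theta>\<in>\<Theta>. \<bar>deviation N \<omega> (\<psi> \<theta>)\<bar> \<le> \<eta> * real N)"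
  proof (rule eventually_mono)
    fix N
    assume "likely p (\<lambda>\<omega>. modulus_le N \<omega> \<psi> \<Theta> h (\<eta> / 2 * sqrt (real N)) \<and>
      (\<forall>t\<in>T l. \<bar>deviation N \<omega> (\<psi> t)\<bar> \<le> \<eta> / 2 * real N))"
    then show "likely p (\<lambda>\<omega>. \<forall>\<theta>\<in>\<Theta>. \<bar>deviation N \<omega> (\<psi> \<theta>)\<bar> \<le> \<eta> * real N)"
    proof (rule likely_mono, intro ballI, elim conjE)
      fix \<omega> \<theta>
      assume E1: "modulus_le N \<omega> \<psi> \<Theta> h (\<eta> / 2 * sqrt (real N))"
        and E2: "\<forall>t\<in>T l. \<bar>deviation N \<omega> (\<psi> t)\<bar> \<le> \<eta> / 2 * real N" and \<theta>: "\<theta> \<in> \<Theta>"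
      obtain t where t: "t \<in> T l" "dist \<theta> t \<le> (1/2) ^ l" using T(3)[OF \<theta>] by blast
      have "\<bar>deviation N \<omega> (\<psi> \<theta>) - deviation N \<omega> (\<psi> t)\<bar> \<le> \<eta> / 2 * sqrt (real N)"
        using E1 \<theta> t l T(2) by force
      also have "\<dots> \<le> \<eta> / 2 * real N"
      proof (intro mult_left_mono)
        show "sqrt (real N) \<le> real N" by (cases "N = 0") (auto intro!: real_le_lsqrt simp: power2_eq_square)
      qed (use \<eta> in simp)
      finally have "\<bar>deviation N \<omega> (\<psi> \<theta>) - deviation N \<omega> (\<psi> t)\<bar> \<le> \<eta> / 2 * real N" .
      moreover have "\<bar>deviation N \<omega> (\<psi> t)\<bar> \<le> \<eta> / 2 * real N" using E2 t(1) by blast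
      ultimately show "\<bar>deviation N \<omega> (\<psi> \<theta>)\<bar> \<le> \<eta> * real N" by argo
    qed
  qed
qed

end

section \<open>Average value-at-risk\<close>

abbreviation mean_excess :: "'w measure \<Rightarrow> ('w \<Rightarrow> real) \<Rightarrow> real \<Rightarrow> real" where
  "mean_excess M Z t \<equiv> \<integral>\<omega>. max (Z \<omega> - t) 0 \<partial>M"

context prob_space begin

context
  fixes Z :: "'a \<Rightarrow> real"
  assumes Z: "integrable M Z"
begin

text \<open>Inverse transform sampling: under the uniform distribution on (0, 1) the quantile
  function has the law of Z. This is the construction behind Skorohod's theorem, provided by
  \<open>cdf_distribution\<close>.\<close>

lemma quantile_transform:
  fixes g :: "real \<Rightarrow> real"
  assumes g [measurable]: "g \<in> borel_measurable borel" and int: "integrable M (\<lambda>\<omega>. g (Z \<omega>))"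
  shows "set_integrable lborel {0<..<1} (\<lambda>u. g (quantile M Z u))"
    and "(LINT u:{0<..<1}|lborel. g (quantile M Z u)) = (\<integral>\<omega>. g (Z \<omega>) \<partial>M)"
proof -
  have Zm [measurable]: "Z \<in> borel_measurable M" using Z by simp
  define \<mu> where "\<mu> = distr M borel Z"
  interpret \<mu>: cdf_distribution \<mu>
    unfolding cdf_distribution_def \<mu>_def by (rule real_distribution_distr) simp
  have q: "quantile M Z = \<mu>.I" by (simp add: fun_eq_iff quantile_def \<mu>_def)
  have [measurable]: "\<mu>.I \<in> borel_measurable (restrict_space lborel {0<..<1})"
    using \<mu>.measurable_CI by (simp cong: measurable_cong_sets)
  have "integrable \<mu> g" using int by (simp add: \<mu>_def integrable_distr_eq)
  then have "integrable (distr (restrict_space lborel {0<..<1::real}) borel \<mu>.I) g"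
    by (simp add: \<mu>.distr_I_eq_M)
  then have "integrable (restrict_space lborel {0<..<1::real}) (\<lambda>u. g (\<mu>.I u))"
    by (simp add: integrable_distr_eq)
  then show "set_integrable lborel {0<..<1} (\<lambda>u. g (quantile M Z u))"
    by (simp add: q integrable_restrict_space set_integrable_def)
  have "(\<integral>\<omega>. g (Z \<omega>) \<partial>M) = (\<integral>z. g z \<partial>\<mu>)" by (simp add: \<mu>_def integral_distr)
  also have "\<dots> = (\<integral>z. g z \<partial>distr (restrict_space lborel {0<..<1::real}) borel \<mu>.I)"
    by (simp add: \<mu>.distr_I_eq_M)
  also have "\<dots> = (\<integral>u. g (\<mu>.I u) \<partial>restrict_space lborel {0<..<1})"
    by (simp add: integral_distr)
  also have "\<dots> = (LINT u:{0<..<1}|lborel. g (quantile M Z u))"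
    by (simp add: q integral_restrict_space set_lebesgue_integral_def)
  finally show "(LINT u:{0<..<1}|lborel. g (quantile M Z u)) = (\<integral>\<omega>. g (Z \<omega>) \<partial>M)" ..
qed

lemma quantile_mono:
  assumes "0 < u" "u \<le> v" "v < 1"
  shows "quantile M Z u \<le> quantile M Z v"
proof -
  have Zm [measurable]: "Z \<in> borel_measurable M" using Z by simp
  interpret \<mu>: cdf_distribution "distr M borel Z"
    unfolding cdf_distribution_def by (rule real_distribution_distr) simp
  show ?thesis
    using mono_onD[OF \<mu>.mono_I, of u v] assms by (simp add: quantile_def)
qed

lemma integrable_excess: "integrable M (\<lambda>\<omega>. max (Z \<omega> - t) 0)"
  using Z by (intro integrable_max) auto

context
  fixes a :: real
  assumes a: "0 < a" "a < 1"
begin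

lemma set_integrable_quantile_tail: "set_integrable lborel {a<..<1} (quantile M Z)"
  by (rule set_integrable_subset[OF quantile_transform(1)[of "\<lambda>x. x"]]) (use Z a in auto)

lemma tail_integral_shift:
  "set_integrable lborel {a<..<1} (\<lambda>u. quantile M Z u - t)"
  "(LINT u:{a<..<1}|lborel. quantile M Z u - t) = (LINT u:{a<..<1}|lborel. quantile M Z u) - (1 - a) * t"
proof -
  have c: "set_integrable lborel {a<..<1} (\<lambda>_. t)" "(LINT u:{a<..<1}|lborel. t) = (1 - a) * t"
    using a by (auto simp: set_integrable_def set_lebesgue_integral_def)
  show "set_integrable lborel {a<..<1} (\<lambda>u. quantile M Z u - t)"
    by (rule set_integral_diff(1)[OF set_integrable_quantile_tail c(1)])
  show "(LINT u:{a<..<1}|lborel. quantile M Z u - t) = (LINT u:{a<..<1}|lborel. quantile M Z u) - (1 - a) * t"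
    by (simp only: set_integral_diff(2)[OF set_integrable_quantile_tail c(1)] c(2))
qed

text \<open>On (a, 1) the integrand \<open>quantile - t\<close> is below its positive part, whose
  integral over all of (0, 1) is the mean excess by the quantile transform.\<close>

lemma AVaR_le: "AVaR M a Z \<le> t + 1 / (1 - a) * mean_excess M Z t"
proof -
  have ex: "set_integrable lborel {0<..<1} (\<lambda>u. max (quantile M Z u - t) 0)"
    "(LINT u:{0<..<1}|lborel. max (quantile M Z u - t) 0) = mean_excess M Z t"
    using quantile_transform[of "\<lambda>z. max (z - t) 0"] integrable_excess by auto
  have "(LINT u:{a<..<1}|lborel. quantile M Z u - t) \<le> (LINT u:{0<..<1}|lborel. max (quantile M Z u - t) 0)"
    using tail_integral_shift(1) ex(1) a unfolding set_lebesgue_integral_def set_integrable_def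
    by (intro integral_mono) (auto simp: indicator_def)
  then have "(LINT u:{a<..<1}|lborel. quantile M Z u) \<le> (1 - a) * t + mean_excess M Z t"
    using tail_integral_shift(2)[of t] ex(2) by linarith
  then have "AVaR M a Z \<le> ((1 - a) * t + mean_excess M Z t) / (1 - a)"
    using a by (simp add: AVaR_def divide_right_mono)
  also have "\<dots> = t + 1 / (1 - a) * mean_excess M Z t"
    using a by (simp add: add_divide_distrib)
  finally show ?thesis .
qed

text \<open>At t = \<open>quantile M Z a\<close> monotonicity makes the positive part vanish to the
  left of a and act as the identity to the right, so the estimate of \<open>AVaR_le\<close> loses
  nothing. Thus the infimum over t in the variational formula is attained.\<close>

lemma AVaR_eq:
  "AVaR M a Z = quantile M Z a + 1 / (1 - a) * mean_excess M Z (quantile M Z a)"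
proof -
  define t where "t = quantile M Z a"
  have "mean_excess M Z t = (LINT u:{0<..<1}|lborel. max (quantile M Z u - t) 0)"
    using quantile_transform(2)[of "\<lambda>z. max (z - t) 0"] integrable_excess by simp
  also have "\<dots> = (LINT u:{a<..<1}|lborel. quantile M Z u - t)"
    unfolding set_lebesgue_integral_def
  proof (intro Bochner_Integration.integral_cong refl)
    fix u :: real
    show "indicat_real {0<..<1} u *\<^sub>R max (quantile M Z u - t) 0 = indicat_real {a<..<1} u *\<^sub>R (quantile M Z u - t)"
      using quantile_mono[of a u] quantile_mono[of u a] a by (auto simp: indicator_def t_def)
  qed
  also have "\<dots> = (LINT u:{a<..<1}|lborel. quantile M Z u) - (1 - a) * t"
    by (rule tail_integral_shift)
  finally have "mean_excess M Z t = (LINT u:{a<..<1}|lborel. quantile M Z u) - (1 - a) * t" .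
  then show ?thesis using a by (simp add: AVaR_def t_def[symmetric] field_simps)
qed

end

end

end

text \<open>As \<open>phi\<close> is linear in w, its expectation is the inner product of w with
  this vector, which gives the bilinear form of the minimax problem for any probability
  space.\<close>

definition mean_cost :: "'w measure \<Rightarrow> real ^ 'k \<Rightarrow> ('w \<Rightarrow> real) \<Rightarrow> real ^ 'k \<Rightarrow> real \<times> (real ^ 'k)" where
  "mean_cost M \<alpha> Z \<tau> =
     (\<integral>\<omega>. Z \<omega> \<partial>M, \<chi> i. \<tau> $ i + 1 / (1 - \<alpha> $ i) * mean_excess M Z (\<tau> $ i))"

lemma inner_mean_cost:
  "inner w (mean_cost M \<alpha> Z \<tau>) = fst w * (\<integral>\<omega>. Z \<omega> \<partial>M) +
     (\<Sum>i\<in>UNIV. snd w $ i * (\<tau> $ i + 1 / (1 - \<alpha> $ i) * mean_excess M Z (\<tau> $ i)))"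
  by (simp add: mean_cost_def inner_prod_def inner_vec_def)

lemma (in prob_space) integral_phi:
  assumes "integrable M Z"
  shows "integrable M (\<lambda>\<omega>. phi \<alpha> (Z \<omega>) w \<tau>)"
    and "(\<integral>\<omega>. phi \<alpha> (Z \<omega>) w \<tau> \<partial>M) = inner w (mean_cost M \<alpha> Z \<tau>)"
  using assms integrable_excess[OF assms]
  by (simp_all add: phi_def inner_mean_cost prob_space)

lemma (in prob_space) AVaR_mixture_le:
  assumes "integrable M Z" "w \<in> simplex_weights" "\<And>i. 0 < \<alpha> $ i \<and> \<alpha> $ i < 1"
  shows "AVaR_mixture M \<alpha> w Z \<le> inner w (mean_cost M \<alpha> Z \<tau>)"
  using assms unfolding AVaR_mixture_def inner_mean_cost
  by (intro add_mono sum_mono mult_left_mono AVaR_le) (auto simp: simplex_weights_def)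

lemma (in prob_space) AVaR_mixture_eq:
  assumes "integrable M Z" "\<And>i. 0 < \<alpha> $ i \<and> \<alpha> $ i < 1"
  shows "AVaR_mixture M \<alpha> w Z = inner w (mean_cost M \<alpha> Z (\<chi> i. quantile M Z (\<alpha> $ i)))"
  using assms unfolding AVaR_mixture_def inner_mean_cost by (simp add: AVaR_eq)

text \<open>The inequality assumed for z combines monotonicity in z with convexity in (z, \<tau>). A
  loss that is convex in x supplies exactly such an inequality.\<close>

lemma phi_mono_convex:
  assumes w: "w \<in> simplex_weights" and \<alpha>: "\<And>i. 0 < \<alpha> $ i \<and> \<alpha> $ i < 1"
    and pq: "0 \<le> p" "0 \<le> q" "p + q = 1" and z: "z \<le> p * z1 + q * z2"
  shows "phi \<alpha> z w (p *\<^sub>R \<tau>1 + q *\<^sub>R \<tau>2) \<le> p * phi \<alpha> z1 w \<tau>1 + q * phi \<alpha> z2 w \<tau>2"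
proof -
  have "snd w $ i * ((p *\<^sub>R \<tau>1 + q *\<^sub>R \<tau>2) $ i + 1 / (1 - \<alpha> $ i) * max (z - (p *\<^sub>R \<tau>1 + q *\<^sub>R \<tau>2) $ i) 0) \<le>
     p * (snd w $ i * (\<tau>1 $ i + 1 / (1 - \<alpha> $ i) * max (z1 - \<tau>1 $ i) 0)) +
     q * (snd w $ i * (\<tau>2 $ i + 1 / (1 - \<alpha> $ i) * max (z2 - \<tau>2 $ i) 0))" for i
  proof -
    have le: "max (z - (p *\<^sub>R \<tau>1 + q *\<^sub>R \<tau>2) $ i) 0 \<le> p * max (z1 - \<tau>1 $ i) 0 + q * max (z2 - \<tau>2 $ i) 0"
    proof (rule max.boundedI)
      have "p * (z1 - \<tau>1 $ i) + q * (z2 - \<tau>2 $ i) \<le> p * max (z1 - \<tau>1 $ i) 0 + q * max (z2 - \<tau>2 $ i) 0"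
        by (intro add_mono mult_left_mono pq) auto
      then show "z - (p *\<^sub>R \<tau>1 + q *\<^sub>R \<tau>2) $ i \<le> p * max (z1 - \<tau>1 $ i) 0 + q * max (z2 - \<tau>2 $ i) 0"
        using z by (simp add: right_diff_distrib)
    qed (use pq in simp)
    have c: "1 / (1 - \<alpha> $ i) \<ge> 0" "snd w $ i \<ge> 0" using \<alpha>[of i] w by (auto simp: simplex_weights_def)
    have "snd w $ i * ((p *\<^sub>R \<tau>1 + q *\<^sub>R \<tau>2) $ i + 1 / (1 - \<alpha> $ i) * max (z - (p *\<^sub>R \<tau>1 + q *\<^sub>R \<tau>2) $ i) 0) \<le>
      snd w $ i * ((p *\<^sub>R \<tau>1 + q *\<^sub>R \<tau>2) $ i +
        1 / (1 - \<alpha> $ i) * (p * max (z1 - \<tau>1 $ i) 0 + q * max (z2 - \<tau>2 $ i) 0))"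
      by (intro mult_left_mono add_left_mono le c)
    also have "\<dots> = p * (snd w $ i * (\<tau>1 $ i + 1 / (1 - \<alpha> $ i) * max (z1 - \<tau>1 $ i) 0)) +
     q * (snd w $ i * (\<tau>2 $ i + 1 / (1 - \<alpha> $ i) * max (z2 - \<tau>2 $ i) 0))"
      by (simp add: distrib_left mult_ac)
    finally show ?thesis .
  qed
  then have "(\<Sum>i\<in>UNIV. snd w $ i * ((p *\<^sub>R \<tau>1 + q *\<^sub>R \<tau>2) $ i + 1 / (1 - \<alpha> $ i) * max (z - (p *\<^sub>R \<tau>1 + q *\<^sub>R \<tau>2) $ i) 0))
     \<le> (\<Sum>i\<in>UNIV. p * (snd w $ i * (\<tau>1 $ i + 1 / (1 - \<alpha> $ i) * max (z1 - \<tau>1 $ i) 0)) +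
     q * (snd w $ i * (\<tau>2 $ i + 1 / (1 - \<alpha> $ i) * max (z2 - \<tau>2 $ i) 0)))"
    by (intro sum_mono)
  moreover have "fst w * z \<le> fst w * (p * z1 + q * z2)"
    using w z by (intro mult_left_mono) (auto simp: simplex_weights_def)
  ultimately show ?thesis
    by (simp add: phi_def sum.distrib sum_distrib_left algebra_simps)
qed

lemma (in prob_space) mean_le_excess_cost:
  fixes Z :: "'a \<Rightarrow> real"
  assumes Z: "integrable M Z" and a: "0 < a" "a < 1"
  shows "(\<integral>\<omega>. Z \<omega> \<partial>M) \<le> t + 1 / (1 - a) * mean_excess M Z t"
proof -
  have "(\<integral>\<omega>. Z \<omega> \<partial>M) - t = (\<integral>\<omega>. Z \<omega> - t \<partial>M)" using Z by (simp add: prob_space)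
  also have "\<dots> \<le> mean_excess M Z t"
    by (intro integral_mono integrable_excess Bochner_Integration.integrable_diff Z) auto
  also have "\<dots> = 1 * mean_excess M Z t" by simp
  also have "\<dots> \<le> 1 / (1 - a) * mean_excess M Z t"
    using a by (intro mult_right_mono) (auto simp: field_simps)
  finally show ?thesis by simp
qed

lemma (in prob_space) mean_le_inner_mean_cost:
  assumes Z: "integrable M Z" and w: "w \<in> simplex_weights" and \<alpha>: "\<And>i. 0 < \<alpha> $ i \<and> \<alpha> $ i < 1"
  shows "(\<integral>\<omega>. Z \<omega> \<partial>M) \<le> inner w (mean_cost M \<alpha> Z \<tau>)"
proof -
  have nn: "0 \<le> snd w $ i" "fst w + (\<Sum>i\<in>UNIV. snd w $ i) = 1" for i
    using w by (auto simp: simplex_weights_def)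
  have "(\<integral>\<omega>. Z \<omega> \<partial>M) = (fst w + (\<Sum>i\<in>UNIV. snd w $ i)) * (\<integral>\<omega>. Z \<omega> \<partial>M)" using nn by simp
  also have "\<dots> = fst w * (\<integral>\<omega>. Z \<omega> \<partial>M) + (\<Sum>i\<in>UNIV. snd w $ i * (\<integral>\<omega>. Z \<omega> \<partial>M))"
    by (simp add: distrib_right sum_distrib_right)
  also have "\<dots> \<le> inner w (mean_cost M \<alpha> Z \<tau>)"
    unfolding inner_mean_cost
    by (intro add_left_mono sum_mono mult_left_mono mean_le_excess_cost Z nn) (use \<alpha> in auto)
  finally show ?thesis .
qed

section \<open>Minimax form of the risk-averse problem\<close>

lemma norm_simplex_weights:
  assumes "w \<in> simplex_weights"
  shows "norm w \<le> 1"
proof -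
  have w: "0 \<le> fst w" "\<And>i. 0 \<le> snd w $ i" "fst w + (\<Sum>i\<in>UNIV. snd w $ i) = 1"
    using assms by (auto simp: simplex_weights_def)
  have "norm w \<le> norm (fst w) + norm (snd w)" by (metis norm_Pair_le prod.collapse)
  also have "norm (snd w) \<le> (\<Sum>i\<in>UNIV. \<bar>snd w $ i\<bar>)" by (rule norm_le_l1_cart)
  finally show ?thesis using w by simp
qed

lemma inner_simplex_weights_one: "w \<in> simplex_weights \<Longrightarrow> inner w (1, \<chi> i. 1) = 1"
  by (simp add: simplex_weights_def inner_prod_def inner_vec_def)

text \<open>Average, over the indices, the vectors that are nonzero at the respective index;
  nonnegativity of the weights prevents cancellation.\<close>

lemma exists_positive_weight:
  fixes W :: "(real \<times> (real ^ 'k)) set"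
  assumes "convex W" "W \<subseteq> simplex_weights" "\<And>i. \<exists>w\<in>W. snd w $ i \<noteq> 0"
  shows "\<exists>w\<in>W. \<forall>i. 0 < snd w $ i"
proof -
  obtain v where v: "\<And>i. v i \<in> W" "\<And>i. snd (v i) $ i \<noteq> 0" using assms(3) by metis
  have pos: "0 \<le> snd (v i) $ j" for i j using v(1)[of i] assms(2) by (auto simp: simplex_weights_def)
  define c where "c = 1 / real CARD('k)"
  have c: "c > 0" by (simp add: c_def)
  define w where "w = (\<Sum>i\<in>UNIV. c *\<^sub>R v i)"
  have "w \<in> W" unfolding w_def by (rule convex_sum[OF _ assms(1)]) (use v in \<open>auto simp: c_def\<close>)
  moreover have "0 < snd w $ j" for j
  proof -
    have "snd w $ j = (\<Sum>i\<in>UNIV. c * (snd (v i) $ j))" by (simp add: w_def snd_sum)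
    also have "\<dots> \<ge> c * (snd (v j) $ j)"
      by (rule member_le_sum) (use pos c in auto)
    moreover have "c * (snd (v j) $ j) > 0" using pos[of j j] v(2)[of j] c by (simp add: less_le)
    ultimately show ?thesis by linarith
  qed
  ultimately show ?thesis by blast
qed

definition positive_weight :: "(real \<times> (real ^ 'k)) set \<Rightarrow> real \<times> (real ^ 'k)" where
  "positive_weight W = (SOME w. w \<in> W \<and> (\<forall>i. 0 < snd w $ i))"

text \<open>Bounds \<open>\<tau>\<close> wherever the objective is not larger than at \<open>\<tau> = 0\<close>, for losses of mean
  absolute value at most \<open>B\<close>. It does not depend on the probability space, so one box
  serves the true problem and its sample averages.\<close>

definition box_radius :: "real ^ 'k \<Rightarrow> (real \<times> (real ^ 'k)) set \<Rightarrow> real \<Rightarrow> real" where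
  "box_radius \<alpha> W B =
     (let R = (\<Sum>i\<in>UNIV. (2 + (\<Sum>j\<in>UNIV. 1 / (1 - \<alpha> $ j))) * B / snd (positive_weight W) $ i)
      in R + (\<Sum>i\<in>UNIV. (R + B) / \<alpha> $ i))"

definition tau_box :: "real \<Rightarrow> (real ^ 'k) set" where
  "tau_box T = {\<tau>. \<forall>i. \<bar>\<tau> $ i\<bar> \<le> T}"

lemma tau_box_eq_cbox: "tau_box T = cbox (\<chi> i. - T) (\<chi> i. T)"
  by (auto simp: tau_box_def mem_box_cart abs_le_iff) (smt (verit))+

lemma tau_box_mono: "S \<le> T \<Longrightarrow> tau_box S \<subseteq> tau_box T"
  by (auto simp: tau_box_def intro: order_trans)

lemma compact_tau_box: "compact (tau_box T)"
  by (simp add: tau_box_eq_cbox)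

text \<open>Instantiated for the true distribution and, outcome by outcome, for the empirical
  distribution of a sample. The pathwise conditions are only almost sure because they are known only
  on the support.\<close>

locale cvar_problem = prob_space M for M :: "'w measure" +
  fixes \<alpha> :: "real ^ 'k" and W :: "(real \<times> (real ^ 'k)) set" and X :: "'x::euclidean_space set"
    and Z :: "'x \<Rightarrow> 'w \<Rightarrow> real" and L :: "'w \<Rightarrow> real"
  assumes X: "X \<noteq> {}" "compact X" "convex X"
    and \<alpha>: "\<And>i. 0 < \<alpha> $ i \<and> \<alpha> $ i < 1"
    and W: "W \<noteq> {}" "closed W" "convex W" "W \<subseteq> simplex_weights"
    and W_nonzero: "\<And>i. \<exists>w\<in>W. snd w $ i \<noteq> 0"
    and Z_int: "\<And>x. x \<in> X \<Longrightarrow> integrable M (Z x)"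
    and L_int: "integrable M L"
    and Z_lipschitz: "AE \<omega> in M. \<forall>x\<in>X. \<forall>x'\<in>X. \<bar>Z x \<omega> - Z x' \<omega>\<bar> \<le> L \<omega> * norm (x - x')"
    and Z_convex: "AE \<omega> in M. convex_on X (\<lambda>x. Z x \<omega>)"
begin

definition A :: "'x \<times> (real ^ 'k) \<Rightarrow> real \<times> (real ^ 'k)" where
  "A y = mean_cost M \<alpha> (Z (fst y)) (snd y)"

lemma inner_A:
  "fst y \<in> X \<Longrightarrow> inner w (A y) = (\<integral>\<omega>. phi \<alpha> (Z (fst y) \<omega>) w (snd y) \<partial>M)"
  by (simp add: A_def integral_phi(2)[OF Z_int])

lemma compact_W: "compact W"
proof -
  have "bounded W"
    unfolding bounded_iff using W(4) norm_simplex_weights by blast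
  then show ?thesis using W(2) by (simp add: compact_eq_bounded_closed)
qed

lemma inner_one: "w \<in> W \<Longrightarrow> inner w (1, \<chi> i. 1) = 1"
  using W(4) inner_simplex_weights_one by blast

lemma convex_domain: "convex (X \<times> (UNIV :: (real ^ 'k) set))"
  by (intro convex_Times X convex_UNIV)

lemma convex_on_inner_A:
  assumes "w \<in> simplex_weights"
  shows "convex_on (X \<times> UNIV) (\<lambda>y. inner w (A y))"
  unfolding convex_on_def
proof (intro conjI ballI allI impI convex_domain)
  fix y y' :: "'x \<times> (real ^ 'k)" and p q :: real
  assume y: "y \<in> X \<times> UNIV" "y' \<in> X \<times> UNIV" and pq: "0 \<le> p" "0 \<le> q" "p + q = 1"
  have x: "fst y \<in> X" "fst y' \<in> X" using y by auto
  have xx: "p *\<^sub>R fst y + q *\<^sub>R fst y' \<in> X" using X(3) x pq by (auto simp: convex_def)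
  have "inner w (A (p *\<^sub>R y + q *\<^sub>R y')) =
      (\<integral>\<omega>. phi \<alpha> (Z (p *\<^sub>R fst y + q *\<^sub>R fst y') \<omega>) w (p *\<^sub>R snd y + q *\<^sub>R snd y') \<partial>M)"
    using inner_A[of "p *\<^sub>R y + q *\<^sub>R y'"] xx by simp
  also have "\<dots> \<le> (\<integral>\<omega>. p * phi \<alpha> (Z (fst y) \<omega>) w (snd y) + q * phi \<alpha> (Z (fst y') \<omega>) w (snd y') \<partial>M)"
  proof (rule integral_mono_AE)
    show "AE \<omega> in M. phi \<alpha> (Z (p *\<^sub>R fst y + q *\<^sub>R fst y') \<omega>) w (p *\<^sub>R snd y + q *\<^sub>R snd y')
       \<le> p * phi \<alpha> (Z (fst y) \<omega>) w (snd y) + q * phi \<alpha> (Z (fst y') \<omega>) w (snd y')"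
      using Z_convex
    proof eventually_elim
      case (elim \<omega>)
      then show ?case
        using x pq by (intro phi_mono_convex assms \<alpha>) (auto simp: convex_on_def)
    qed
  qed (intro Bochner_Integration.integrable_add integrable_mult_right integral_phi(1) Z_int x xx)+
  also have "\<dots> = p * inner w (A y) + q * inner w (A y')"
    using x by (simp add: inner_A integral_phi(1)[OF Z_int])
  finally show "inner w (A (p *\<^sub>R y + q *\<^sub>R y')) \<le> p * inner w (A y) + q * inner w (A y')" .
qed

lemma mean_excess_lipschitz:
  assumes x: "x \<in> X" "x' \<in> X"
  shows "\<bar>mean_excess M (Z x) t - mean_excess M (Z x') t'\<bar>
    \<le> (\<integral>\<omega>. L \<omega> \<partial>M) * norm (x - x') + \<bar>t - t'\<bar>"
    "\<bar>(\<integral>\<omega>. Z x \<omega> \<partial>M) - (\<integral>\<omega>. Z x' \<omega> \<partial>M)\<bar> \<le> (\<integral>\<omega>. L \<omega> \<partial>M) * norm (x - x')"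
proof -
  have "\<bar>mean_excess M (Z x) t - mean_excess M (Z x') t'\<bar> =
      \<bar>\<integral>\<omega>. max (Z x \<omega> - t) 0 - max (Z x' \<omega> - t') 0 \<partial>M\<bar>"
    using integrable_excess Z_int x by simp
  also have "\<dots> \<le> (\<integral>\<omega>. \<bar>max (Z x \<omega> - t) 0 - max (Z x' \<omega> - t') 0\<bar> \<partial>M)"
    by (rule integral_abs_bound)
  also have "\<dots> \<le> (\<integral>\<omega>. L \<omega> * norm (x - x') + \<bar>t - t'\<bar> \<partial>M)"
  proof (rule integral_mono_AE)
    show "AE \<omega> in M. \<bar>max (Z x \<omega> - t) 0 - max (Z x' \<omega> - t') 0\<bar> \<le> L \<omega> * norm (x - x') + \<bar>t - t'\<bar>"
      using Z_lipschitz
    proof eventually_elim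
      case (elim \<omega>)
      then have "\<bar>Z x \<omega> - Z x' \<omega>\<bar> \<le> L \<omega> * norm (x - x')" using x by blast
      then show ?case by linarith
    qed
  qed (use L_int integrable_excess Z_int x in auto)
  also have "\<dots> = (\<integral>\<omega>. L \<omega> \<partial>M) * norm (x - x') + \<bar>t - t'\<bar>"
    using L_int by (simp add: prob_space)
  finally show "\<bar>mean_excess M (Z x) t - mean_excess M (Z x') t'\<bar>
    \<le> (\<integral>\<omega>. L \<omega> \<partial>M) * norm (x - x') + \<bar>t - t'\<bar>" .
  have "\<bar>(\<integral>\<omega>. Z x \<omega> \<partial>M) - (\<integral>\<omega>. Z x' \<omega> \<partial>M)\<bar> = \<bar>\<integral>\<omega>. Z x \<omega> - Z x' \<omega> \<partial>M\<bar>"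
    using Z_int x by simp
  also have "\<dots> \<le> (\<integral>\<omega>. \<bar>Z x \<omega> - Z x' \<omega>\<bar> \<partial>M)" by (rule integral_abs_bound)
  also have "\<dots> \<le> (\<integral>\<omega>. L \<omega> * norm (x - x') \<partial>M)"
    by (rule integral_mono_AE) (use Z_lipschitz L_int Z_int x in auto)
  finally show "\<bar>(\<integral>\<omega>. Z x \<omega> \<partial>M) - (\<integral>\<omega>. Z x' \<omega> \<partial>M)\<bar> \<le> (\<integral>\<omega>. L \<omega> \<partial>M) * norm (x - x')"
    by simp
qed

lemma continuous_on_A: "continuous_on (X \<times> UNIV) A"
proof -
  define K where "K = \<bar>\<integral>\<omega>. L \<omega> \<partial>M\<bar> + 1"
  have lip: "K-lipschitz_on (X \<times> UNIV) f"
    if f: "\<And>y y'. y \<in> X \<times> UNIV \<Longrightarrow> y' \<in> X \<times> UNIV \<Longrightarrow>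
      \<bar>f y - f y'\<bar> \<le> (\<integral>\<omega>. L \<omega> \<partial>M) * norm (fst y - fst y') + norm (snd y - snd y')"
    for f :: "'x \<times> (real ^ 'k) \<Rightarrow> real"
  proof (rule lipschitz_onI)
    fix y y' :: "'x \<times> (real ^ 'k)" assume y: "y \<in> X \<times> UNIV" "y' \<in> X \<times> UNIV"
    have "norm (fst y - fst y') \<le> dist y y'" "norm (snd y - snd y') \<le> dist y y'"
      using dist_fst_le[of y y'] dist_snd_le[of y y'] by (auto simp: dist_norm)
    then have "\<bar>\<integral>\<omega>. L \<omega> \<partial>M\<bar> * norm (fst y - fst y') + norm (snd y - snd y')
        \<le> \<bar>\<integral>\<omega>. L \<omega> \<partial>M\<bar> * dist y y' + dist y y'"
      by (intro add_mono mult_left_mono) auto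
    moreover have "(\<integral>\<omega>. L \<omega> \<partial>M) * norm (fst y - fst y') \<le> \<bar>\<integral>\<omega>. L \<omega> \<partial>M\<bar> * norm (fst y - fst y')"
      by (intro mult_right_mono) auto
    ultimately show "dist (f y) (f y') \<le> K * dist y y'"
      using f[OF y] by (simp add: dist_real_def K_def distrib_right)
  qed (simp add: K_def)
  have "continuous_on (X \<times> UNIV) (\<lambda>y :: 'x \<times> (real ^ 'k). \<integral>\<omega>. max (Z (fst y) \<omega> - snd y $ i) 0 \<partial>M)" for i
  proof (rule lipschitz_on_continuous_on[OF lip])
    fix y y' :: "'x \<times> (real ^ 'k)" assume "y \<in> X \<times> UNIV" "y' \<in> X \<times> UNIV"
    then show "\<bar>mean_excess M (Z (fst y)) (snd y $ i) - mean_excess M (Z (fst y')) (snd y' $ i)\<bar>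
       \<le> (\<integral>\<omega>. L \<omega> \<partial>M) * norm (fst y - fst y') + norm (snd y - snd y')"
      using mean_excess_lipschitz(1)[of "fst y" "fst y'" "snd y $ i" "snd y' $ i"]
        component_le_norm_cart[of "snd y - snd y'" i] by auto
  qed
  moreover have "continuous_on (X \<times> UNIV) (\<lambda>y :: 'x \<times> (real ^ 'k). \<integral>\<omega>. Z (fst y) \<omega> \<partial>M)"
  proof (rule lipschitz_on_continuous_on[OF lip])
    fix y y' :: "'x \<times> (real ^ 'k)" assume "y \<in> X \<times> UNIV" "y' \<in> X \<times> UNIV"
    then show "\<bar>(\<integral>\<omega>. Z (fst y) \<omega> \<partial>M) - (\<integral>\<omega>. Z (fst y') \<omega> \<partial>M)\<bar>
       \<le> (\<integral>\<omega>. L \<omega> \<partial>M) * norm (fst y - fst y') + norm (snd y - snd y')"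
      using mean_excess_lipschitz(2)[of "fst y" "fst y'"] by (auto simp: add_increasing2)
  qed
  ultimately show ?thesis
    unfolding A_def[abs_def] mean_cost_def by (intro continuous_intros)
qed

lemma positive_weight: "positive_weight W \<in> W" "0 < snd (positive_weight W) $ i"
proof -
  have "\<exists>w. w \<in> W \<and> (\<forall>i. 0 < snd w $ i)"
    using exists_positive_weight[OF W(3,4) W_nonzero] by blast
  from someI_ex[OF this] show "positive_weight W \<in> W" "0 < snd (positive_weight W) $ i"
    unfolding positive_weight_def by blast+
qed

text \<open>All components a i of the cost vector are at least -B, and at \<tau> = 0 every weighting
  costs at most c B. A weight vector with positive entries therefore bounds every a i from above by
  R, and each a i controls \<tau>_i on both sides through \<open>a1\<close> and
  \<open>a2\<close>.\<close>

lemma sublevel_in_box: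
  assumes B: "\<And>x. x \<in> X \<Longrightarrow> (\<integral>\<omega>. \<bar>Z x \<omega>\<bar> \<partial>M) \<le> B" and x0: "x0 \<in> X"
    and y: "y \<in> X \<times> UNIV" "support_fun W (A y) \<le> support_fun W (A (x0, 0))"
  shows "snd y \<in> tau_box (box_radius \<alpha> W B)"
proof -
  define c where "c = 1 + (\<Sum>j\<in>UNIV. 1 / (1 - \<alpha> $ j))"
  define w where "w = positive_weight W"
  have w: "w \<in> W" "\<And>i. 0 < snd w $ i" unfolding w_def by (rule positive_weight)+
  have wS: "w \<in> simplex_weights" using w W(4) by blast
  have inv: "1 / (1 - \<alpha> $ i) > 0" for i using \<alpha>[of i] by simp
  have c_ge: "1 / (1 - \<alpha> $ i) \<le> c" "1 \<le> c" for i
    using member_le_sum[of i UNIV "\<lambda>j. 1 / (1 - \<alpha> $ j)"] inv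
    by (auto simp: c_def less_imp_le sum_nonneg intro: order_trans)
  have "0 \<le> (\<integral>\<omega>. \<bar>Z x0 \<omega>\<bar> \<partial>M)" by simp
  then have B0: "B \<ge> 0" using B[OF x0] by linarith
  obtain x \<tau> where xt: "y = (x, \<tau>)" "x \<in> X" using y by auto
  define m where "m = (\<integral>\<omega>. Z x \<omega> \<partial>M)"
  have m: "\<bar>m\<bar> \<le> B" unfolding m_def using integral_abs_bound[of M "Z x"] B[OF xt(2)] by linarith
  define a where "a i = \<tau> $ i + 1 / (1 - \<alpha> $ i) * mean_excess M (Z x) (\<tau> $ i)" for i
  have a1: "\<tau> $ i \<le> a i" for i using inv[of i] by (simp add: a_def)
  have ex: "m - \<tau> $ i \<le> mean_excess M (Z x) (\<tau> $ i)" for i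
  proof -
    have "m - \<tau> $ i = (\<integral>\<omega>. Z x \<omega> - \<tau> $ i \<partial>M)" using Z_int xt by (simp add: m_def prob_space)
    also have "\<dots> \<le> mean_excess M (Z x) (\<tau> $ i)"
      by (intro integral_mono integrable_excess) (use Z_int xt in auto)
    finally show ?thesis .
  qed
  \<comment> \<open>Bounding the positive part below by Z - \<tau>_i gives a i the slope -\<alpha>_i
    / (1 - \<alpha>_i) in \<tau>_i; as this is negative, an upper bound on a i bounds \<tau>_i from
    below.\<close>
  have a2: "(m - \<alpha> $ i * \<tau> $ i) / (1 - \<alpha> $ i) \<le> a i" for i
  proof -
    have "\<tau> $ i + 1 / (1 - \<alpha> $ i) * (m - \<tau> $ i) \<le> a i"
      unfolding a_def using ex inv[of i] by (intro add_left_mono mult_left_mono) auto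
    moreover have "\<tau> $ i + 1 / (1 - \<alpha> $ i) * (m - \<tau> $ i) = (m - \<alpha> $ i * \<tau> $ i) / (1 - \<alpha> $ i)"
      using \<alpha>[of i] by (simp add: field_simps)
    ultimately show ?thesis by simp
  qed
  have a3: "- B \<le> a i" for i
    using mean_le_excess_cost[OF Z_int[OF xt(2)], of "\<alpha> $ i" "\<tau> $ i"] \<alpha>[of i] m by (simp add: a_def m_def)
  have upper: "support_fun W (A (x0, 0)) \<le> c * B"
    unfolding support_fun_le_iff[OF compact_W W(1)]
  proof
    fix v assume "v \<in> W"
    then have v: "0 \<le> fst v" "\<And>i. 0 \<le> snd v $ i" "fst v + (\<Sum>i\<in>UNIV. snd v $ i) = 1"
      using W(4) by (auto simp: simplex_weights_def)
    have "(\<integral>\<omega>. max (Z x0 \<omega>) 0 \<partial>M) \<le> (\<integral>\<omega>. \<bar>Z x0 \<omega>\<bar> \<partial>M)"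
      by (intro integral_mono) (use Z_int x0 in auto)
    then have ex0: "(\<integral>\<omega>. max (Z x0 \<omega>) 0 \<partial>M) \<le> B" using B[OF x0] by linarith
    have "(\<integral>\<omega>. Z x0 \<omega> \<partial>M) \<le> 1 * B" using integral_abs_bound[of M "Z x0"] B[OF x0] by linarith
    also have "\<dots> \<le> c * B" by (intro mult_right_mono c_ge B0)
    finally have m0: "(\<integral>\<omega>. Z x0 \<omega> \<partial>M) \<le> c * B" .
    have e0: "1 / (1 - \<alpha> $ i) * (\<integral>\<omega>. max (Z x0 \<omega>) 0 \<partial>M) \<le> c * B" for i
      using c_ge(1)[of i] c_ge(2) ex0 by (intro mult_mono) auto
    have "inner v (A (x0, 0)) = fst v * (\<integral>\<omega>. Z x0 \<omega> \<partial>M) +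
        (\<Sum>i\<in>UNIV. snd v $ i * (1 / (1 - \<alpha> $ i) * (\<integral>\<omega>. max (Z x0 \<omega>) 0 \<partial>M)))"
      by (simp add: A_def inner_mean_cost)
    also have "\<dots> \<le> fst v * (c * B) + (\<Sum>i\<in>UNIV. snd v $ i * (c * B))"
      by (intro add_mono mult_left_mono sum_mono m0 e0 v)
    also have "\<dots> = (fst v + (\<Sum>i\<in>UNIV. snd v $ i)) * (c * B)"
      by (simp add: sum_distrib_right distrib_right)
    finally show "inner v (A (x0, 0)) \<le> c * B" using v by simp
  qed
  define r where "r i = (1 + c) * B / snd w $ i" for i
  have r0: "r i \<ge> 0" for i unfolding r_def using w(2)[of i] c_ge B0 by (intro divide_nonneg_pos mult_nonneg_nonneg) auto
  have a_le: "a i \<le> r i" for i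
  proof -
    have nn: "0 \<le> fst w" "\<And>j. 0 \<le> snd w $ j" "fst w + (\<Sum>i\<in>UNIV. snd w $ i) = 1"
      using wS by (auto simp: simplex_weights_def)
    \<comment> \<open>Adding B makes all summands nonnegative, so a single one is bounded by the
      whole sum.\<close>
    have "snd w $ i * (a i + B) \<le> (\<Sum>j\<in>UNIV. snd w $ j * (a j + B))"
    proof (rule member_le_sum)
      show "0 \<le> snd w $ j * (a j + B)" for j
        using a3[of j] by (intro mult_nonneg_nonneg nn) linarith
    qed auto
    moreover have "0 \<le> fst w * (m + B)" using nn(1) m by (intro mult_nonneg_nonneg) auto
    ultimately have "snd w $ i * (a i + B) \<le> fst w * (m + B) + (\<Sum>j\<in>UNIV. snd w $ j * (a j + B))" by linarith
    also have "\<dots> = fst w * m + (\<Sum>j\<in>UNIV. snd w $ j * a j) + (fst w + (\<Sum>i\<in>UNIV. snd w $ i)) * B"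
      by (simp add: distrib_left sum.distrib sum_distrib_right distrib_right)
    also have "\<dots> = inner w (A y) + B" using nn by (simp add: A_def inner_mean_cost xt a_def m_def)
    also have "inner w (A y) \<le> c * B"
      using inner_le_support_fun[OF compact_W W(1) w(1), of "A y"] y(2) upper by linarith
    finally have "snd w $ i * (a i + B) \<le> (1 + c) * B" by (simp add: distrib_right)
    then have "a i + B \<le> r i" using w(2)[of i] by (simp add: r_def pos_le_divide_eq mult.commute)
    then show ?thesis using B0 by simp
  qed
  define R where "R = (\<Sum>i\<in>UNIV. r i)"
  have a_R: "a i \<le> R" for i
    using a_le[of i] member_le_sum[of i UNIV r] r0 by (auto simp: R_def)
  have R0: "R \<ge> 0" unfolding R_def by (intro sum_nonneg r0)
  define s where "s = (\<Sum>i\<in>UNIV. (R + B) / \<alpha> $ i)"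
  have s_ge: "(R + B) / \<alpha> $ i \<le> s" for i
    unfolding s_def by (rule member_le_sum) (use R0 B0 \<alpha> in \<open>auto simp: less_imp_le intro!: divide_nonneg_pos\<close>)
  have s0: "s \<ge> 0" unfolding s_def using R0 B0 \<alpha> by (intro sum_nonneg divide_nonneg_pos) auto
  have "box_radius \<alpha> W B = R + s"
    by (simp add: box_radius_def Let_def R_def s_def r_def c_def w_def)
  moreover have "\<bar>\<tau> $ i\<bar> \<le> R + s" for i
  proof -
    have "\<tau> $ i \<le> R" using a1[of i] a_R[of i] by linarith
    moreover have "- \<tau> $ i \<le> (R + B) / \<alpha> $ i"
    proof -
      have "(m - \<alpha> $ i * \<tau> $ i) \<le> R * (1 - \<alpha> $ i)"
        using a2[of i] a_R[of i] \<alpha>[of i] by (simp add: pos_divide_le_eq[symmetric])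
      also have "\<dots> \<le> R * 1" using R0 \<alpha>[of i] by (intro mult_left_mono) auto
      finally have "- \<tau> $ i * \<alpha> $ i \<le> R + B" using m by (simp add: mult.commute)
      then show ?thesis using \<alpha>[of i] by (simp add: pos_le_divide_eq)
    qed
    ultimately show ?thesis using s_ge[of i] s0 R0 by linarith
  qed
  ultimately show ?thesis by (simp add: tau_box_def xt)
qed

lemma mean_abs_bounded: "\<exists>B. \<forall>x\<in>X. (\<integral>\<omega>. \<bar>Z x \<omega>\<bar> \<partial>M) \<le> B"
proof -
  obtain x0 where x0: "x0 \<in> X" using X by blast
  obtain b where b: "\<And>x. x \<in> X \<Longrightarrow> norm x \<le> b" using compact_imp_bounded[OF X(2)] by (auto simp: bounded_iff)
  have "(\<integral>\<omega>. \<bar>Z x \<omega>\<bar> \<partial>M) \<le> (\<integral>\<omega>. \<bar>Z x0 \<omega>\<bar> + \<bar>L \<omega>\<bar> * (2 * b) \<partial>M)" if x: "x \<in> X" for x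
  proof (rule integral_mono_AE)
    have "norm (x - x0) \<le> 2 * b" using norm_triangle_ineq4[of x x0] b[OF x] b[OF x0] by linarith
    then have "\<bar>L \<omega>\<bar> * norm (x - x0) \<le> \<bar>L \<omega>\<bar> * (2 * b)" for \<omega> by (intro mult_left_mono) auto
    moreover have "L \<omega> * norm (x - x0) \<le> \<bar>L \<omega>\<bar> * norm (x - x0)" for \<omega> by (intro mult_right_mono) auto
    ultimately have le: "L \<omega> * norm (x - x0) \<le> \<bar>L \<omega>\<bar> * (2 * b)" for \<omega> using order_trans by blast
    show "AE \<omega> in M. \<bar>Z x \<omega>\<bar> \<le> \<bar>Z x0 \<omega>\<bar> + \<bar>L \<omega>\<bar> * (2 * b)"
      using Z_lipschitz
    proof eventually_elim
      case (elim \<omega>)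
      then have "\<bar>Z x \<omega> - Z x0 \<omega>\<bar> \<le> L \<omega> * norm (x - x0)" using x x0 by blast
      then show ?case using le[of \<omega>] by linarith
    qed
  qed (use Z_int L_int x x0 in auto)
  then show ?thesis by blast
qed

text \<open>Attainment is the point to prove: minimize over a compact box that contains the sublevel
  set of a reference point (x0, 0); outside this sublevel set no value is better than that at the
  reference point.\<close>

sublocale saddle: bilinear_saddle W "(1, \<chi> i. 1)" "X \<times> UNIV" A
proof
  obtain B where B: "\<And>x. x \<in> X \<Longrightarrow> (\<integral>\<omega>. \<bar>Z x \<omega>\<bar> \<partial>M) \<le> B" using mean_abs_bounded by blast
  obtain x0 where x0: "x0 \<in> X" using X by blast
  \<comment> \<open>The maximum with 0 guarantees that the reference point (x0, 0) itself lies in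
    K.\<close>
  define K where "K = X \<times> (tau_box (max 0 (box_radius \<alpha> W B)) :: (real ^ 'k) set)"
  have K: "compact K" "(x0, 0) \<in> K"
    using X x0 by (auto simp: K_def intro!: compact_Times compact_tau_box) (simp add: tau_box_def)
  have "continuous_on K (\<lambda>y. support_fun W (A y))"
    by (intro continuous_on_compose2[OF continuous_on_support_fun[OF compact_W W(1), of UNIV]]
        continuous_on_subset[OF continuous_on_A]) (auto simp: K_def)
  then obtain y where y: "y \<in> K" "\<And>y'. y' \<in> K \<Longrightarrow> support_fun W (A y) \<le> support_fun W (A y')"
    using continuous_attains_inf[OF K(1)] K(2) by blast
  show "\<exists>y\<in>X \<times> UNIV. \<forall>y'\<in>X \<times> UNIV. support_fun W (A y) \<le> support_fun W (A y')"
  proof (intro bexI ballI)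
    show "y \<in> X \<times> UNIV" using y by (auto simp: K_def)
    fix y' :: "'x \<times> (real ^ 'k)" assume y': "y' \<in> X \<times> UNIV"
    show "support_fun W (A y) \<le> support_fun W (A y')"
    proof (cases "support_fun W (A y') \<le> support_fun W (A (x0, 0))")
      case True
      then have "snd y' \<in> tau_box (box_radius \<alpha> W B)" using sublevel_in_box[of B x0 y'] B x0 y' by blast
      then have "snd y' \<in> tau_box (max 0 (box_radius \<alpha> W B))"
        using tau_box_mono[of "box_radius \<alpha> W B" "max 0 (box_radius \<alpha> W B)"] by auto
      then have "y' \<in> K" using y' by (simp add: K_def mem_Times_iff)
      then show ?thesis by (rule y(2))
    next
      case False
      then show ?thesis using y(2)[OF K(2)] by simp
    qed
  qed
qed (use compact_W W inner_one convex_domain convex_on_inner_A continuous_on_A in auto)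

lemma minimizers_in_box:
  assumes "\<And>x. x \<in> X \<Longrightarrow> (\<integral>\<omega>. \<bar>Z x \<omega>\<bar> \<partial>M) \<le> B"
  shows "saddle.minimizers \<subseteq> X \<times> tau_box (box_radius \<alpha> W B)"
proof
  fix y assume y: "y \<in> saddle.minimizers"
  obtain x0 where x0: "x0 \<in> X" using X by blast
  have "support_fun W (A y) \<le> support_fun W (A (x0, 0))"
    using y saddle.saddle_value_le[of "(x0, 0)"] x0 by (auto simp: saddle.minimizers_def)
  then show "y \<in> X \<times> tau_box (box_radius \<alpha> W B)"
    using sublevel_in_box[OF assms x0, of y] y by (auto simp: saddle.minimizers_def mem_Times_iff)
qed

section \<open>Solution sets and optimal value in terms of saddle points\<close>

lemma SUP_integral_phi:
  "x \<in> X \<Longrightarrow> (SUP w\<in>W. \<integral>\<omega>. phi \<alpha> (Z x \<omega>) w \<tau> \<partial>M) = support_fun W (A (x, \<tau>))"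
  using inner_A[of "(x, \<tau>)"] by (simp add: support_fun_def)

lemma primal_solutions_eq: "primal_solutions M \<alpha> W X Z = saddle.minimizers"
proof -
  have iff: "is_arg_min (\<lambda>(x, \<tau>). SUP w\<in>W. \<integral>\<omega>. phi \<alpha> (Z x \<omega>) w \<tau> \<partial>M) (\<lambda>p. p \<in> X \<times> UNIV) y \<longleftrightarrow>
     y \<in> X \<times> UNIV \<and> (\<forall>y'\<in>X \<times> UNIV. support_fun W (A y) \<le> support_fun W (A y'))" for y
    by (fastforce simp: is_arg_min_linorder SUP_integral_phi split: prod.splits)
  show ?thesis
    unfolding primal_solutions_def iff saddle.minimizers_def
    using saddle.saddle_value_le saddle.obtain_minimizer order_trans by (metis (no_types, lifting))
qed

lemma AVaR_mixture_le_inner_A: "w \<in> W \<Longrightarrow> y \<in> X \<times> UNIV \<Longrightarrow> AVaR_mixture M \<alpha> w (Z (fst y)) \<le> inner w (A y)"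
  unfolding A_def using W(4) \<alpha> Z_int by (intro AVaR_mixture_le) auto

lemma AVaR_mixture_eq_inner_A:
  "x \<in> X \<Longrightarrow> AVaR_mixture M \<alpha> w (Z x) = inner w (A (x, \<chi> i. quantile M (Z x) (\<alpha> $ i)))"
  unfolding A_def using \<alpha> Z_int by (simp add: AVaR_mixture_eq)

lemma AVaR_mixture_ge: "w \<in> W \<Longrightarrow> x \<in> X \<Longrightarrow> (\<integral>\<omega>. Z x \<omega> \<partial>M) \<le> AVaR_mixture M \<alpha> w (Z x)"
  using W(4) unfolding AVaR_mixture_eq_inner_A A_def fst_conv snd_conv
  by (intro mean_le_inner_mean_cost Z_int \<alpha>) auto

lemma bdd_below_AVaR_mixture: "w \<in> W \<Longrightarrow> bdd_below ((\<lambda>x. AVaR_mixture M \<alpha> w (Z x)) ` X)"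
proof -
  assume w: "w \<in> W"
  obtain B where B: "\<And>x. x \<in> X \<Longrightarrow> (\<integral>\<omega>. \<bar>Z x \<omega>\<bar> \<partial>M) \<le> B" using mean_abs_bounded by blast
  show ?thesis
  proof (rule bdd_belowI2)
    fix x assume x: "x \<in> X"
    show "- B \<le> AVaR_mixture M \<alpha> w (Z x)"
      using AVaR_mixture_ge[OF w x] integral_abs_bound[of M "Z x"] B[OF x] by linarith
  qed
qed

lemma AVaR_mixture_le_saddle_value:
  assumes "y \<in> saddle.minimizers" "w \<in> W"
  shows "AVaR_mixture M \<alpha> w (Z (fst y)) \<le> saddle.saddle_value"
  using AVaR_mixture_le_inner_A[OF assms(2), of y] saddle.minimizers_inner_le[OF assms] assms(1)
  by (auto simp: saddle.minimizers_def)

lemma saddle_value_le_AVaR_mixture: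
  assumes "w \<in> saddle.maximizers" "x \<in> X"
  shows "saddle.saddle_value \<le> AVaR_mixture M \<alpha> w (Z x)"
  using assms by (auto simp: saddle.maximizers_def AVaR_mixture_eq_inner_A)

text \<open>For each x the vector of quantiles minimizes over \<tau> for every w at once, so the
  dual objective in AVaR form is the one of the saddle problem with \<tau> eliminated. A primal
  solution bounds it by the saddle value, and any member of \<open>maximizers\<close> reaches that
  bound.\<close>

lemma dual_solutions_eq: "dual_solutions M \<alpha> W X Z = saddle.maximizers"
proof -
  obtain y0 where y0: "y0 \<in> saddle.minimizers" using saddle.minimizers_nonempty by blast
  then have x0: "fst y0 \<in> X" by (auto simp: saddle.minimizers_def)
  obtain w0 where w0: "w0 \<in> saddle.maximizers" using saddle.maximizers_nonempty by blast
  define g where "g w = (INF x\<in>X. AVaR_mixture M \<alpha> w (Z x))" for w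
  have g_le: "g w \<le> AVaR_mixture M \<alpha> w (Z x)" if "w \<in> W" "x \<in> X" for w x
    unfolding g_def by (rule cINF_lower[OF bdd_below_AVaR_mixture[OF that(1)] that(2)])
  have g_le_value: "g w \<le> saddle.saddle_value" if "w \<in> W" for w
    using g_le[OF that x0] AVaR_mixture_le_saddle_value[OF y0 that] by linarith
  have g_max: "saddle.saddle_value \<le> g w" if "w \<in> saddle.maximizers" for w
    unfolding g_def by (intro cINF_greatest X saddle_value_le_AVaR_mixture that)
  have w0W: "w0 \<in> W" using w0 by (simp add: saddle.maximizers_def)
  have iff: "is_arg_max g (\<lambda>w. w \<in> W) w \<longleftrightarrow> w \<in> saddle.maximizers" for w
  proof
    assume "is_arg_max g (\<lambda>w. w \<in> W) w"
    then have w: "w \<in> W" "g w0 \<le> g w" using w0W unfolding is_arg_max_linorder by blast+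
    have "saddle.saddle_value \<le> inner w (A y)" if y: "y \<in> X \<times> UNIV" for y
      using g_max[OF w0] w(2) g_le[OF w(1), of "fst y"] AVaR_mixture_le_inner_A[OF w(1) y] y
      by (auto simp: mem_Times_iff)
    with w(1) show "w \<in> saddle.maximizers" by (simp add: saddle.maximizers_def)
  next
    assume w: "w \<in> saddle.maximizers"
    then show "is_arg_max g (\<lambda>w. w \<in> W) w"
      using g_le_value g_max[OF w] by (fastforce simp: is_arg_max_linorder saddle.maximizers_def)
  qed
  show ?thesis
    using iff unfolding dual_solutions_def g_def[abs_def] by blast
qed

text \<open>Exchanging the infimum over \<tau> with the supremum over w at a fixed x is avoided by
  using one saddle point: w0 bounds the risk of every x from below by the saddle value, and the
  x-part of y0 meets this bound.\<close>

lemma opt_value_eq: "opt_value M \<alpha> W X Z = saddle.saddle_value"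
proof -
  obtain y0 where y0: "y0 \<in> saddle.minimizers" using saddle.minimizers_nonempty by blast
  then have x0: "fst y0 \<in> X" by (auto simp: saddle.minimizers_def)
  obtain w0 where w0: "w0 \<in> saddle.maximizers" using saddle.maximizers_nonempty by blast
  then have w0W: "w0 \<in> W" by (simp add: saddle.maximizers_def)
  have ge: "saddle.saddle_value \<le> risk M \<alpha> W (Z x)" if x: "x \<in> X" for x
  proof -
    have "bdd_above ((\<lambda>w. AVaR_mixture M \<alpha> w (Z x)) ` W)"
    proof (rule bdd_aboveI2)
      fix w assume w: "w \<in> W"
      show "AVaR_mixture M \<alpha> w (Z x) \<le> support_fun W (A (x, 0))"
        using AVaR_mixture_le_inner_A[OF w, of "(x, 0)"] inner_le_support_fun[OF compact_W W(1) w, of "A (x, 0)"] x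
        by simp
    qed
    then have "AVaR_mixture M \<alpha> w0 (Z x) \<le> risk M \<alpha> W (Z x)"
      unfolding risk_def by (rule cSUP_upper[OF w0W])
    with saddle_value_le_AVaR_mixture[OF w0 x] show ?thesis by linarith
  qed
  have "risk M \<alpha> W (Z (fst y0)) \<le> saddle.saddle_value"
    unfolding risk_def by (intro cSUP_least W AVaR_mixture_le_saddle_value[OF y0])
  with ge[OF x0] have "risk M \<alpha> W (Z (fst y0)) = saddle.saddle_value" by simp
  then show ?thesis
    unfolding opt_value_def by (intro cInf_eq_minimum) (use x0 ge in \<open>auto intro: rev_image_eqI\<close>)
qed

end

section \<open>Sample average approximation\<close>

text \<open>Uniform on the sample indices rather than on the sample values: every function of the
  index is measurable, and repeated values need no special care. The empty sample has no such
  distribution, hence the condition N > 0 in the lemmas below.\<close>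

definition empirical :: "nat \<Rightarrow> nat measure" where
  "empirical N = measure_pmf (pmf_of_set {..<N})"

lemma prob_space_empirical: "prob_space (empirical N)"
  unfolding empirical_def by (rule prob_space_measure_pmf)

lemma integrable_empirical: "N > 0 \<Longrightarrow> integrable (empirical N) (f :: nat \<Rightarrow> real)"
  unfolding empirical_def by (rule integrable_measure_pmf_finite) (simp add: lessThan_empty_iff)

lemma integral_empirical: "N > 0 \<Longrightarrow> (\<integral>j. f j \<partial>empirical N) = (\<Sum>j<N. f j :: real) / real N"
  unfolding empirical_def by (subst integral_pmf_of_set) (auto simp: lessThan_empty_iff)

lemma AE_empirical: "N > 0 \<Longrightarrow> (\<And>j. j < N \<Longrightarrow> P j) \<Longrightarrow> AE j in empirical N. P j"
  unfolding empirical_def by (subst AE_measure_pmf_iff) (auto simp: lessThan_empty_iff)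

lemma inner_mean_cost_empirical:
  assumes "N > 0"
  shows "inner w (mean_cost (empirical N) \<alpha> z \<tau>) = (\<Sum>j<N. phi \<alpha> (z j) w \<tau>) / real N"
    and "inner w (mean_cost (empirical N) \<alpha> z \<tau>) =
      fst w / real N * (\<Sum>j<N. z j) +
        (\<Sum>i\<in>UNIV. snd w $ i * (\<tau> $ i + 1 / (real N * (1 - \<alpha> $ i)) * (\<Sum>j<N. max (z j - \<tau> $ i) 0)))"
  using prob_space.integral_phi(2)[OF prob_space_empirical integrable_empirical[OF assms], of \<alpha> z w \<tau>]
  by (simp_all add: integral_empirical[OF assms] inner_mean_cost mult_ac)

section \<open>Pointwise Lipschitz and growth bounds for the cost\<close>

definition loss_vector :: "real ^ 'k \<Rightarrow> real \<Rightarrow> real ^ 'k \<Rightarrow> real \<times> (real ^ 'k)" where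
  "loss_vector \<alpha> z \<tau> = (z, \<chi> i. \<tau> $ i + 1 / (1 - \<alpha> $ i) * max (z - \<tau> $ i) 0)"

lemma phi_eq_inner: "phi \<alpha> z w \<tau> = inner w (loss_vector \<alpha> z \<tau>)"
  by (simp add: phi_def loss_vector_def inner_prod_def inner_vec_def)

text \<open>The sum of the Lipschitz constants of the components of \<open>loss_vector\<close>, with
  respect to |z - z'| + norm (\<tau> - \<tau>').\<close>

definition lip_const :: "real ^ 'k \<Rightarrow> real" where
  "lip_const \<alpha> = 1 + (\<Sum>i\<in>UNIV. 1 + 1 / (1 - \<alpha> $ i))"

lemma norm_loss_vector_diff:
  assumes \<alpha>: "\<And>i. 0 < \<alpha> $ i \<and> \<alpha> $ i < 1"
  shows "norm (loss_vector \<alpha> z \<tau> - loss_vector \<alpha> z' \<tau>') \<le> lip_const \<alpha> * (\<bar>z - z'\<bar> + norm (\<tau> - \<tau>'))"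
proof -
  define d where "d = \<bar>z - z'\<bar> + norm (\<tau> - \<tau>')"
  have comp: "\<bar>(\<tau> $ i + 1 / (1 - \<alpha> $ i) * max (z - \<tau> $ i) 0) - (\<tau>' $ i + 1 / (1 - \<alpha> $ i) * max (z' - \<tau>' $ i) 0)\<bar>
      \<le> (1 + 1 / (1 - \<alpha> $ i)) * d" for i
  proof -
    have t: "\<bar>\<tau> $ i - \<tau>' $ i\<bar> \<le> norm (\<tau> - \<tau>')" using component_le_norm_cart[of "\<tau> - \<tau>'" i] by simp
    then have "\<bar>max (z - \<tau> $ i) 0 - max (z' - \<tau>' $ i) 0\<bar> \<le> d" unfolding d_def by linarith
    then have "\<bar>1 / (1 - \<alpha> $ i) * (max (z - \<tau> $ i) 0 - max (z' - \<tau>' $ i) 0)\<bar> \<le> 1 / (1 - \<alpha> $ i) * d"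
      using \<alpha>[of i] unfolding abs_mult by (intro mult_mono) auto
    moreover have "\<bar>\<tau> $ i - \<tau>' $ i\<bar> \<le> d" using t unfolding d_def by linarith
    ultimately show ?thesis unfolding distrib_right right_diff_distrib by linarith
  qed
  have "norm (loss_vector \<alpha> z \<tau> - loss_vector \<alpha> z' \<tau>') \<le> \<bar>z - z'\<bar> +
     norm (\<chi> i. (\<tau> $ i + 1 / (1 - \<alpha> $ i) * max (z - \<tau> $ i) 0) - (\<tau>' $ i + 1 / (1 - \<alpha> $ i) * max (z' - \<tau>' $ i) 0))"
  proof -
    have "loss_vector \<alpha> z \<tau> - loss_vector \<alpha> z' \<tau>' = (z - z',
      \<chi> i. (\<tau> $ i + 1 / (1 - \<alpha> $ i) * max (z - \<tau> $ i) 0) - (\<tau>' $ i + 1 / (1 - \<alpha> $ i) * max (z' - \<tau>' $ i) 0))"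
      by (simp add: loss_vector_def vec_eq_iff)
    then show ?thesis unfolding real_norm_def[symmetric] by (simp only: norm_Pair_le)
  qed
  also have "\<dots> \<le> d + (\<Sum>i\<in>UNIV. (1 + 1 / (1 - \<alpha> $ i)) * d)"
    by (intro add_mono order_trans[OF norm_le_l1_cart sum_mono]) (use comp in \<open>auto simp: d_def\<close>)
  also have "\<dots> = lip_const \<alpha> * d" by (simp add: lip_const_def sum_distrib_right distrib_right)
  finally show ?thesis by (simp add: d_def)
qed

lemma norm_loss_vector:
  assumes \<alpha>: "\<And>i. 0 < \<alpha> $ i \<and> \<alpha> $ i < 1"
  shows "norm (loss_vector \<alpha> z \<tau>) \<le> lip_const \<alpha> * (\<bar>z\<bar> + norm \<tau>)"
proof -
  have "loss_vector \<alpha> 0 0 = 0" by (simp add: loss_vector_def zero_prod_def vec_eq_iff)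
  then show ?thesis using norm_loss_vector_diff[OF \<alpha>, of z \<tau> 0 0] by simp
qed

lemma lip_const_nonneg: "(\<And>i. 0 < \<alpha> $ i \<and> \<alpha> $ i < 1) \<Longrightarrow> lip_const \<alpha> \<ge> 0"
  unfolding lip_const_def by (intro add_nonneg_nonneg sum_nonneg) (auto simp: less_imp_le)

text \<open>Bilinearity splits the difference into w against a change of the loss vector and a
  change of w against the loss vector. The second part scales with the size of the loss, so a
  majorant of |G_x| enters the Lipschitz envelope later.\<close>

lemma phi_lipschitz:
  assumes \<alpha>: "\<And>i. 0 < \<alpha> $ i \<and> \<alpha> $ i < 1" and w: "w \<in> simplex_weights"
  shows "\<bar>phi \<alpha> z w \<tau> - phi \<alpha> z' w' \<tau>'\<bar> \<le>
    lip_const \<alpha> * (\<bar>z - z'\<bar> + norm (\<tau> - \<tau>')) + lip_const \<alpha> * (\<bar>z'\<bar> + norm \<tau>') * norm (w - w')"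
proof -
  have "phi \<alpha> z w \<tau> - phi \<alpha> z' w' \<tau>' =
      inner w (loss_vector \<alpha> z \<tau> - loss_vector \<alpha> z' \<tau>') + inner (w - w') (loss_vector \<alpha> z' \<tau>')"
    by (simp add: phi_eq_inner inner_diff_left inner_diff_right)
  then have "\<bar>phi \<alpha> z w \<tau> - phi \<alpha> z' w' \<tau>'\<bar> \<le>
      \<bar>inner w (loss_vector \<alpha> z \<tau> - loss_vector \<alpha> z' \<tau>')\<bar> + \<bar>inner (w - w') (loss_vector \<alpha> z' \<tau>')\<bar>"
    by (simp add: abs_triangle_ineq)
  also have "\<dots> \<le> norm w * norm (loss_vector \<alpha> z \<tau> - loss_vector \<alpha> z' \<tau>') + norm (w - w') * norm (loss_vector \<alpha> z' \<tau>')"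
    by (intro add_mono Cauchy_Schwarz_ineq2)
  also have "\<dots> \<le> 1 * (lip_const \<alpha> * (\<bar>z - z'\<bar> + norm (\<tau> - \<tau>'))) + norm (w - w') * (lip_const \<alpha> * (\<bar>z'\<bar> + norm \<tau>'))"
    by (intro add_mono mult_mono norm_loss_vector_diff norm_loss_vector \<alpha> norm_simplex_weights w)
       (auto simp: lip_const_nonneg \<alpha>)
  finally show ?thesis by (simp add: mult_ac)
qed

lemma abs_phi_le:
  assumes \<alpha>: "\<And>i. 0 < \<alpha> $ i \<and> \<alpha> $ i < 1" and w: "w \<in> simplex_weights"
  shows "\<bar>phi \<alpha> z w \<tau>\<bar> \<le> lip_const \<alpha> * (\<bar>z\<bar> + norm \<tau>)"
proof -
  have "\<bar>phi \<alpha> z w \<tau>\<bar> \<le> norm w * norm (loss_vector \<alpha> z \<tau>)"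
    unfolding phi_eq_inner by (rule Cauchy_Schwarz_ineq2)
  also have "\<dots> \<le> 1 * (lip_const \<alpha> * (\<bar>z\<bar> + norm \<tau>))"
    by (intro mult_mono norm_loss_vector \<alpha> norm_simplex_weights w) auto
  finally show ?thesis by simp
qed

lemma integrable_square_add:
  fixes f g :: "'b \<Rightarrow> real"
  assumes "f \<in> borel_measurable M" "g \<in> borel_measurable M"
    and "integrable M (\<lambda>x. (f x)\<^sup>2)" "integrable M (\<lambda>x. (g x)\<^sup>2)"
  shows "integrable M (\<lambda>x. (f x + g x)\<^sup>2)"
proof (rule Bochner_Integration.integrable_bound)
  show "integrable M (\<lambda>x. 2 * (f x)\<^sup>2 + 2 * (g x)\<^sup>2)" using assms by simp
  have "(f x + g x)\<^sup>2 \<le> 2 * (f x)\<^sup>2 + 2 * (g x)\<^sup>2" for x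
    using zero_le_power2[of "f x - g x"] by (simp add: power2_sum power2_diff)
  then show "AE x in M. norm ((f x + g x)\<^sup>2) \<le> norm (2 * (f x)\<^sup>2 + 2 * (g x)\<^sup>2)" by simp
qed (use assms in measurable)

locale saa_problem = prob_space M for M :: "'w measure" +
  fixes \<xi> :: "'w \<Rightarrow> 's::topological_space" and \<xi>s :: "nat \<Rightarrow> 'w \<Rightarrow> 's" and \<Xi> :: "'s set"
    and X :: "'x::euclidean_space set" and G :: "'x \<Rightarrow> 's \<Rightarrow> real" and C :: "'s \<Rightarrow> real"
    and \<alpha> :: "real ^ 'k" and W :: "(real \<times> (real ^ 'k)) set"
  assumes X: "X \<noteq> {}" "compact X" "convex X"
    and \<alpha>: "\<And>i. 0 < \<alpha> $ i \<and> \<alpha> $ i < 1"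
    and W: "W \<noteq> {}" "closed W" "convex W" "W \<subseteq> simplex_weights"
    and W_nonzero: "\<And>i. \<exists>w\<in>W. snd w $ i \<noteq> 0"
    and xi_meas [measurable]: "\<xi> \<in> borel_measurable M"
    and xi_supp: "AE z in distr M borel \<xi>. z \<in> \<Xi>"
    and sample_indep: "indep_vars (\<lambda>_. borel) \<xi>s UNIV"
    and sample_distr: "\<And>j. distr M borel (\<xi>s j) = distr M borel \<xi>"
    and G_meas: "\<And>x. x \<in> X \<Longrightarrow> G x \<in> borel_measurable borel"
    and G_convex: "\<And>z. z \<in> \<Xi> \<Longrightarrow> convex_on X (\<lambda>x. G x z)"
    and G_square_int: "\<exists>x\<in>X. integrable M (\<lambda>\<omega>. (G x (\<xi> \<omega>))\<^sup>2)"
    and C_meas [measurable]: "C \<in> borel_measurable borel"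
    and C_square_int: "integrable M (\<lambda>\<omega>. (C (\<xi> \<omega>))\<^sup>2)"
    and G_Lipschitz: "\<And>x x' z. x \<in> X \<Longrightarrow> x' \<in> X \<Longrightarrow> z \<in> \<Xi> \<Longrightarrow> \<bar>G x z - G x' z\<bar> \<le> C z * norm (x - x')"
begin

sublocale iid: iid_sample M borel "distr M borel \<xi>" \<xi>s
  by unfold_locales (use sample_indep sample_distr in auto)

abbreviation "D \<equiv> distr M borel \<xi>"

definition base where "base = (SOME x. x \<in> X \<and> integrable M (\<lambda>\<omega>. (G x (\<xi> \<omega>))\<^sup>2))"
text \<open>Some bound on the distances to \<open>base\<close>, not the diameter proper.\<close>

definition diam where "diam = (SOME b. \<forall>x\<in>X. norm (x - base) \<le> b)"
definition envelope where "envelope z = \<bar>G base z\<bar> + diam * \<bar>C z\<bar>"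

lemma base: "base \<in> X" "integrable M (\<lambda>\<omega>. (G base (\<xi> \<omega>))\<^sup>2)"
  using someI_ex[of "\<lambda>x. x \<in> X \<and> integrable M (\<lambda>\<omega>. (G x (\<xi> \<omega>))\<^sup>2)"] G_square_int
  unfolding base_def by blast+

lemma diam: "x \<in> X \<Longrightarrow> norm (x - base) \<le> diam"
proof -
  have "\<exists>b. \<forall>x\<in>X. norm (x - base) \<le> b"
    using bounded_translation[OF compact_imp_bounded[OF X(2)], of "- base"] by (auto simp: bounded_iff)
  from someI_ex[OF this] show "x \<in> X \<Longrightarrow> norm (x - base) \<le> diam" unfolding diam_def by blast
qed

lemma diam_nonneg: "diam \<ge> 0"
  using diam[OF base(1)] by simp

lemma envelope_nonneg: "envelope z \<ge> 0"
  by (simp add: envelope_def diam_nonneg)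

lemma abs_G_le_envelope:
  assumes "x \<in> X" "z \<in> \<Xi>"
  shows "\<bar>G x z\<bar> \<le> envelope z"
proof -
  have "\<bar>G x z - G base z\<bar> \<le> C z * norm (x - base)" using G_Lipschitz[OF assms(1) base(1) assms(2)] .
  also have "\<dots> \<le> \<bar>C z\<bar> * norm (x - base)" by (intro mult_right_mono) auto
  also have "\<dots> \<le> \<bar>C z\<bar> * diam" by (intro mult_left_mono diam assms) simp
  finally show ?thesis by (simp add: envelope_def mult.commute)
qed

lemma borel_measurable_G_base [measurable]: "G base \<in> borel_measurable borel"
  by (rule G_meas[OF base(1)])

lemma borel_measurable_envelope [measurable]: "envelope \<in> borel_measurable borel"
  unfolding envelope_def[abs_def] by measurable

lemma C_square_int_D: "integrable D (\<lambda>z. (C z)\<^sup>2)"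
  using C_square_int by (simp add: integrable_distr_eq)

lemma envelope_square_int: "integrable D (\<lambda>z. (envelope z)\<^sup>2)"
  unfolding envelope_def
proof (rule integrable_square_add)
  show "integrable D (\<lambda>z. \<bar>G base z\<bar>\<^sup>2)" using base(2) by (simp add: integrable_distr_eq)
  show "integrable D (\<lambda>z. (diam * \<bar>C z\<bar>)\<^sup>2)" using C_square_int_D by (simp add: power_mult_distrib)
qed measurable

lemma envelope_int: "integrable D envelope"
  by (rule iid.D.square_integrable_imp_integrable[OF _ envelope_square_int]) measurable

lemma AE_xi: "AE \<omega> in M. \<xi> \<omega> \<in> \<Xi>"
  by (rule AE_distrD[OF xi_meas xi_supp])

lemma G_square_int_D: "x \<in> X \<Longrightarrow> integrable D (\<lambda>z. (G x z)\<^sup>2)"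
proof (rule Bochner_Integration.integrable_bound[OF envelope_square_int])
  assume x: "x \<in> X"
  show "(\<lambda>z. (G x z)\<^sup>2) \<in> borel_measurable D" using G_meas[OF x] by measurable
  show "AE z in D. norm ((G x z)\<^sup>2) \<le> norm ((envelope z)\<^sup>2)"
    using xi_supp by eventually_elim
      (use abs_G_le_envelope[OF x] envelope_nonneg in \<open>auto simp: abs_le_square_iff[symmetric]\<close>)
qed

lemma G_int_D: "x \<in> X \<Longrightarrow> integrable D (G x)"
  using iid.D.square_integrable_imp_integrable[OF _ G_square_int_D] G_meas by simp

lemma G_int: "x \<in> X \<Longrightarrow> integrable M (\<lambda>\<omega>. G x (\<xi> \<omega>))"
  using integrable_distr[OF xi_meas G_int_D] .

sublocale true: cvar_problem M \<alpha> W X "\<lambda>x \<omega>. G x (\<xi> \<omega>)" "\<lambda>\<omega>. C (\<xi> \<omega>)"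
proof
  show "integrable M (\<lambda>\<omega>. C (\<xi> \<omega>))"
    by (rule square_integrable_imp_integrable[OF _ C_square_int]) measurable
  show "AE \<omega> in M. \<forall>x\<in>X. \<forall>x'\<in>X. \<bar>G x (\<xi> \<omega>) - G x' (\<xi> \<omega>)\<bar> \<le> C (\<xi> \<omega>) * norm (x - x')"
    using AE_xi by eventually_elim (use G_Lipschitz in blast)
  show "AE \<omega> in M. convex_on X (\<lambda>x. G x (\<xi> \<omega>))"
    using AE_xi by eventually_elim (use G_convex in blast)
qed (use X \<alpha> W W_nonzero G_int in auto)

definition sample_cost :: "nat \<Rightarrow> 'w \<Rightarrow> 'x \<times> (real ^ 'k) \<Rightarrow> real \<times> (real ^ 'k)" where
  "sample_cost N \<omega> y = mean_cost (empirical N) \<alpha> (\<lambda>j. G (fst y) (\<xi>s j \<omega>)) (snd y)"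

definition in_support where "in_support \<omega> \<longleftrightarrow> (\<forall>j. \<xi>s j \<omega> \<in> \<Xi>)"

lemma AE_in_support: "AE \<omega> in M. in_support \<omega>"
  unfolding in_support_def using iid.AE_sample[OF xi_supp] by (simp add: AE_all_countable)

text \<open>Convexity and the Lipschitz bound hold at the sample values because
  \<open>in_support\<close> keeps them in \<Xi>; integrability is automatic for a distribution with
  finite support.\<close>

lemma cvar_problem_sample:
  assumes "N > 0" "in_support \<omega>"
  shows "cvar_problem (empirical N) \<alpha> W X (\<lambda>x j. G x (\<xi>s j \<omega>)) (\<lambda>j. C (\<xi>s j \<omega>))"
proof -
  interpret E: prob_space "empirical N" by (rule prob_space_empirical)
  show ?thesis
    by unfold_locales
       (use assms X \<alpha> W W_nonzero G_Lipschitz G_convex in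
         \<open>auto simp: in_support_def intro!: integrable_empirical AE_empirical\<close>)
qed


lemma saa_value_eq:
  assumes "N > 0"
  shows "saa_value \<alpha> W X G N (\<lambda>j. \<xi>s j \<omega>) = (INF y\<in>X \<times> UNIV. support_fun W (sample_cost N \<omega> y))"
  by (simp add: saa_value_def support_fun_def sample_cost_def split_beta inner_mean_cost_empirical(1)[OF assms])

abbreviation saa :: "nat \<Rightarrow> 'w \<Rightarrow> real" where
  "saa N \<omega> \<equiv> saa_value \<alpha> W X G N (\<lambda>j. \<xi>s j \<omega>)"

definition limit_value :: "nat \<Rightarrow> 'w \<Rightarrow> real" where
  "limit_value N \<omega> = (INF y\<in>true.saddle.minimizers. support_fun true.saddle.maximizers (sample_cost N \<omega> y))"

text \<open>The parameter joins y and w, so that the modulus of continuity is joint in both, as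
  \<open>perturbation_stable\<close> demands.\<close>

definition \<psi> :: "('x \<times> (real ^ 'k)) \<times> (real \<times> (real ^ 'k)) \<Rightarrow> 's \<Rightarrow> real" where
  "\<psi> \<theta> z = phi \<alpha> (G (fst (fst \<theta>)) z) (snd \<theta>) (snd (fst \<theta>))"

lemma deviation_\<psi>:
  assumes "N > 0" "fst y \<in> X"
  shows "iid.deviation N \<omega> (\<psi> (y, w)) = real N * (inner w (sample_cost N \<omega> y) - inner w (true.A y))"
proof -
  have "\<psi> (y, w) \<in> borel_measurable borel"
    unfolding \<psi>_def phi_def using G_meas[OF assms(2)] by simp
  then have "(\<integral>z. \<psi> (y, w) z \<partial>D) = (\<integral>\<omega>. \<psi> (y, w) (\<xi> \<omega>) \<partial>M)" by (simp add: integral_distr)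
  also have "\<dots> = inner w (true.A y)" using assms by (simp add: \<psi>_def[abs_def] true.inner_A)
  finally show ?thesis
    using assms unfolding iid.deviation_def sample_cost_def inner_mean_cost_empirical(1)[OF assms(1)]
    by (simp add: sum_subtractf \<psi>_def[abs_def] right_diff_distrib)
qed

text \<open>The summand 1 leaves room for the sample mean of the envelope, which exceeds its
  expectation by at most 1 with high probability.\<close>

definition mean_bound where "mean_bound = (\<integral>z. envelope z \<partial>D) + 1"
text \<open>The summand 1 makes the box a neighbourhood of the minimizers in the \<tau>-direction,
  which \<open>K_absorbing\<close> relies on.\<close>

definition radius where "radius = box_radius \<alpha> W mean_bound + 1"
definition K :: "('x \<times> (real ^ 'k)) set" where "K = X \<times> tau_box radius"

lemma K: "compact K" "K \<subseteq> X \<times> UNIV"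
  unfolding K_def by (auto intro: compact_Times X compact_tau_box)

lemma minimizers_in_smaller_box: "true.saddle.minimizers \<subseteq> X \<times> tau_box (radius - 1)"
proof -
  have "(\<integral>\<omega>. \<bar>G x (\<xi> \<omega>)\<bar> \<partial>M) \<le> mean_bound" if x: "x \<in> X" for x
  proof -
    have "(\<integral>\<omega>. \<bar>G x (\<xi> \<omega>)\<bar> \<partial>M) = (\<integral>z. \<bar>G x z\<bar> \<partial>D)"
      using G_meas[OF x] by (simp add: integral_distr)
    also have "\<dots> \<le> (\<integral>z. envelope z \<partial>D)"
    proof (rule integral_mono_AE)
      show "AE z in D. \<bar>G x z\<bar> \<le> envelope z"
        using xi_supp by eventually_elim (rule abs_G_le_envelope[OF x])
    qed (use G_int_D[OF x] envelope_int in auto)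
    finally show ?thesis by (simp add: mean_bound_def)
  qed
  from true.minimizers_in_box[OF this] show ?thesis by (simp add: radius_def)
qed

lemma K_absorbing:
  assumes "y0 \<in> true.saddle.minimizers" "y \<in> X \<times> UNIV"
  shows "\<exists>t>0. t \<le> 1 \<and> (1 - t) *\<^sub>R y0 + t *\<^sub>R y \<in> K"
proof -
  have y0: "fst y0 \<in> X" "\<And>i. \<bar>snd y0 $ i\<bar> \<le> radius - 1"
    using minimizers_in_smaller_box assms(1) by (auto simp: tau_box_def)
  \<comment> \<open>A step of this size moves every coordinate of the \<tau>-part by at most 1, the
    slack built into \<open>radius\<close>.\<close>
  define t where "t = 1 / (1 + norm (snd y - snd y0))"
  have t: "t > 0" "t \<le> 1" by (auto simp: t_def add_pos_nonneg)
  have tn: "t * norm (snd y - snd y0) \<le> 1"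
    using add_pos_nonneg[of 1 "norm (snd y - snd y0)"] by (simp add: t_def pos_divide_le_eq)
  have "(1 - t) *\<^sub>R fst y0 + t *\<^sub>R fst y \<in> X"
    using X(3) y0(1) assms(2) t by (intro convexD) auto
  moreover have "\<bar>((1 - t) *\<^sub>R snd y0 + t *\<^sub>R snd y) $ i\<bar> \<le> radius" for i
  proof -
    have "((1 - t) *\<^sub>R snd y0 + t *\<^sub>R snd y) $ i = snd y0 $ i + t * (snd y - snd y0) $ i"
      by (simp add: algebra_simps)
    moreover have "\<bar>t * (snd y - snd y0) $ i\<bar> \<le> t * norm (snd y - snd y0)"
      unfolding abs_mult using t component_le_norm_cart[of "snd y - snd y0" i]
      by (intro mult_mono) auto
    ultimately show ?thesis using y0(2)[of i] tn by linarith
  qed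
  ultimately show ?thesis using t by (auto simp: K_def tau_box_def mem_Times_iff)
qed

lemma norm_tau_box: "\<tau> \<in> tau_box T \<Longrightarrow> norm \<tau> \<le> real CARD('k) * T" for \<tau> :: "real ^ 'k"
  using norm_le_l1_cart[of \<tau>] sum_bounded_above[of UNIV "\<lambda>i. \<bar>\<tau> $ i\<bar>" T]
  by (auto simp: tau_box_def)

text \<open>The first summand pays for changes of (x, \<tau>), the second for changes of w. The
  absolute value keeps the bound on norm \<tau> nonnegative irrespective of the sign of
  \<open>radius\<close>.\<close>

definition lip :: "'s \<Rightarrow> real" where
  "lip z = lip_const \<alpha> * (\<bar>C z\<bar> + 1) + lip_const \<alpha> * (envelope z + \<bar>real CARD('k) * radius\<bar>)"

lemma \<psi>_lipschitz:
  assumes \<theta>: "\<theta> \<in> K \<times> W" "\<theta>' \<in> K \<times> W" and z: "z \<in> \<Xi>"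
  shows "\<bar>\<psi> \<theta> z - \<psi> \<theta>' z\<bar> \<le> lip z * dist \<theta> \<theta>'"
proof -
  obtain x \<tau> w where t: "\<theta> = ((x, \<tau>), w)" by (metis surj_pair)
  obtain x' \<tau>' w' where t': "\<theta>' = ((x', \<tau>'), w')" by (metis surj_pair)
  have x: "x \<in> X" "x' \<in> X" and w: "w \<in> simplex_weights" and \<tau>': "\<tau>' \<in> tau_box radius"
    using \<theta> W(4) by (auto simp: t t' K_def)
  have c: "lip_const \<alpha> \<ge> 0" by (rule lip_const_nonneg[OF \<alpha>])
  have d: "norm (x - x') \<le> dist \<theta> \<theta>'" "norm (\<tau> - \<tau>') \<le> dist \<theta> \<theta>'" "norm (w - w') \<le> dist \<theta> \<theta>'"
    using dist_fst_le[of \<theta> \<theta>'] dist_snd_le[of \<theta> \<theta>'] dist_fst_le[of "fst \<theta>" "fst \<theta>'"] dist_snd_le[of "fst \<theta>" "fst \<theta>'"]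
    by (auto simp: t t' dist_norm)
  have "\<bar>G x z - G x' z\<bar> \<le> C z * norm (x - x')" by (rule G_Lipschitz[OF x z])
  also have "\<dots> \<le> \<bar>C z\<bar> * dist \<theta> \<theta>'" by (intro mult_mono d) auto
  finally have g: "\<bar>G x z - G x' z\<bar> + norm (\<tau> - \<tau>') \<le> (\<bar>C z\<bar> + 1) * dist \<theta> \<theta>'"
    using d(2) by (simp add: distrib_right)
  have "\<bar>G x' z\<bar> + norm \<tau>' \<le> envelope z + \<bar>real CARD('k) * radius\<bar>"
    using abs_G_le_envelope[OF x(2) z] norm_tau_box[OF \<tau>'] by linarith
  then have "lip_const \<alpha> * (\<bar>G x' z\<bar> + norm \<tau>') * norm (w - w') \<le>
     lip_const \<alpha> * (envelope z + \<bar>real CARD('k) * radius\<bar>) * dist \<theta> \<theta>'"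
    using c envelope_nonneg by (intro mult_mono d mult_left_mono) auto
  moreover have "lip_const \<alpha> * (\<bar>G x z - G x' z\<bar> + norm (\<tau> - \<tau>')) \<le> lip_const \<alpha> * ((\<bar>C z\<bar> + 1) * dist \<theta> \<theta>')"
    by (intro mult_left_mono g c)
  moreover have "\<bar>\<psi> \<theta> z - \<psi> \<theta>' z\<bar> \<le> lip_const \<alpha> * (\<bar>G x z - G x' z\<bar> + norm (\<tau> - \<tau>')) +
      lip_const \<alpha> * (\<bar>G x' z\<bar> + norm \<tau>') * norm (w - w')"
    unfolding \<psi>_def t t' fst_conv snd_conv by (rule phi_lipschitz[OF \<alpha> w])
  ultimately show ?thesis by (simp add: lip_def distrib_right mult.assoc)
qed

lemma lip_nonneg: "lip z \<ge> 0"
  unfolding lip_def using lip_const_nonneg[OF \<alpha>] envelope_nonneg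
  by (intro add_nonneg_nonneg mult_nonneg_nonneg) auto

lemma lip_measurable [measurable]: "lip \<in> borel_measurable borel"
  unfolding lip_def[abs_def] by measurable

lemma lip_square_int: "integrable D (\<lambda>z. (lip z)\<^sup>2)"
  unfolding lip_def power2_eq_square[symmetric]
proof (rule integrable_square_add)
  have "integrable D (\<lambda>z. (\<bar>C z\<bar> + 1)\<^sup>2)"
    by (rule integrable_square_add) (use C_square_int_D in auto)
  then show "integrable D (\<lambda>z. (lip_const \<alpha> * (\<bar>C z\<bar> + 1))\<^sup>2)" by (simp add: power_mult_distrib)
  have "integrable D (\<lambda>z. (envelope z + \<bar>real CARD('k) * radius\<bar>)\<^sup>2)"
    by (rule integrable_square_add) (use envelope_square_int in auto)
  then show "integrable D (\<lambda>z. (lip_const \<alpha> * (envelope z + \<bar>real CARD('k) * radius\<bar>))\<^sup>2)"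
    by (simp add: power_mult_distrib)
qed measurable

lemma \<psi>_measurable: "\<theta> \<in> K \<times> W \<Longrightarrow> \<psi> \<theta> \<in> borel_measurable borel"
  unfolding \<psi>_def phi_def using G_meas[of "fst (fst \<theta>)"] by (auto simp: K_def)

lemma \<psi>_square_int: "\<theta> \<in> K \<times> W \<Longrightarrow> integrable D (\<lambda>z. (\<psi> \<theta> z)\<^sup>2)"
proof -
  assume \<theta>: "\<theta> \<in> K \<times> W"
  then have x: "fst (fst \<theta>) \<in> X" and w: "snd \<theta> \<in> simplex_weights" using W(4) by (auto simp: K_def)
  define c where "c = norm (snd (fst \<theta>))"
  show ?thesis
  proof (rule Bochner_Integration.integrable_bound)
    have "integrable D (\<lambda>z. (\<bar>G (fst (fst \<theta>)) z\<bar> + c)\<^sup>2)"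
      by (rule integrable_square_add) (use G_square_int_D[OF x] G_meas[OF x] in auto)
    then show "integrable D (\<lambda>z. (lip_const \<alpha> * (\<bar>G (fst (fst \<theta>)) z\<bar> + c))\<^sup>2)"
      by (simp add: power_mult_distrib)
    show "AE z in D. norm ((\<psi> \<theta> z)\<^sup>2) \<le> norm ((lip_const \<alpha> * (\<bar>G (fst (fst \<theta>)) z\<bar> + c))\<^sup>2)"
    proof (rule AE_I2)
      fix z
      have "\<bar>\<psi> \<theta> z\<bar> \<le> lip_const \<alpha> * (\<bar>G (fst (fst \<theta>)) z\<bar> + c)"
        unfolding \<psi>_def c_def by (rule abs_phi_le[OF \<alpha> w])
      then have "\<bar>\<psi> \<theta> z\<bar>\<^sup>2 \<le> (lip_const \<alpha> * (\<bar>G (fst (fst \<theta>)) z\<bar> + c))\<^sup>2" by (intro power_mono) auto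
      then show "norm ((\<psi> \<theta> z)\<^sup>2) \<le> norm ((lip_const \<alpha> * (\<bar>G (fst (fst \<theta>)) z\<bar> + c))\<^sup>2)" by simp
    qed
  qed (use \<psi>_measurable[OF \<theta>] in measurable)
qed

lemma \<psi>_int: "\<theta> \<in> K \<times> W \<Longrightarrow> integrable D (\<psi> \<theta>)"
  using iid.D.square_integrable_imp_integrable[OF _ \<psi>_square_int] \<psi>_measurable by simp

lemma bounded_KW: "bounded (K \<times> W)"
  using compact_Times[OF K(1) true.compact_W] by (rule compact_imp_bounded)

text \<open>The deterministic core, at one outcome: \<open>mean\<close> places the sample minimizers
  in K, \<open>unif\<close> puts the sample saddle point near true solutions, and
  \<open>equi\<close>, divided by N, supplies the error \<epsilon> / sqrt N.\<close>

lemma saa_value_close: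
  assumes N: "N > 0" and supp: "in_support \<omega>" and h: "h > 0"
    and stable: "true.saddle.perturbation_stable K h \<eta>"
    and mean: "\<bar>iid.deviation N \<omega> envelope\<bar> \<le> 1 * real N"
    and unif: "\<forall>\<theta>\<in>K \<times> W. \<bar>iid.deviation N \<omega> (\<psi> \<theta>)\<bar> \<le> \<eta> * real N"
    and equi: "iid.modulus_le N \<omega> \<psi> (K \<times> W) h (\<epsilon> * sqrt (real N))"
  shows "\<bar>sqrt (real N) * (saa N \<omega> - limit_value N \<omega>)\<bar> \<le> \<epsilon>"
proof -
  interpret E: cvar_problem "empirical N" \<alpha> W X "\<lambda>x j. G x (\<xi>s j \<omega>)" "\<lambda>j. C (\<xi>s j \<omega>)"
    by (rule cvar_problem_sample[OF N supp])
  have EA: "E.A = sample_cost N \<omega>"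
    by (simp add: fun_eq_iff E.A_def sample_cost_def)
  have Nr: "real N > 0" using N by simp
  have dev: "inner w (sample_cost N \<omega> y) - inner w (true.A y) = iid.deviation N \<omega> (\<psi> (y, w)) / real N"
    if "y \<in> K" for y w
    using deviation_\<psi>[OF N, of y \<omega> w] that Nr by (auto simp: K_def)
  have "\<bar>saa N \<omega> - limit_value N \<omega>\<bar> \<le> \<epsilon> / sqrt (real N)"
    unfolding saa_value_eq[OF N] limit_value_def EA[symmetric] E.saddle.saddle_value_def[symmetric]
  proof (rule true.saddle.perturbation_stableD[OF stable])
    show "bilinear_saddle W (1, \<chi> i. 1) (X \<times> UNIV) E.A" by (rule E.saddle.bilinear_saddle_axioms)
    have "(\<integral>j. \<bar>G x (\<xi>s j \<omega>)\<bar> \<partial>empirical N) \<le> mean_bound" if x: "x \<in> X" for x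
    proof -
      have "(\<Sum>j<N. \<bar>G x (\<xi>s j \<omega>)\<bar>) \<le> (\<Sum>j<N. envelope (\<xi>s j \<omega>))"
        using supp by (intro sum_mono abs_G_le_envelope[OF x]) (simp add: in_support_def)
      also have "\<dots> = iid.deviation N \<omega> envelope + real N * (\<integral>z. envelope z \<partial>D)"
        by (simp add: iid.deviation_def sum_subtractf)
      also have "\<dots> \<le> mean_bound * real N" using mean by (simp add: mean_bound_def algebra_simps)
      finally show ?thesis using Nr by (simp add: integral_empirical[OF N] pos_divide_le_eq)
    qed
    from E.minimizers_in_box[OF this] have "E.saddle.minimizers \<subseteq> K"
      using tau_box_mono[of "radius - 1" radius] by (auto simp: K_def radius_def)
    with E.saddle.minimizers_nonempty show "E.saddle.minimizers \<inter> K \<noteq> {}" by blast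
  next
    fix y w assume "y \<in> K" "w \<in> W"
    then show "\<bar>inner w (E.A y) - inner w (true.A y)\<bar> \<le> \<eta>"
      using bspec[OF unif, of "(y, w)"] Nr by (simp add: EA dev abs_divide pos_divide_le_eq)
  next
    fix y y' w w' assume *: "y \<in> K" "y' \<in> K" "w \<in> W" "w' \<in> W" "dist (y, w) (y', w') \<le> h"
    then have "\<bar>iid.deviation N \<omega> (\<psi> (y, w)) - iid.deviation N \<omega> (\<psi> (y', w'))\<bar> / real N \<le> \<epsilon> * sqrt (real N) / real N"
      using equi by (intro divide_right_mono) auto
    also have "\<dots> = \<epsilon> / sqrt (real N)" using sqrt_divide_self_eq[of "real N"] by (simp add: divide_inverse mult.assoc)
    finally show "\<bar>(inner w (E.A y) - inner w (true.A y)) - (inner w' (E.A y') - inner w' (true.A y'))\<bar> \<le> \<epsilon> / sqrt (real N)"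
      using * by (simp add: EA dev diff_divide_distrib[symmetric] abs_divide)
  qed
  then have "sqrt (real N) * \<bar>saa N \<omega> - limit_value N \<omega>\<bar> \<le> \<epsilon>"
    using N by (simp add: pos_le_divide_eq mult.commute)
  then show ?thesis by (simp add: abs_mult)
qed

text \<open>The order of choices matters: \<epsilon> and p determine the scale h through
  equicontinuity, h determines the closeness \<eta> through stability, and only then is N taken
  large enough for the laws of large numbers.\<close>

theorem whp_saa_expansion:
  assumes \<epsilon>: "\<epsilon> > 0"
  shows "iid.whp (\<lambda>N \<omega>. \<bar>sqrt (real N) * (saa N \<omega> - limit_value N \<omega>)\<bar> \<le> \<epsilon>)"
  unfolding iid.whp_def
proof (intro allI impI)
  fix p :: real assume p: "p > 0"
  then have p2: "p / 2 > 0" by simp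
  obtain h where h: "h > 0" and equi: "\<forall>\<^sub>F N in sequentially. iid.likely (p / 2) (\<lambda>\<omega>.
    iid.modulus_le N \<omega> \<psi> (K \<times> W) h (\<epsilon> * sqrt (real N)))"
    using iid.stochastic_equicontinuity[OF bounded_KW \<psi>_measurable \<psi>_int lip_measurable lip_nonneg
          lip_square_int xi_supp \<psi>_lipschitz \<epsilon> p2] by blast
  have sub: "true.saddle.minimizers \<subseteq> K"
    using minimizers_in_smaller_box tau_box_mono[of "radius - 1" radius] by (auto simp: K_def)
  obtain \<eta> where \<eta>: "\<eta> > 0" and stable: "true.saddle.perturbation_stable K h \<eta>"
    using true.saddle.exists_perturbation_stable[OF K sub K_absorbing h] by blast
  have "iid.whp (\<lambda>N \<omega>. (in_support \<omega> \<and> \<bar>iid.deviation N \<omega> envelope\<bar> \<le> 1 * real N) \<and>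
      (\<forall>\<theta>\<in>K \<times> W. \<bar>iid.deviation N \<omega> (\<psi> \<theta>)\<bar> \<le> \<eta> * real N))"
    by (intro iid.whp_conj iid.whp_AE AE_in_support iid.whp_deviation_small envelope_square_int
        iid.whp_uniform_deviation_small[OF bounded_KW \<psi>_measurable \<psi>_square_int lip_measurable lip_nonneg
          lip_square_int xi_supp \<psi>_lipschitz] borel_measurable_envelope \<eta>) auto
  from iid.eventually_likely_conj[OF equi iid.whpD[OF this p2]] eventually_gt_at_top[of 0]
  show "\<forall>\<^sub>F N in sequentially. iid.likely p (\<lambda>\<omega>. \<bar>sqrt (real N) * (saa N \<omega> - limit_value N \<omega>)\<bar> \<le> \<epsilon>)"
  proof eventually_elim
    case (elim N)
    from elim(1) show ?case
      by (rule iid.likely_mono) (elim conjE, rule saa_value_close[OF elim(2) _ h stable])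
  qed
qed

end

section \<open>Measurability and limit distribution\<close>

text \<open>On the reals \<open>Inf\<close> depends only on the set of lower bounds, even where it is a junk value.\<close>

lemma INF_real_eq_if_dense:
  fixes F :: "'a::topological_space \<Rightarrow> real"
  assumes "continuous_on S F" "T \<subseteq> S" "S \<subseteq> closure T"
  shows "(INF y\<in>S. F y) = (INF y\<in>T. F y)"
proof -
  have "(\<forall>y\<in>S. c \<le> F y) \<longleftrightarrow> (\<forall>y\<in>T. c \<le> F y)" for c
  proof
    assume T: "\<forall>y\<in>T. c \<le> F y"
    have "closedin (top_of_set S) (S \<inter> F -` {c..})"
      by (intro continuous_closedin_preimage assms) simp
    then obtain U where U: "closed U" "S \<inter> F -` {c..} = S \<inter> U"
      unfolding closedin_closed by blast
    then have "T \<subseteq> U" using T assms(2) by auto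
    then have "S \<subseteq> U" using closure_minimal[OF _ U(1)] assms(3) by blast
    then show "\<forall>y\<in>S. c \<le> F y" using U(2) by auto
  qed (use assms(2) in blast)
  then have "(\<forall>x\<in>uminus ` F ` S. x \<le> z) \<longleftrightarrow> (\<forall>x\<in>uminus ` F ` T. x \<le> z)" for z
    by (simp add: minus_le_iff)
  then show ?thesis unfolding Inf_real_def Sup_real_def by simp
qed

lemma borel_measurable_completion_AE:
  assumes f: "f \<in> borel_measurable M" and eq: "AE x in M. f x = g x"
  shows "g \<in> borel_measurable (completion M)"
proof (rule measurableI)
  fix S :: "'b set" assume S: "S \<in> sets borel"
  have A: "f -` S \<inter> space M \<in> sets (completion M)" using measurable_sets[OF f S] by simp
  have ae: "AE x in completion M. x \<in> f -` S \<inter> space M \<longleftrightarrow> x \<in> g -` S \<inter> space (completion M)"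
    using AE_completion[OF eq] by eventually_elim auto
  show "g -` S \<inter> space (completion M) \<in> sets (completion M)"
    by (rule completion.in_sets_AE[OF ae A]) simp
qed simp

section \<open>Slutsky's lemma and scaling of the normal distribution\<close>

lemma cts_step_diff_le:
  assumes "x < y"
  shows "\<bar>cts_step x y a - cts_step x y b\<bar> \<le> \<bar>a - b\<bar> / (y - x)" "\<bar>cts_step x y a - cts_step x y b\<bar> \<le> 1"
proof -
  have eq: "cts_step x y u = max 0 (min 1 ((y - u) / (y - x)))" for u
    using assms by (auto simp: cts_step_def max_def min_def divide_le_0_iff divide_less_0_iff pos_le_divide_eq not_le)
  have "\<bar>a - b\<bar> / (y - x) = \<bar>(y - a) / (y - x) - (y - b) / (y - x)\<bar>"
    using assms by (simp add: diff_divide_distrib[symmetric] abs_divide abs_minus_commute)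
  then show "\<bar>cts_step x y a - cts_step x y b\<bar> \<le> \<bar>a - b\<bar> / (y - x)" unfolding eq by linarith
  show "\<bar>cts_step x y a - cts_step x y b\<bar> \<le> 1" unfolding eq by linarith
qed

lemma isCont_cts_step:
  assumes "x < y"
  shows "isCont (cts_step x y) a"
  by (rule continuous_on_interior[OF uniformly_continuous_imp_continuous[OF
        cts_step_uniformly_continuous[OF assms]]]) simp

text \<open>It suffices to test weak convergence against the functions \<open>cts_step\<close>,
  which are Lipschitz and have oscillation at most 1. Their expectations at V N and \<sigma> S N
  differ by the Lipschitz constant times \<delta>, plus the probability of a deviation beyond
  \<delta>.\<close>

lemma (in prob_space) slutsky:
  assumes [measurable]: "\<And>N. S N \<in> borel_measurable M" "\<And>N. V N \<in> borel_measurable M"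
    and weak: "weak_conv_m (\<lambda>N. distr M borel (S N)) \<nu>" and \<nu>: "real_distribution \<nu>"
    and diff: "tendsto_zero_in_prob M (\<lambda>N \<omega>. V N \<omega> - \<sigma> * S N \<omega>)"
  shows "weak_conv_m (\<lambda>N. distr M borel (V N)) (distr \<nu> borel (\<lambda>x. \<sigma> * x))"
proof (rule integral_cts_step_conv_imp_weak_conv)
  interpret \<nu>: real_distribution \<nu> by (rule \<nu>)
  show "real_distribution (distr M borel (V N))" for N by (rule real_distribution_distr) simp
  show "real_distribution (distr \<nu> borel (\<lambda>x. \<sigma> * x))" by (rule \<nu>.real_distribution_distr) simp
  fix x y :: real assume xy: "x < y"
  have [measurable]: "cts_step x y \<in> borel_measurable borel"
    by (intro borel_measurable_continuous_onI continuous_at_imp_continuous_on ballI isCont_cts_step xy)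
  have bounded: "norm (cts_step x y u) \<le> 1" for u using xy by (auto simp: cts_step_def field_simps)
  have int: "integrable M (\<lambda>\<omega>. cts_step x y (f \<omega>))" if [measurable]: "f \<in> borel_measurable M" for f
    by (rule integrable_const_bound[of _ 1]) (use bounded in auto)
  have "(\<lambda>N. integral\<^sup>L (distr M borel (S N)) (\<lambda>u. cts_step x y (\<sigma> * u))) \<longlonglongrightarrow> integral\<^sup>L \<nu> (\<lambda>u. cts_step x y (\<sigma> * u))"
  proof (rule weak_conv_imp_integral_bdd_continuous_conv[OF _ \<nu> weak, of _ 1])
    show "real_distribution (distr M borel (S N))" for N by (rule real_distribution_distr) simp
    show "isCont (\<lambda>u. cts_step x y (\<sigma> * u)) a" for a
      by (intro isCont_o2[OF _ isCont_cts_step[OF xy]] continuous_intros)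
  qed (rule bounded)
  then have lim: "(\<lambda>N. \<integral>\<omega>. cts_step x y (\<sigma> * S N \<omega>) \<partial>M) \<longlonglongrightarrow> integral\<^sup>L \<nu> (\<lambda>u. cts_step x y (\<sigma> * u))"
    by (simp add: integral_distr)
  have "(\<lambda>N. (\<integral>\<omega>. cts_step x y (V N \<omega>) \<partial>M) - (\<integral>\<omega>. cts_step x y (\<sigma> * S N \<omega>) \<partial>M)) \<longlonglongrightarrow> 0"
  proof (rule LIMSEQ_I)
    fix \<epsilon> :: real assume \<epsilon>: "\<epsilon> > 0"
    \<comment> \<open>The Lipschitz constant of \<open>cts_step x y\<close> is 1 / (y - x), so
      deviations up to \<delta> contribute at most \<epsilon> / 2.\<close>
    define \<delta> where "\<delta> = \<epsilon> / 2 * (y - x)"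
    have \<delta>: "\<delta> > 0" using \<epsilon> xy by (simp add: \<delta>_def)
    define B where "B N = {\<omega> \<in> space M. \<bar>V N \<omega> - \<sigma> * S N \<omega>\<bar> > \<delta>}" for N
    have B [measurable]: "B N \<in> events" for N unfolding B_def by measurable
    have "(\<lambda>N. prob (B N)) \<longlonglongrightarrow> 0" using diff \<delta> unfolding B_def tendsto_zero_in_prob_def by blast
    then obtain N0 where N0: "\<And>N. N \<ge> N0 \<Longrightarrow> prob (B N) < \<epsilon> / 2"
      using order_tendstoD(2)[of _ 0 sequentially "\<epsilon> / 2"] \<epsilon> by (auto simp: eventually_sequentially)
    have "norm ((\<integral>\<omega>. cts_step x y (V N \<omega>) \<partial>M) - (\<integral>\<omega>. cts_step x y (\<sigma> * S N \<omega>) \<partial>M) - 0) < \<epsilon>"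
      if N: "N \<ge> N0" for N
    proof -
      have "norm ((\<integral>\<omega>. cts_step x y (V N \<omega>) \<partial>M) - (\<integral>\<omega>. cts_step x y (\<sigma> * S N \<omega>) \<partial>M) - 0) =
          \<bar>\<integral>\<omega>. cts_step x y (V N \<omega>) - cts_step x y (\<sigma> * S N \<omega>) \<partial>M\<bar>"
        by (simp add: int)
      also have "\<dots> \<le> (\<integral>\<omega>. \<bar>cts_step x y (V N \<omega>) - cts_step x y (\<sigma> * S N \<omega>)\<bar> \<partial>M)"
        by (rule integral_abs_bound)
      also have "\<dots> \<le> (\<integral>\<omega>. \<epsilon> / 2 + indicat_real (B N) \<omega> \<partial>M)"
      proof (rule integral_mono)
        fix \<omega> assume \<omega>: "\<omega> \<in> space M"
        show "\<bar>cts_step x y (V N \<omega>) - cts_step x y (\<sigma> * S N \<omega>)\<bar> \<le> \<epsilon> / 2 + indicat_real (B N) \<omega>"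
        proof (cases "\<omega> \<in> B N")
          case True
          then show ?thesis using cts_step_diff_le(2)[OF xy, of "V N \<omega>" "\<sigma> * S N \<omega>"] \<epsilon> by simp
        next
          case False
          then have "\<bar>V N \<omega> - \<sigma> * S N \<omega>\<bar> / (y - x) \<le> \<delta> / (y - x)"
            using \<omega> xy by (intro divide_right_mono) (auto simp: B_def)
          also have "\<dots> = \<epsilon> / 2" unfolding \<delta>_def using xy by (intro nonzero_mult_div_cancel_right) simp
          finally have "\<bar>V N \<omega> - \<sigma> * S N \<omega>\<bar> / (y - x) \<le> \<epsilon> / 2" .
          from order_trans[OF cts_step_diff_le(1)[OF xy] this] show ?thesis using False by simp
        qed
      next
        show "integrable M (\<lambda>\<omega>. \<bar>cts_step x y (V N \<omega>) - cts_step x y (\<sigma> * S N \<omega>)\<bar>)"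
          by (intro integrable_abs Bochner_Integration.integrable_diff int) measurable
        show "integrable M (\<lambda>\<omega>. \<epsilon> / 2 + indicat_real (B N) \<omega>)"
          by (rule integrable_const_bound[of _ "\<epsilon> / 2 + 1"]) (use \<epsilon> in \<open>auto simp: indicator_def\<close>)
      qed
      also have "\<dots> = \<epsilon> / 2 + prob (B N)"
        by (simp add: prob_space emeasure_eq_measure)
      also have "\<dots> < \<epsilon>" using N0[OF N] by simp
      finally show ?thesis .
    qed
    then show "\<exists>N0. \<forall>N\<ge>N0. norm ((\<integral>\<omega>. cts_step x y (V N \<omega>) \<partial>M) - (\<integral>\<omega>. cts_step x y (\<sigma> * S N \<omega>) \<partial>M) - 0) < \<epsilon>"
      by blast
  qed
  from tendsto_add[OF this lim]
  show "(\<lambda>N. integral\<^sup>L (distr M borel (V N)) (cts_step x y)) \<longlonglongrightarrow> integral\<^sup>L (distr \<nu> borel (\<lambda>x. \<sigma> * x)) (cts_step x y)"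
    by (simp add: integral_distr)
qed

lemma distr_std_normal_scale:
  assumes "\<sigma> > 0"
  shows "distr std_normal_distribution borel (\<lambda>x. \<sigma> * x) = density lborel (\<lambda>t. ennreal (normal_density 0 \<sigma> t))"
proof -
  interpret N: prob_space std_normal_distribution
    using real_dist_normal_dist by (simp add: real_distribution_def)
  have "distributed std_normal_distribution lborel (\<lambda>x. x) (normal_density 0 1)"
    unfolding distributed_def by (auto intro: distr_id2)
  from N.normal_density_affine[OF this, of \<sigma> 0]
  have "distr std_normal_distribution lborel (\<lambda>x. \<sigma> * x) = density lborel (\<lambda>t. ennreal (normal_density 0 \<sigma> t))"
    using assms by (simp add: distributed_def)
  moreover have "distr std_normal_distribution borel (\<lambda>x. \<sigma> * x) = distr std_normal_distribution lborel (\<lambda>x. \<sigma> * x)"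
    by (rule distr_cong) auto
  ultimately show ?thesis by simp
qed

section \<open>Measurability of the sample value and the limit theorems\<close>

context saa_problem begin

lemma sample_cost_measurable:
  assumes "fst y \<in> X" "N > 0"
  shows "(\<lambda>\<omega>. sample_cost N \<omega> y) \<in> borel_measurable M"
proof -
  have [measurable]: "G (fst y) \<in> borel_measurable borel" by (rule G_meas[OF assms(1)])
  have "(\<lambda>\<omega>. inner (sample_cost N \<omega> y) b) \<in> borel_measurable M" for b
    unfolding sample_cost_def inner_commute[of _ b] inner_mean_cost_empirical(1)[OF assms(2)] phi_def
    by measurable
  then show ?thesis
    by (subst borel_measurable_euclidean_space) blast
qed

text \<open>A countable dense subset of Y' gives the same infimum wherever the sample cost is
  continuous in y. This continuity holds for samples inside \<Xi>, hence almost surely, which is why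
  measurability is with respect to the completion.\<close>

lemma INF_support_fun_measurable:
  assumes Y': "Y' \<subseteq> X \<times> UNIV" and W': "compact W'" "W' \<noteq> {}" and N: "N > 0"
  shows "(\<lambda>\<omega>. INF y\<in>Y'. support_fun W' (sample_cost N \<omega> y)) \<in> borel_measurable (completion M)"
proof -
  obtain T where T: "countable T" "T \<subseteq> Y'" "Y' \<subseteq> closure T" by (rule separable)
  show ?thesis
  proof (rule borel_measurable_completion_AE)
    show "(\<lambda>\<omega>. INF y\<in>T. support_fun W' (sample_cost N \<omega> y)) \<in> borel_measurable M"
    proof (rule borel_measurable_cINF_real[OF T(1)])
      fix y assume "y \<in> T"
      then have "(\<lambda>\<omega>. sample_cost N \<omega> y) \<in> borel_measurable M"
        using T(2) Y' N by (intro sample_cost_measurable) auto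
      moreover have "support_fun W' \<in> borel_measurable borel"
        by (intro borel_measurable_continuous_onI continuous_on_support_fun W')
      ultimately show "(\<lambda>\<omega>. support_fun W' (sample_cost N \<omega> y)) \<in> borel_measurable M"
        by (rule measurable_compose)
    qed
    show "AE \<omega> in M. (INF y\<in>T. support_fun W' (sample_cost N \<omega> y)) = (INF y\<in>Y'. support_fun W' (sample_cost N \<omega> y))"
      using AE_in_support
    proof eventually_elim
      case (elim \<omega>)
      interpret E: cvar_problem "empirical N" \<alpha> W X "\<lambda>x j. G x (\<xi>s j \<omega>)" "\<lambda>j. C (\<xi>s j \<omega>)"
        by (rule cvar_problem_sample[OF N elim])
      have "E.A = sample_cost N \<omega>" by (simp add: fun_eq_iff E.A_def sample_cost_def)
      then have "continuous_on Y' (\<lambda>y. support_fun W' (sample_cost N \<omega> y))"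
        using E.continuous_on_A Y'
        by (intro continuous_on_compose2[OF continuous_on_support_fun[OF W', of UNIV]])
           (auto intro: continuous_on_subset)
      from INF_real_eq_if_dense[OF this T(2,3)] show ?case by simp
    qed
  qed
qed

lemma saa_value_measurable:
  "N > 0 \<Longrightarrow> (\<lambda>\<omega>. saa N \<omega>) \<in> borel_measurable (completion M)"
  using INF_support_fun_measurable[OF order_refl true.compact_W W(1)] by (simp only: saa_value_eq)

lemma limit_value_measurable:
  assumes "N > 0"
  shows "limit_value N \<in> borel_measurable (completion M)"
proof -
  have "true.saddle.minimizers \<subseteq> X \<times> UNIV" unfolding true.saddle.minimizers_def by blast
  from INF_support_fun_measurable[OF this true.saddle.compact_maximizers true.saddle.maximizers_nonempty assms]
  show ?thesis by (simp only: limit_value_def[abs_def])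
qed

lemma scaled_saa_value_measurable:
  "(\<lambda>\<omega>. sqrt (real N) * (saa N \<omega> - c)) \<in> borel_measurable (completion M)"
\<comment> \<open>For the empty sample the factor sqrt 0 removes the unspecified value.\<close>
proof (cases "N = 0")
  case False
  then have [measurable]: "(\<lambda>\<omega>. saa N \<omega>) \<in> borel_measurable (completion M)"
    by (intro saa_value_measurable) simp
  show ?thesis by measurable
qed simp

text \<open>\<open>whp_saa_expansion\<close> controls outer probabilities; measurability with
  respect to the completion turns them into probabilities, bounded by those of the exceptional
  events.\<close>

theorem op_inv_sqrt_saa_expansion:
  "op_inv_sqrt M (\<lambda>N \<omega>. saa N \<omega> - limit_value N \<omega>)"
  unfolding op_inv_sqrt_def tendsto_zero_in_prob_def
proof (intro conjI allI impI)
  fix N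
  show "(\<lambda>\<omega>. sqrt (real N) * (saa N \<omega> - limit_value N \<omega>)) \<in> borel_measurable (completion M)"
  proof (cases "N = 0")
    case False
    then have [measurable]: "(\<lambda>\<omega>. saa N \<omega>) \<in> borel_measurable (completion M)"
      "limit_value N \<in> borel_measurable (completion M)"
      by (intro saa_value_measurable limit_value_measurable; simp)+
    show ?thesis by measurable
  qed simp
next
  fix \<epsilon> :: real assume \<epsilon>: "\<epsilon> > 0"
  interpret c: prob_space "completion M" by (rule prob_space_completion)
  let ?bad = "\<lambda>N. {\<omega> \<in> space (completion M).
    \<bar>sqrt (real N) * (saa N \<omega> - limit_value N \<omega>)\<bar> > \<epsilon>}"
  show "(\<lambda>N. c.prob (?bad N)) \<longlonglongrightarrow> 0"
  proof (rule LIMSEQ_I)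
    fix p :: real assume "p > 0"
    then have "p / 2 > 0" by simp
    from iid.whpD[OF whp_saa_expansion[OF \<epsilon>] this]
    obtain N0 where N0: "\<forall>N\<ge>N0. iid.likely (p / 2) (\<lambda>\<omega>. \<bar>sqrt (real N) * (saa N \<omega> - limit_value N \<omega>)\<bar> \<le> \<epsilon>)"
      unfolding eventually_sequentially by (rule exE)
    have small: "norm (c.prob (?bad N) - 0) < p" if N: "N \<ge> N0" for N
    proof -
      obtain E where E: "E \<in> events" "prob E \<le> p / 2"
        "\<forall>\<omega>\<in>space M - E. \<bar>sqrt (real N) * (saa N \<omega> - limit_value N \<omega>)\<bar> \<le> \<epsilon>"
        using N0[THEN spec, THEN mp, OF N] unfolding iid.likely_def by blast
      have "c.prob (?bad N) \<le> c.prob E"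
      proof (rule c.finite_measure_mono)
        show "?bad N \<subseteq> E"
        proof
          fix \<omega> assume "\<omega> \<in> ?bad N"
          then show "\<omega> \<in> E" using E(3)[rule_format, of \<omega>] by (cases "\<omega> \<in> E") (auto simp: not_le)
        qed
      qed (use E(1) in simp)
      also have "\<dots> \<le> p / 2" using E by simp
      finally show ?thesis using \<open>p > 0\<close> by simp
    qed
    show "\<exists>N0. \<forall>N\<ge>N0. norm (c.prob (?bad N) - 0) < p"
      by (intro exI[of _ N0] allI impI small)
  qed
qed

text \<open>The integrand \<open>phi\<close> without the constant sum of w_i \<tau>_i, which affects
  neither deviations nor the variance.\<close>

definition clt_loss :: "'x \<Rightarrow> real ^ 'k \<Rightarrow> real \<times> (real ^ 'k) \<Rightarrow> 's \<Rightarrow> real" where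
  "clt_loss x \<tau> w z = fst w * G x z + (\<Sum>i\<in>UNIV. snd w $ i / (1 - \<alpha> $ i) * max (G x z - \<tau> $ i) 0)"

text \<open>For singletons \<open>limit_value\<close> is the sample mean of one function, and by
  \<open>saddle_inner_eq\<close> the saddle value is its expectation. Hence the scaled error differs
  from the normalized sum \<open>S0\<close> by a term that tends to zero in probability.\<close>

theorem saa_value_clt:
  assumes max: "true.saddle.maximizers = {w}" and min: "true.saddle.minimizers = {(x, \<tau>)}"
  shows "converges_in_distribution (completion M)
     (\<lambda>N \<omega>. sqrt (real N) * (saa N \<omega> - true.saddle.saddle_value))
     (normal_law 0 (variance (\<lambda>\<omega>. clt_loss x \<tau> w (\<xi> \<omega>))))"
proof -
  let ?V = "\<lambda>N \<omega>. sqrt (real N) * (saa N \<omega> - true.saddle.saddle_value)"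
  interpret c: prob_space "completion M" by (rule prob_space_completion)
  have x: "x \<in> X" using min by (auto simp: true.saddle.minimizers_def)
  have w: "w \<in> W" using max by (auto simp: true.saddle.maximizers_def)
  have in_K: "((x, \<tau>), w) \<in> K \<times> W"
    using minimizers_in_smaller_box min w tau_box_mono[of "radius - 1" radius] by (auto simp: K_def)
  define g where "g = clt_loss x \<tau> w"
  have [measurable]: "G x \<in> borel_measurable borel" by (rule G_meas[OF x])
  have g [measurable]: "g \<in> borel_measurable borel" unfolding g_def clt_loss_def[abs_def] by measurable
  define k where "k = (\<Sum>i\<in>UNIV. snd w $ i * \<tau> $ i)"
  have \<psi>_g: "\<psi> ((x, \<tau>), w) = (\<lambda>z. g z + k)"
    by (simp add: fun_eq_iff \<psi>_def phi_def g_def clt_loss_def k_def distrib_left sum.distrib)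
  then have g_eq: "g = (\<lambda>z. \<psi> ((x, \<tau>), w) z + (- k))" by simp
  have g2: "integrable D (\<lambda>z. (g z)\<^sup>2)"
    unfolding g_eq by (rule integrable_square_add) (use \<psi>_square_int[OF in_K] \<psi>_measurable[OF in_K] in auto)
  have g1: "integrable D g" by (rule iid.D.square_integrable_imp_integrable[OF _ g2]) simp
  define m where "m = (\<integral>z. g z \<partial>D)"
  have dev: "iid.deviation N \<omega> (\<psi> ((x, \<tau>), w)) = (\<Sum>i<N. g (\<xi>s i \<omega>) - m)" for N \<omega>
  proof -
    have "(\<integral>z. g z + k \<partial>D) = m + k"
      using Bochner_Integration.integral_add[OF g1, of "\<lambda>_. k"] iid.D.prob_space unfolding m_def by simp
    then show ?thesis by (simp only: iid.deviation_def \<psi>_g) simp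
  qed
  have value_eq: "true.saddle.saddle_value = inner w (true.A (x, \<tau>))"
    using true.saddle.saddle_inner_eq[of "(x, \<tau>)" w] max min by simp
  have limit: "limit_value N \<omega> = inner w (sample_cost N \<omega> (x, \<tau>))" for N \<omega>
    by (simp add: limit_value_def max min support_fun_def)
  define S0 where "S0 N \<omega> = (\<Sum>i<N. g (\<xi>s i \<omega>) - m) / sqrt (real N)" for N \<omega>
  have [measurable]: "S0 N \<in> borel_measurable M" for N unfolding S0_def[abs_def] by measurable
  have diff: "?V N \<omega> - S0 N \<omega> = sqrt (real N) * (saa N \<omega> - limit_value N \<omega>)" for N \<omega>
  proof (cases "N = 0")
    case False
    then have "S0 N \<omega> = (real N / sqrt (real N)) * (limit_value N \<omega> - true.saddle.saddle_value)"
      using deviation_\<psi>[of N "(x, \<tau>)" \<omega> w] x by (simp add: S0_def dev[symmetric] limit value_eq)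
    then show ?thesis by (simp add: real_div_sqrt algebra_simps)
  qed (simp add: S0_def)
  have zero: "tendsto_zero_in_prob (completion M) (\<lambda>N \<omega>. ?V N \<omega> - S0 N \<omega>)"
    unfolding diff using op_inv_sqrt_saa_expansion by (simp add: op_inv_sqrt_def)
  define v where "v = variance (\<lambda>\<omega>. g (\<xi> \<omega>))"
  have m_xi: "m = (\<integral>\<omega>. g (\<xi> \<omega>) \<partial>M)" by (simp add: m_def integral_distr)
  have m_s: "(\<integral>\<omega>. g (\<xi>s n \<omega>) \<partial>M) = m" for n
    using iid.integral_sample[OF g] by (simp add: m_def)
  have var_D: "v = (\<integral>z. (g z - m)\<^sup>2 \<partial>D)"
    by (simp add: v_def m_xi integral_distr)
  have var_s: "variance (\<lambda>\<omega>. g (\<xi>s n \<omega>)) = v" for n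
    using iid.integral_sample[of "\<lambda>z. (g z - m)\<^sup>2" n] by (simp add: m_s var_D)
  have v0: "v \<ge> 0" unfolding var_D by simp
  have "weak_conv_m (\<lambda>N. distr (completion M) borel (?V N)) (normal_law 0 v)"
  proof (cases "v = 0")
    \<comment> \<open>The central limit theorem requires positive variance. For variance zero,
      \<open>g\<close> is almost surely constant along the sample, \<open>S0\<close> vanishes, and
      Slutsky's lemma yields the point mass.\<close>
    case True
    have "integrable D (\<lambda>z. (g z - m)\<^sup>2)"
      using integrable_square_add[of g D "\<lambda>_. - m"] g2 by simp
    then have "AE z in D. (g z - m)\<^sup>2 = 0"
      using True var_D integral_nonneg_eq_0_iff_AE[of D "\<lambda>z. (g z - m)\<^sup>2"] by simp
    then have "AE z in D. g z - m = 0" by eventually_elim simp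
    then have "AE \<omega> in M. \<forall>i. g (\<xi>s i \<omega>) - m = 0"
      using iid.AE_sample[of "\<lambda>z. g z - m = 0"] by (subst AE_all_countable) blast
    then have AE0: "AE \<omega> in completion M. \<forall>i. g (\<xi>s i \<omega>) - m = 0" by (rule AE_completion)
    have "distr (completion M) borel (S0 N) = return borel 0" for N
    proof -
      have "distr (completion M) borel (S0 N) = distr (completion M) borel (\<lambda>_. 0)"
        by (rule distr_cong_AE) (use AE0 in \<open>auto simp: S0_def intro: measurable_completion\<close>)
      then show ?thesis by (simp add: c.distr_const)
    qed
    then have "weak_conv_m (\<lambda>N. distr (completion M) borel (S0 N)) (return borel 0)"
      by (simp add: weak_conv_m_def weak_conv_def)
    moreover have "real_distribution (return borel (0 :: real))"
      by (simp add: real_distribution_def real_distribution_axioms_def prob_space_return)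
    moreover have "tendsto_zero_in_prob (completion M) (\<lambda>N \<omega>. ?V N \<omega> - 1 * S0 N \<omega>)"
      unfolding mult_1 by (rule zero)
    ultimately have "weak_conv_m (\<lambda>N. distr (completion M) borel (?V N)) (distr (return borel 0) borel (\<lambda>x. 1 * x))"
      by (intro c.slutsky[of S0] scaled_saa_value_measurable measurable_completion) auto
    then show ?thesis by (simp add: normal_law_def True distr_id2)
  next
    case False
    define \<sigma> where "\<sigma> = sqrt v"
    have \<sigma>: "\<sigma> > 0" "\<sigma>\<^sup>2 = v" using v0 False by (auto simp: \<sigma>_def)
    define S where "S N \<omega> = (\<Sum>i<N. g (\<xi>s i \<omega>) - m) / sqrt (real N * \<sigma>\<^sup>2)" for N \<omega>
    have [measurable]: "S N \<in> borel_measurable M" for N unfolding S_def[abs_def] by measurable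
    have "weak_conv_m (\<lambda>N. distr M borel (S N)) std_normal_distribution"
      unfolding S_def[abs_def]
    proof (rule central_limit_theorem[OF _ m_s \<sigma>(1)])
      show "indep_vars (\<lambda>_. borel) (\<lambda>n \<omega>. g (\<xi>s n \<omega>)) UNIV"
        by (rule indep_vars_compose2[OF sample_indep]) simp
      show "integrable M (\<lambda>\<omega>. (g (\<xi>s n \<omega>))\<^sup>2)" for n by (rule iid.integrable_sample[OF g2])
      show "variance (\<lambda>\<omega>. g (\<xi>s n \<omega>)) = \<sigma>\<^sup>2" for n by (simp add: var_s \<sigma>)
      show "distr M borel (\<lambda>\<omega>. g (\<xi>s n \<omega>)) = distr D borel g" for n
        using distr_distr[OF g iid.X_measurable, of n] by (simp add: sample_distr comp_def)
    qed
    then have weak: "weak_conv_m (\<lambda>N. distr (completion M) borel (S N)) std_normal_distribution"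
      by (simp add: distr_completion)
    have eq: "\<sigma> * S N \<omega> = S0 N \<omega>" for N \<omega>
      unfolding S_def S0_def \<sigma>(2) real_sqrt_mult \<sigma>_def[symmetric] using \<sigma>(1) by simp
    have "tendsto_zero_in_prob (completion M) (\<lambda>N \<omega>. ?V N \<omega> - \<sigma> * S N \<omega>)"
      unfolding eq by (rule zero)
    then have "weak_conv_m (\<lambda>N. distr (completion M) borel (?V N)) (distr std_normal_distribution borel (\<lambda>x. \<sigma> * x))"
      by (rule c.slutsky[OF _ _ weak real_dist_normal_dist, rotated -1])
         (use scaled_saa_value_measurable in \<open>auto intro: measurable_completion\<close>)
    then show ?thesis
      unfolding distr_std_normal_scale[OF \<sigma>(1)] using False by (simp add: normal_law_def \<sigma>_def)
  qed
  then show ?thesis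
    unfolding converges_in_distribution_def v_def g_def using scaled_saa_value_measurable by blast
qed

lemma limit_value_eq:
  assumes "N > 0"
  shows "limit_value N \<omega> =
    (INF (x, \<tau>)\<in>primal_solutions M \<alpha> W X (\<lambda>x \<omega>. G x (\<xi> \<omega>)).
      SUP w\<in>dual_solutions M \<alpha> W X (\<lambda>x \<omega>. G x (\<xi> \<omega>)).
        fst w / real N * (\<Sum>j<N. G x (\<xi>s j \<omega>)) +
        (\<Sum>i\<in>UNIV. snd w $ i *
           (\<tau> $ i + 1 / (real N * (1 - \<alpha> $ i)) * (\<Sum>j<N. max (G x (\<xi>s j \<omega>) - \<tau> $ i) 0))))"
  unfolding true.primal_solutions_eq true.dual_solutions_eq limit_value_def
proof (rule INF_cong[OF refl])
  fix y :: "'x \<times> (real ^ 'k)"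
  obtain x \<tau> where y: "y = (x, \<tau>)" by (cases y)
  show "support_fun true.saddle.maximizers (sample_cost N \<omega> y) =
    (case y of (x, \<tau>) \<Rightarrow> SUP w\<in>true.saddle.maximizers.
        fst w / real N * (\<Sum>j<N. G x (\<xi>s j \<omega>)) +
        (\<Sum>i\<in>UNIV. snd w $ i *
           (\<tau> $ i + 1 / (real N * (1 - \<alpha> $ i)) * (\<Sum>j<N. max (G x (\<xi>s j \<omega>) - \<tau> $ i) 0))))"
    unfolding y prod.case support_fun_def sample_cost_def fst_conv snd_conv
      inner_mean_cost_empirical(2)[OF assms] ..
qed

end

theorem theorem4p2:
  fixes M :: "'w measure"
    and \<xi> :: "'w \<Rightarrow> real ^ 'd"
    and \<xi>s :: "nat \<Rightarrow> 'w \<Rightarrow> real ^ 'd"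
    and \<Xi> :: "(real ^ 'd) set"
    and X :: "(real ^ 'm) set"
    and G :: "real ^ 'm \<Rightarrow> real ^ 'd \<Rightarrow> real"
    and C :: "real ^ 'd \<Rightarrow> real"
    and \<alpha> :: "(real, 'k :: {finite, linorder}) vec"
    and W :: "(real \<times> (real, 'k) vec) set"
  assumes prob: "prob_space M"
    and X_ne: "X \<noteq> {}" and X_compact: "compact X"
    and xi_meas: "\<xi> \<in> borel_measurable M"
    and xi_supp: "AE z in distr M borel \<xi>. z \<in> \<Xi>"
    and sample_indep: "prob_space.indep_vars M (\<lambda>_. borel) \<xi>s UNIV"
    and sample_distr: "\<And>j. distr M borel (\<xi>s j) = distr M borel \<xi>"
    and G_meas: "\<And>x. x \<in> X \<Longrightarrow> G x \<in> borel_measurable borel"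
    and G_int: "\<And>x. x \<in> X \<Longrightarrow> integrable M (\<lambda>\<omega>. G x (\<xi> \<omega>))"
    and alpha_bounds: "\<And>i. 0 < \<alpha> $ i \<and> \<alpha> $ i < 1"
    and alpha_increasing: "\<And>i j. i < j \<Longrightarrow> \<alpha> $ i < \<alpha> $ j"
    and W_ne: "W \<noteq> {}" and W_closed: "closed W" and W_convex: "convex W"
    and W_simplex: "W \<subseteq> simplex_weights"
    and X_convex: "convex X"
    and G_convex: "\<And>z. z \<in> \<Xi> \<Longrightarrow> convex_on X (\<lambda>x. G x z)"
    and W_nonzero: "\<And>i. \<exists>w\<in>W. snd w $ i \<noteq> 0"
    and G_square_int: "\<exists>x\<in>X. integrable M (\<lambda>\<omega>. (G x (\<xi> \<omega>))\<^sup>2)"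
    and C_meas: "C \<in> borel_measurable borel"
    and C_square_int: "integrable M (\<lambda>\<omega>. (C (\<xi> \<omega>))\<^sup>2)"
    and G_Lipschitz:
      "\<And>x x' z. x \<in> X \<Longrightarrow> x' \<in> X \<Longrightarrow> z \<in> \<Xi> \<Longrightarrow> \<bar>G x z - G x' z\<bar> \<le> C z * norm (x - x')"
  shows
    "op_inv_sqrt M
       (\<lambda>N \<omega>. saa_value \<alpha> W X G N (\<lambda>j. \<xi>s j \<omega>) -
         (INF (x, \<tau>)\<in>primal_solutions M \<alpha> W X (\<lambda>x \<omega>. G x (\<xi> \<omega>)).
          SUP w\<in>dual_solutions M \<alpha> W X (\<lambda>x \<omega>. G x (\<xi> \<omega>)).
            fst w / real N * (\<Sum>j<N. G x (\<xi>s j \<omega>)) +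
            (\<Sum>i\<in>UNIV. snd w $ i *
               (\<tau> $ i + 1 / (real N * (1 - \<alpha> $ i)) * (\<Sum>j<N. max (G x (\<xi>s j \<omega>) - \<tau> $ i) 0))))) \<and>
     (\<forall>w x \<tau>.
        dual_solutions M \<alpha> W X (\<lambda>x \<omega>. G x (\<xi> \<omega>)) = {w} \<longrightarrow>
        primal_solutions M \<alpha> W X (\<lambda>x \<omega>. G x (\<xi> \<omega>)) = {(x, \<tau>)} \<longrightarrow>
        converges_in_distribution (completion M)
          (\<lambda>N \<omega>. sqrt (real N) *
             (saa_value \<alpha> W X G N (\<lambda>j. \<xi>s j \<omega>) - opt_value M \<alpha> W X (\<lambda>x \<omega>. G x (\<xi> \<omega>))))
          (normal_law 0
             (prob_space.variance M
                (\<lambda>\<omega>. fst w * G x (\<xi> \<omega>) +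
                   (\<Sum>i\<in>UNIV. snd w $ i / (1 - \<alpha> $ i) * max (G x (\<xi> \<omega>) - \<tau> $ i) 0)))))"
proof -
  interpret prob_space M by (rule prob)
  interpret saa: saa_problem M \<xi> \<xi>s \<Xi> X G C \<alpha> W
    by unfold_locales (fact X_ne X_compact X_convex alpha_bounds W_ne W_closed W_convex W_simplex W_nonzero
        xi_meas xi_supp sample_indep sample_distr G_meas G_convex G_square_int C_meas C_square_int G_Lipschitz)+
  let ?L = "\<lambda>N \<omega>. INF (x, \<tau>)\<in>primal_solutions M \<alpha> W X (\<lambda>x \<omega>. G x (\<xi> \<omega>)).
          SUP w\<in>dual_solutions M \<alpha> W X (\<lambda>x \<omega>. G x (\<xi> \<omega>)).
            fst w / real N * (\<Sum>j<N. G x (\<xi>s j \<omega>)) +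
            (\<Sum>i\<in>UNIV. snd w $ i *
               (\<tau> $ i + 1 / (real N * (1 - \<alpha> $ i)) * (\<Sum>j<N. max (G x (\<xi>s j \<omega>) - \<tau> $ i) 0)))"
  \<comment> \<open>The explicit formula for \<open>limit_value\<close> holds for N > 0; at N = 0
    the factor sqrt 0 makes both sides zero.\<close>
  have eq: "sqrt (real N) * (saa_value \<alpha> W X G N (\<lambda>j. \<xi>s j \<omega>) - ?L N \<omega>) =
      sqrt (real N) * (saa_value \<alpha> W X G N (\<lambda>j. \<xi>s j \<omega>) - saa.limit_value N \<omega>)" for N \<omega>
    using saa.limit_value_eq[of N \<omega>] by (cases "N = 0") auto
  have "op_inv_sqrt M (\<lambda>N \<omega>. saa_value \<alpha> W X G N (\<lambda>j. \<xi>s j \<omega>) - ?L N \<omega>)"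
    unfolding op_inv_sqrt_def eq by (rule saa.op_inv_sqrt_saa_expansion[unfolded op_inv_sqrt_def])
  moreover have "converges_in_distribution (completion M)
      (\<lambda>N \<omega>. sqrt (real N) *
         (saa_value \<alpha> W X G N (\<lambda>j. \<xi>s j \<omega>) - opt_value M \<alpha> W X (\<lambda>x \<omega>. G x (\<xi> \<omega>))))
      (normal_law 0
         (prob_space.variance M
            (\<lambda>\<omega>. fst w * G x (\<xi> \<omega>) +
               (\<Sum>i\<in>UNIV. snd w $ i / (1 - \<alpha> $ i) * max (G x (\<xi> \<omega>) - \<tau> $ i) 0))))"
    if "dual_solutions M \<alpha> W X (\<lambda>x \<omega>. G x (\<xi> \<omega>)) = {w}"
      "primal_solutions M \<alpha> W X (\<lambda>x \<omega>. G x (\<xi> \<omega>)) = {(x, \<tau>)}" for w x \<tau>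
    using saa.saa_value_clt that
    unfolding saa.true.dual_solutions_eq saa.true.primal_solutions_eq saa.true.opt_value_eq saa.clt_loss_def
    by blast
  ultimately show ?thesis by blast
qed

end
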